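(* Up to equivalence, the only nonabelian $7$-dimensional nice nilpotent Lie algebra with a diagram involution $\sigma$ and a Ricci-flat $\sigma$-diagonal metric is \[(0,0,0,(\lambda-1)e^{12},\lambda e^{13},e^{23},e^{16}+e^{25}+e^{34}),\qquad \lambda\in\mathbb{R}\setminus\{0,1\},\] and this happens exactly in the following cases, where $S_\sigma(p,q)$ denotes the collection of sets $\{i:g_i<0\}$ of Ricci-flat $\sigma$-diagonal metrics $\sum g_ie^i\otimes e^{\sigma_i}$ of signature $(p,q)$: - $\sigma=(23)(45)$ and $\lambda=\tfrac12$, with $S_\sigma(4,3)=\{\{1\},\{2,3,7\},\{4,5,7\},\{1,2,3,4,5\}\}$ and $S_\sigma(3,4)=\{\{6,7\},\{1,2,3,6\},\{1,4,5,6\},\{2,3,4,5,6,7\}\}$; - $\sigma=(12)(56)$ and $\lambda=-1$, with $S_\sigma(4,3)=\{\{3\},\{1,2,7\},\{5,6,7\},\{1,2,3,5,6\}\}$ and $S_\sigma(3,4)=\{\{4,7\},\{1,2,3,4\},\{3,4,5,6\},\{1,2,4,5,6,7\}\}$; - $\sigma=(13)(46)$ and $\lambda=2$, with $S_\sigma(4,3)=\{\{2\},\{1,3,7\},\{4,6,7\},\{1,2,3,4,6\}\}$ and $S_\sigma(3,4)=\{\{5,7\},\{1,2,3,5\},\{2,4,5,6\},\{1,3,4,5,6,7\}\}$.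
   Context: A nice basis of a real Lie algebra is a basis $\{e_1,\dots,e_n\}$ with dual basis $\{e^i\}$ such that each $[e_i,e_j]$ is a multiple of some $e_h$ and each $e_i\lrcorner\,de^j$ is a multiple of some $e^h$, where $d$ is the Chevalley–Eilenberg differential. The notation $(\omega_1,\dots,\omega_n)$ denotes the Lie algebra with nice basis $e_1,\dots,e_n$ and $de^k=\omega_k$, $e^{ij}=e^i\wedge e^j$. Two nice Lie algebras are equivalent if there is a Lie algebra isomorphism mapping each basis element to a multiple of a basis element. A diagram involution is an order-two permutation $\sigma$ of $\{1,\dots,n\}$ such that $e_k$ is a nonzero multiple of $[e_i,e_j]$ iff $e_{\sigma_k}$ is a nonzero multiple of $[e_{\sigma_i},e_{\sigma_j}]$. A $\sigma$-diagonal metric is a nondegenerate scalar product $\sum_i g_ie^i\otimes e^{\sigma_i}$ with $g_i\neq0$ and $g_{\sigma_i}=g_i$ for all $i$. Ricci-flat means the Ricci tensor of the corresponding left-invariant pseudoriemannian metric vanishes. *)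

theory Defs
  imports "Jordan_Normal_Form.Char_Poly"
begin

abbreviation rng :: "nat \<Rightarrow> nat set" where "rng n \<equiv> {1..n}"

(* Structure constants: [e_i,e_j] = \<Sum>_k c i j k e_k (indices in 1..n). *)
type_synonym sconst = "nat \<Rightarrow> nat \<Rightarrow> nat \<Rightarrow> real"

definition lie_sc :: "nat \<Rightarrow> sconst \<Rightarrow> bool" where
  "lie_sc n c \<longleftrightarrow>
     (\<forall>i\<in>rng n. \<forall>j\<in>rng n. \<forall>k\<in>rng n. c i j k = - c j i k) \<and>
     (\<forall>i\<in>rng n. \<forall>j\<in>rng n. \<forall>k\<in>rng n. \<forall>l\<in>rng n.
        (\<Sum>m\<in>rng n. c i j m * c m k l + c j k m * c m i l + c k i m * c m j l) = 0)"

definition br :: "nat \<Rightarrow> sconst \<Rightarrow> (nat \<Rightarrow> real) \<Rightarrow> (nat \<Rightarrow> real) \<Rightarrow> (nat \<Rightarrow> real)" where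
  "br n c v w = (\<lambda>k. if k \<in> rng n then (\<Sum>i\<in>rng n. \<Sum>j\<in>rng n. v i * w j * c i j k) else 0)"

(* nilpotent: some term g^{N+1} of the lower central series vanishes, i.e. all
   iterated brackets [x_1,[x_2,...,[x_N,x]...]] vanish *)
definition nilpotent_sc :: "nat \<Rightarrow> sconst \<Rightarrow> bool" where
  "nilpotent_sc n c \<longleftrightarrow> (\<exists>N. \<forall>xs x. length xs = N \<longrightarrow>
      (\<forall>k\<in>rng n. foldr (br n c) xs x k = 0))"

definition nonabelian_sc :: "nat \<Rightarrow> sconst \<Rightarrow> bool" where
  "nonabelian_sc n c \<longleftrightarrow> (\<exists>i\<in>rng n. \<exists>j\<in>rng n. \<exists>k\<in>rng n. c i j k \<noteq> 0)"

(* nice basis: each [e_i,e_j] is a multiple of some e_h, and each e_i \<lrcorner> de^j is a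
   multiple of some e^h; here (e_i \<lrcorner> de^j)(e_h) = de^j(e_i,e_h) = - c i h j *)
definition nice_sc :: "nat \<Rightarrow> sconst \<Rightarrow> bool" where
  "nice_sc n c \<longleftrightarrow>
     (\<forall>i\<in>rng n. \<forall>j\<in>rng n. \<exists>h\<in>rng n. \<forall>k\<in>rng n. k \<noteq> h \<longrightarrow> c i j k = 0) \<and>
     (\<forall>i\<in>rng n. \<forall>j\<in>rng n. \<exists>h\<in>rng n. \<forall>k\<in>rng n. k \<noteq> h \<longrightarrow> c i k j = 0)"

definition nice_nilpotent_lie :: "nat \<Rightarrow> sconst \<Rightarrow> bool" where
  "nice_nilpotent_lie n c \<longleftrightarrow> lie_sc n c \<and> nice_sc n c \<and> nilpotent_sc n c"

(* equivalence: a Lie algebra isomorphism f with f(e_i) = a_i e_{\<pi> i};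
   bracket preservation f[e_i,e_j] = [f e_i, f e_j] written in coordinates *)
definition nice_equivalent :: "nat \<Rightarrow> sconst \<Rightarrow> sconst \<Rightarrow> bool" where
  "nice_equivalent n c c' \<longleftrightarrow> (\<exists>\<pi> a. bij_betw \<pi> (rng n) (rng n) \<and> (\<forall>i\<in>rng n. a i \<noteq> (0::real)) \<and>
     (\<forall>i\<in>rng n. \<forall>j\<in>rng n. \<forall>k\<in>rng n. c i j k * a k = a i * a j * c' (\<pi> i) (\<pi> j) (\<pi> k)))"

definition diag_edge :: "nat \<Rightarrow> sconst \<Rightarrow> nat \<Rightarrow> nat \<Rightarrow> nat \<Rightarrow> bool" where
  "diag_edge n c i j k \<longleftrightarrow> c i j k \<noteq> 0 \<and> (\<forall>m\<in>rng n. m \<noteq> k \<longrightarrow> c i j m = 0)"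

definition diagram_involution :: "nat \<Rightarrow> sconst \<Rightarrow> (nat \<Rightarrow> nat) \<Rightarrow> bool" where
  "diagram_involution n c \<sigma> \<longleftrightarrow>
     \<sigma> ` rng n \<subseteq> rng n \<and> (\<forall>i\<in>rng n. \<sigma> (\<sigma> i) = i) \<and> (\<exists>i\<in>rng n. \<sigma> i \<noteq> i) \<and>
     (\<forall>i\<in>rng n. \<forall>j\<in>rng n. \<forall>k\<in>rng n. diag_edge n c i j k \<longleftrightarrow> diag_edge n c (\<sigma> i) (\<sigma> j) (\<sigma> k))"

(* sigma-diagonal metric \<Sum> g_i e^i \<otimes> e^{\<sigma> i} *)
definition sigma_diagonal :: "nat \<Rightarrow> (nat \<Rightarrow> nat) \<Rightarrow> (nat \<Rightarrow> real) \<Rightarrow> bool" where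
  "sigma_diagonal n \<sigma> g \<longleftrightarrow> (\<forall>i\<in>rng n. g i \<noteq> 0 \<and> g (\<sigma> i) = g i)"

definition sdmetric :: "(nat \<Rightarrow> nat) \<Rightarrow> (nat \<Rightarrow> real) \<Rightarrow> nat \<Rightarrow> nat \<Rightarrow> real" where
  "sdmetric \<sigma> g a b = (if b = \<sigma> a then g a else 0)"

(* Levi-Civita connection of a left-invariant metric, \<nabla>_{e_i} e_j = \<Sum>_k \<Gamma> i j k e_k,
   characterised by the Koszul formula
   2<\<nabla>_X Y,Z> = <[X,Y],Z> - <[Y,Z],X> + <[Z,X],Y> *)
definition is_LC :: "nat \<Rightarrow> sconst \<Rightarrow> (nat \<Rightarrow> nat \<Rightarrow> real) \<Rightarrow> sconst \<Rightarrow> bool" where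
  "is_LC n c G \<Gamma> \<longleftrightarrow>
     (\<forall>i j k. \<not> (i \<in> rng n \<and> j \<in> rng n \<and> k \<in> rng n) \<longrightarrow> \<Gamma> i j k = 0) \<and>
     (\<forall>i\<in>rng n. \<forall>j\<in>rng n. \<forall>l\<in>rng n.
        2 * (\<Sum>k\<in>rng n. \<Gamma> i j k * G k l) =
        (\<Sum>m\<in>rng n. c i j m * G m l - c j l m * G m i + c l i m * G m j))"

definition LC :: "nat \<Rightarrow> sconst \<Rightarrow> (nat \<Rightarrow> nat \<Rightarrow> real) \<Rightarrow> sconst" where
  "LC n c G = (THE \<Gamma>. is_LC n c G \<Gamma>)"

(* R(e_a,e_b)e_c = \<nabla>_a\<nabla>_b e_c - \<nabla>_b\<nabla>_a e_c - \<nabla>_{[e_a,e_b]} e_c = \<Sum>_d curv a b c d e_d *)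
definition curv :: "nat \<Rightarrow> sconst \<Rightarrow> sconst \<Rightarrow> nat \<Rightarrow> nat \<Rightarrow> nat \<Rightarrow> nat \<Rightarrow> real" where
  "curv n c \<Gamma> a b e d = (\<Sum>m\<in>rng n. \<Gamma> b e m * \<Gamma> a m d - \<Gamma> a e m * \<Gamma> b m d - c a b m * \<Gamma> m e d)"

definition ricci :: "nat \<Rightarrow> sconst \<Rightarrow> (nat \<Rightarrow> nat \<Rightarrow> real) \<Rightarrow> nat \<Rightarrow> nat \<Rightarrow> real" where
  "ricci n c G b e = (\<Sum>a\<in>rng n. curv n c (LC n c G) a b e a)"

definition ricci_flat :: "nat \<Rightarrow> sconst \<Rightarrow> (nat \<Rightarrow> nat \<Rightarrow> real) \<Rightarrow> bool" where
  "ricci_flat n c G \<longleftrightarrow> (\<forall>b\<in>rng n. \<forall>e\<in>rng n. ricci n c G b e = 0)"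

definition gram_mat :: "nat \<Rightarrow> (nat \<Rightarrow> nat \<Rightarrow> real) \<Rightarrow> real mat" where
  "gram_mat n G = mat n n (\<lambda>(i,j). G (i+1) (j+1))"

definition signature :: "nat \<Rightarrow> (nat \<Rightarrow> nat \<Rightarrow> real) \<Rightarrow> nat \<times> nat" where
  "signature n G =
    (\<Sum>x\<in>{x. poly (char_poly (gram_mat n G)) x = 0 \<and> x > 0}. order x (char_poly (gram_mat n G)),
     \<Sum>x\<in>{x. poly (char_poly (gram_mat n G)) x = 0 \<and> x < 0}. order x (char_poly (gram_mat n G)))"

definition Sset :: "nat \<Rightarrow> sconst \<Rightarrow> (nat \<Rightarrow> nat) \<Rightarrow> nat \<Rightarrow> nat \<Rightarrow> nat set set" where
  "Sset n c \<sigma> p q = {{i\<in>rng n. g i < 0} | g. sigma_diagonal n \<sigma> g \<and>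
       ricci_flat n c (sdmetric \<sigma> g) \<and> signature n (sdmetric \<sigma> g) = (p, q)}"

(* Lie algebra given by (de^1,...,de^n): om k i j = coefficient of e^{ij} (i<j) in de^k;
   convention de^k(X,Y) = - e^k([X,Y]) *)
definition sc_of_de :: "(nat \<Rightarrow> nat \<Rightarrow> nat \<Rightarrow> real) \<Rightarrow> sconst" where
  "sc_of_de om i j k = (if i < j then - om k i j else if j < i then om k j i else 0)"

definition omL :: "real \<Rightarrow> nat \<Rightarrow> nat \<Rightarrow> nat \<Rightarrow> real" where
  "omL lam k i j =
    (if (k,i,j) = (4,1,2) then lam - 1
     else if (k,i,j) = (5,1,3) then lam
     else if (k,i,j) = (6,2,3) then 1
     else if (k,i,j) = (7,1,6) \<or> (k,i,j) = (7,2,5) \<or> (k,i,j) = (7,3,4) then 1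
     else 0)"

definition Lsc :: "real \<Rightarrow> sconst" where
  "Lsc lam = sc_of_de (omL lam)"

definition swp :: "nat \<Rightarrow> nat \<Rightarrow> nat \<Rightarrow> nat" where
  "swp a b i = (if i = a then b else if i = b then a else i)"

end

theory Submission
  imports Defs
begin

text \<open>
  Let \<open>X\<^sub>I = c\<^sub>I c\<^sub>\<sigma>\<^sub>I g\<^sub>k / (g\<^sub>i g\<^sub>j)\<close> for an arrow \<open>I\<close>, i.e. \<open>{i, j} \<rightarrow> k\<close> with \<open>c i j k \<noteq> 0\<close>. For a
  \<open>\<sigma>\<close>-diagonal metric the Ricci tensor is again \<open>\<sigma>\<close>-diagonal, and it vanishes iff at every node
  the sum of \<open>X\<close> over incoming arrows equals the sum over outgoing ones. Equivalently, for every
  weight \<open>w\<close> on the nodes, \<open>\<Sum>\<^sub>I X\<^sub>I (w\<^sub>k - w\<^sub>i - w\<^sub>j) = 0\<close>. Since \<open>X\<close> is \<open>\<sigma>\<close>-invariant and nowhere zero,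
  a weight whose defect \<open>w\<^sub>k - w\<^sub>i - w\<^sub>j\<close> is supported, with constant value, on a single \<open>\<sigma>\<close>-orbit of
  arrows is an obstruction. There are only a few thousand diagrams with seven topologically ordered nodes,
  sources first, that meet the combinatorial consequences of niceness and of the Jacobi identity.
  Fifteen weights exclude all of them except two, up to relabelling; one of these is excluded by comparing signs in
  the balance equations with the Jacobi identity, and the other is the diagram of the family.
  On the family, balance is a system of three equations in five unknowns, which fixes
  \<open>\<lambda>\<close> and is solved explicitly.
\<close>

section \<open>The Ricci tensor of a \<open>\<sigma>\<close>-diagonal metric\<close>

text \<open>Niceness makes the diagrams searchable: a pair of nodes has at most one target, and the
  source pairs of one node are disjoint, so the arrows into a node form a matching of earlier nodes.
  The structure constants are unknown to the search; all it keeps of the Jacobi identity is that a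
  nonzero term cannot stand alone, and the identity itself returns only for the two survivors. In
  the surviving family three routes lead to node \<open>7\<close>, each combining two of the sources
  in a middle node and then adding the third. The cyclically oriented products of constants along
  the routes sum to zero by the Jacobi identity, and rescaling basis vectors multiplies all three by
  one common factor. Their ratio, \<open>lam - 1 : - lam : 1\<close>, is thus the parameter. An
  involution exchanges two routes, and balance forces the products on these two to agree, so the
  ratio is 1 : 1 : -2 up to order. The values 1/2, -1 and 2 are the three places where the -2 can
  stand.\<close>

definition arrow_val :: "sconst \<Rightarrow> (nat \<Rightarrow> nat) \<Rightarrow> (nat \<Rightarrow> real) \<Rightarrow> sconst" where
  "arrow_val c \<sigma> g i j k = c i j k * c (\<sigma> i) (\<sigma> j) (\<sigma> k) * g k / (g i * g j)"

text \<open>The height \<open>h\<close> stands in for nilpotency. It stays abstract because it is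
  instantiated by path lengths, by \<open>id\<close> after relabelling, and by \<open>level\<close>
  on the family.\<close>

locale diagonal_nice =
  fixes n :: nat and c :: sconst and \<sigma> :: "nat \<Rightarrow> nat" and g :: "nat \<Rightarrow> real" and h :: "nat \<Rightarrow> nat"
  assumes anti: "\<lbrakk>i \<in> rng n; j \<in> rng n; k \<in> rng n\<rbrakk> \<Longrightarrow> c i j k = - c j i k"
    and target_unique: "\<lbrakk>i \<in> rng n; j \<in> rng n; k \<in> rng n; k' \<in> rng n; c i j k \<noteq> 0; c i j k' \<noteq> 0\<rbrakk> \<Longrightarrow> k = k'"
    and source_unique: "\<lbrakk>i \<in> rng n; j \<in> rng n; j' \<in> rng n; k \<in> rng n; c i j k \<noteq> 0; c i j' k \<noteq> 0\<rbrakk> \<Longrightarrow> j = j'"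
    and height: "\<lbrakk>i \<in> rng n; j \<in> rng n; k \<in> rng n; c i j k \<noteq> 0\<rbrakk> \<Longrightarrow> h j < h k"
    and \<sigma>_rng: "i \<in> rng n \<Longrightarrow> \<sigma> i \<in> rng n"
    and \<sigma>_\<sigma>: "i \<in> rng n \<Longrightarrow> \<sigma> (\<sigma> i) = i"
    and \<sigma>_edge: "\<lbrakk>i \<in> rng n; j \<in> rng n; k \<in> rng n; c i j k \<noteq> 0\<rbrakk> \<Longrightarrow> c (\<sigma> i) (\<sigma> j) (\<sigma> k) \<noteq> 0"
    and g_nonzero: "i \<in> rng n \<Longrightarrow> g i \<noteq> 0"
    and g_\<sigma>: "i \<in> rng n \<Longrightarrow> g (\<sigma> i) = g i"
begin

text \<open>Membership in \<open>rng n\<close> stays an atom, so that the locale assumptions apply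
  as conditional rewrite rules, and \<open>1\<close> is not turned into
  \<open>Suc 0\<close>.\<close>

declare atLeastAtMost_iff [simp del] One_nat_def [simp del]

lemma bij_\<sigma>: "bij_betw \<sigma> (rng n) (rng n)"
  by (rule bij_betw_byWitness[where f' = \<sigma>]) (use \<sigma>_rng \<sigma>_\<sigma> in auto)

lemma sum_metric:
  assumes "l \<in> rng n"
  shows "(\<Sum>k\<in>rng n. f k * sdmetric \<sigma> g k l) = f (\<sigma> l) * g l"
proof -
  have "(\<Sum>k\<in>rng n. f k * sdmetric \<sigma> g k l) = (\<Sum>k\<in>rng n. if k = \<sigma> l then f k * g k else 0)"
    by (rule sum.cong) (use assms \<sigma>_\<sigma> in \<open>auto simp: sdmetric_def\<close>)
  then show ?thesis using assms \<sigma>_rng[OF assms] g_\<sigma>[OF assms] by (simp add: sum.delta')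
qed

text \<open>The Koszul formula solved for the connection: raising an index replaces \<open>k\<close>
  by \<open>\<sigma> k\<close> and divides by \<open>g k\<close>. The value 0 outside
  \<open>rng n\<close> is what \<open>is_LC\<close> prescribes, so that the description in
  \<open>LC\<close> is unique.\<close>

definition conn :: sconst where
  "conn i j k = (if i \<in> rng n \<and> j \<in> rng n \<and> k \<in> rng n then
     (c i j k - c j (\<sigma> k) (\<sigma> i) * g i / g k + c (\<sigma> k) i (\<sigma> j) * g j / g k) / 2 else 0)"

lemma is_LC_iff: "is_LC n c (sdmetric \<sigma> g) \<Gamma> \<longleftrightarrow> \<Gamma> = conn"
proof -
  have koszul: "is_LC n c (sdmetric \<sigma> g) \<Gamma> \<longleftrightarrow>
     (\<forall>i j k. \<not> (i \<in> rng n \<and> j \<in> rng n \<and> k \<in> rng n) \<longrightarrow> \<Gamma> i j k = 0) \<and>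
     (\<forall>i\<in>rng n. \<forall>j\<in>rng n. \<forall>l\<in>rng n. 2 * (\<Gamma> i j (\<sigma> l) * g l) =
        c i j (\<sigma> l) * g l - c j l (\<sigma> i) * g i + c l i (\<sigma> j) * g j)"
    unfolding is_LC_def by (simp add: sum.distrib sum_subtractf sum_metric)
  have *: "2 * (\<Gamma> i j (\<sigma> l) * g l) = c i j (\<sigma> l) * g l - c j l (\<sigma> i) * g i + c l i (\<sigma> j) * g j
      \<longleftrightarrow> \<Gamma> i j (\<sigma> l) = conn i j (\<sigma> l)"
    if "i \<in> rng n" "j \<in> rng n" "l \<in> rng n" for i j l
    using that g_nonzero[of l] \<sigma>_rng[of l] \<sigma>_\<sigma>[of l] g_\<sigma>[of l] by (auto simp: conn_def field_simps)
  have **: "(\<forall>i\<in>rng n. \<forall>j\<in>rng n. \<forall>l\<in>rng n. \<Gamma> i j (\<sigma> l) = conn i j (\<sigma> l)) \<longleftrightarrow>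
    (\<forall>i\<in>rng n. \<forall>j\<in>rng n. \<forall>l\<in>rng n. \<Gamma> i j l = conn i j l)"
    by (metis \<sigma>_\<sigma> \<sigma>_rng)
  have "is_LC n c (sdmetric \<sigma> g) \<Gamma> \<longleftrightarrow>
     (\<forall>i j k. \<not> (i \<in> rng n \<and> j \<in> rng n \<and> k \<in> rng n) \<longrightarrow> \<Gamma> i j k = 0) \<and>
     (\<forall>i\<in>rng n. \<forall>j\<in>rng n. \<forall>k\<in>rng n. \<Gamma> i j k = conn i j k)"
    unfolding koszul **[symmetric] using * by (intro conj_cong ball_cong refl) blast+
  also have "\<dots> \<longleftrightarrow> (\<forall>i j k. \<Gamma> i j k = conn i j k)"
    unfolding conn_def by meson
  finally show ?thesis by (simp add: fun_eq_iff)
qed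

lemma LC_eq: "LC n c (sdmetric \<sigma> g) = conn"
  unfolding LC_def is_LC_iff by simp

lemma height2: "\<lbrakk>i \<in> rng n; j \<in> rng n; k \<in> rng n; c i j k \<noteq> 0\<rbrakk> \<Longrightarrow> h i < h k"
  using height[of j i k] anti[of i j k] by auto

lemma c_diag: "\<lbrakk>i \<in> rng n; j \<in> rng n\<rbrakk> \<Longrightarrow> c i j i = 0 \<and> c i j j = 0"
  using height[of i j j] height2[of i j i] by blast

lemma sum2_swap:
  "(\<Sum>a\<in>rng n. \<Sum>m\<in>rng n. f a m) = (\<Sum>a\<in>rng n. \<Sum>m\<in>rng n. f (\<sigma> m) (\<sigma> a) :: real)"
proof -
  have "(\<Sum>a\<in>rng n. \<Sum>m\<in>rng n. f (\<sigma> m) (\<sigma> a)) = (\<Sum>a\<in>rng n. \<Sum>m\<in>rng n. f m (\<sigma> a))"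
    by (intro sum.cong refl sum.reindex_bij_betw[OF bij_\<sigma>])
  also have "\<dots> = (\<Sum>a\<in>rng n. \<Sum>m\<in>rng n. f m a)"
    by (rule sum.reindex_bij_betw[OF bij_\<sigma>, of "\<lambda>a. \<Sum>m\<in>rng n. f m a"])
  finally show ?thesis using sum.swap by metis
qed

text \<open>Two of the three Koszul terms have a repeated index and vanish by heights. The third
  contracts the antisymmetric bracket with the symmetric inverse metric: reindexing by
  \<open>\<sigma>\<close> gives \<open>T = - T\<close>.\<close>

lemma conn_trace:
  assumes m: "m \<in> rng n"
  shows "(\<Sum>a\<in>rng n. conn a m a) = 0"
proof -
  define T where "T = (\<Sum>a\<in>rng n. c (\<sigma> a) a (\<sigma> m) / g a)"
  have "T = (\<Sum>a\<in>rng n. c (\<sigma> (\<sigma> a)) (\<sigma> a) (\<sigma> m) / g (\<sigma> a))"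
    unfolding T_def by (rule sum.reindex_bij_betw[OF bij_\<sigma>, symmetric])
  also have "\<dots> = (\<Sum>a\<in>rng n. - (c (\<sigma> a) a (\<sigma> m) / g a))"
  proof (rule sum.cong[OF refl])
    fix a assume a: "a \<in> rng n"
    show "c (\<sigma> (\<sigma> a)) (\<sigma> a) (\<sigma> m) / g (\<sigma> a) = - (c (\<sigma> a) a (\<sigma> m) / g a)"
      using anti[of a "\<sigma> a" "\<sigma> m"] a m \<sigma>_rng \<sigma>_\<sigma> g_\<sigma> by simp
  qed
  also have "\<dots> = - T" by (simp add: T_def sum_negf)
  finally have "T = 0" by simp
  have "(\<Sum>a\<in>rng n. conn a m a) = (\<Sum>a\<in>rng n. (g m / 2) * (c (\<sigma> a) a (\<sigma> m) / g a))"
    by (rule sum.cong) (use m c_diag \<sigma>_rng in \<open>auto simp: conn_def mult.commute\<close>)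
  also have "\<dots> = (g m / 2) * T"
    by (simp add: T_def sum_distrib_left)
  finally show ?thesis using \<open>T = 0\<close> by simp
qed

lemma torsion_free: "\<lbrakk>a \<in> rng n; b \<in> rng n; m \<in> rng n\<rbrakk> \<Longrightarrow> c a b m = conn a b m - conn b a m"
  using anti[of a b m] anti[of b "\<sigma> m" "\<sigma> a"] anti[of a "\<sigma> m" "\<sigma> b"] \<sigma>_rng
  by (auto simp: conn_def field_simps)

text \<open>Torsion-freeness turns the bracket term of the curvature into connection terms. One part
  cancels the second curvature term after the summation indices are exchanged, and the first
  curvature term contains the trace of \<open>conn_trace\<close>.\<close>

lemma ricci_conn:
  assumes b: "b \<in> rng n" and e: "e \<in> rng n"
  shows "ricci n c (sdmetric \<sigma> g) b e = - (\<Sum>a\<in>rng n. \<Sum>m\<in>rng n. conn a b m * conn m e a)"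
proof -
  have "ricci n c (sdmetric \<sigma> g) b e = (\<Sum>a\<in>rng n. \<Sum>m\<in>rng n.
      conn b e m * conn a m a - conn a e m * conn b m a
      - (conn a b m - conn b a m) * conn m e a)"
    unfolding ricci_def curv_def LC_eq
    by (intro sum.cong refl) (use b torsion_free in auto)
  also have "\<dots> = (\<Sum>a\<in>rng n. \<Sum>m\<in>rng n. conn b e m * conn a m a)
     - (\<Sum>a\<in>rng n. \<Sum>m\<in>rng n. conn a e m * conn b m a)
     - (\<Sum>a\<in>rng n. \<Sum>m\<in>rng n. conn a b m * conn m e a)
     + (\<Sum>a\<in>rng n. \<Sum>m\<in>rng n. conn b a m * conn m e a)"
    by (simp add: sum.distrib sum_subtractf algebra_simps)
  also have "(\<Sum>a\<in>rng n. \<Sum>m\<in>rng n. conn b e m * conn a m a) = 0"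
    using conn_trace by (subst sum.swap) (simp add: sum_distrib_left[symmetric])
  also have "(\<Sum>a\<in>rng n. \<Sum>m\<in>rng n. conn b a m * conn m e a)
     = (\<Sum>a\<in>rng n. \<Sum>m\<in>rng n. conn a e m * conn b m a)"
    by (subst sum.swap) (simp add: mult.commute)
  finally show ?thesis by simp
qed

text \<open>Twice the Christoffel symbols are \<open>A - B + C\<close>, one term for each bracket in the Koszul formula.
  The contractions \<open>AA\<close> and \<open>BB\<close> vanish because heights increase along arrows. After the substitution
  \<open>(a, m) \<mapsto> (\<sigma> m, \<sigma> a)\<close>, \<open>AC\<close> cancels \<open>BC\<close>, \<open>CA\<close> cancels \<open>CB\<close>, and \<open>BA\<close> equals \<open>AB\<close>.\<close>

lemma ricci_eq:
  assumes b: "b \<in> rng n" and e: "e \<in> rng n"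
  shows "4 * ricci n c (sdmetric \<sigma> g) b e =
    (\<Sum>i\<in>rng n. \<Sum>j\<in>rng n. c i j (\<sigma> b) * c (\<sigma> i) (\<sigma> j) (\<sigma> e) * g b * g e / (g i * g j))
    - 2 * (\<Sum>a\<in>rng n. \<Sum>m\<in>rng n. c b a m * c e (\<sigma> a) (\<sigma> m) * g m / g a)"
    (is "_ = ?T - 2 * ?U")
proof -
  define A where "A = (\<lambda>i j k. c i j k)"
  define B where "B = (\<lambda>i j k. c j (\<sigma> k) (\<sigma> i) * g i / g k)"
  define C where "C = (\<lambda>i j k. c (\<sigma> k) i (\<sigma> j) * g j / g k)"
  define S where "S = (\<lambda>f :: nat \<Rightarrow> nat \<Rightarrow> real. \<Sum>a\<in>rng n. \<Sum>m\<in>rng n. f a m)"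
  have S_cong: "S f = S f'" if "\<And>a m. a \<in> rng n \<Longrightarrow> m \<in> rng n \<Longrightarrow> f a m = f' a m" for f f'
    unfolding S_def by (intro sum.cong refl) (use that in auto)
  have S_swap: "S f = S f'" if "\<And>a m. a \<in> rng n \<Longrightarrow> m \<in> rng n \<Longrightarrow> f (\<sigma> m) (\<sigma> a) = f' a m" for f f'
    using S_cong[of "\<lambda>a m. f (\<sigma> m) (\<sigma> a)" f'] that sum2_swap[of f] by (simp add: S_def)
  note [simp] = \<sigma>_rng \<sigma>_\<sigma> g_\<sigma> g_nonzero b e
  have "4 * ricci n c (sdmetric \<sigma> g) b e = - S (\<lambda>a m. 4 * (conn a b m * conn m e a))"
    unfolding ricci_conn[OF b e] S_def by (simp add: sum_distrib_left)
  also have "S (\<lambda>a m. 4 * (conn a b m * conn m e a)) =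
     S (\<lambda>a m. (A a b m - B a b m + C a b m) * (A m e a - B m e a + C m e a))"
    by (rule S_cong) (simp add: conn_def A_def B_def C_def)
  also have "\<dots> = S (\<lambda>a m. A a b m * A m e a) + S (\<lambda>a m. B a b m * B m e a)
    - S (\<lambda>a m. A a b m * B m e a) - S (\<lambda>a m. B a b m * A m e a)
    + S (\<lambda>a m. A a b m * C m e a) - S (\<lambda>a m. B a b m * C m e a)
    + S (\<lambda>a m. C a b m * A m e a) - S (\<lambda>a m. C a b m * B m e a)
    + S (\<lambda>a m. C a b m * C m e a)"
    unfolding S_def by (simp add: sum.distrib sum_subtractf algebra_simps)
  also have "S (\<lambda>a m. A a b m * A m e a) = S (\<lambda>a m. 0)"
  proof (rule S_cong)
    fix a m assume "a \<in> rng n" "m \<in> rng n"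
    then show "A a b m * A m e a = 0"
      using height2[of a b m] height2[of m e a] b e unfolding A_def by fastforce
  qed
  also have "S (\<lambda>a m. B a b m * B m e a) = S (\<lambda>a m. 0)"
  proof (rule S_cong)
    fix a m assume "a \<in> rng n" "m \<in> rng n"
    then show "B a b m * B m e a = 0"
      using height[of b "\<sigma> m" "\<sigma> a"] height[of e "\<sigma> a" "\<sigma> m"] b e \<sigma>_rng unfolding B_def by fastforce
  qed
  also have "S (\<lambda>a m. B a b m * A m e a) = S (\<lambda>a m. A a b m * B m e a)"
  proof (rule S_swap)
    fix a m assume [simp]: "a \<in> rng n" "m \<in> rng n"
    show "B (\<sigma> m) b (\<sigma> a) * A (\<sigma> a) e (\<sigma> m) = A a b m * B m e a"
      using anti[of b a m] anti[of "\<sigma> a" e "\<sigma> m"] by (simp add: A_def B_def)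
  qed
  also have "S (\<lambda>a m. B a b m * C m e a) = S (\<lambda>a m. A a b m * C m e a)"
  proof (rule S_swap)
    fix a m assume [simp]: "a \<in> rng n" "m \<in> rng n"
    show "B (\<sigma> m) b (\<sigma> a) * C (\<sigma> a) e (\<sigma> m) = A a b m * C m e a"
      using anti[of b a m] anti[of "\<sigma> a" m "\<sigma> e"] by (simp add: A_def B_def C_def)
  qed
  also have "S (\<lambda>a m. C a b m * B m e a) = S (\<lambda>a m. C a b m * A m e a)"
  proof (rule S_swap)
    fix a m assume [simp]: "a \<in> rng n" "m \<in> rng n"
    show "C (\<sigma> m) b (\<sigma> a) * B (\<sigma> a) e (\<sigma> m) = C a b m * A m e a"
      using anti[of m e a] anti[of "\<sigma> m" a "\<sigma> b"] by (simp add: A_def B_def C_def)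
  qed
  also have "S (\<lambda>a m. A a b m * B m e a) = S (\<lambda>a m. - (c b a m * c e (\<sigma> a) (\<sigma> m) * g m / g a))"
    by (rule S_cong) (use anti[of b] in \<open>simp add: A_def B_def\<close>)
  also have "\<dots> = - ?U" unfolding S_def by (simp add: sum_negf)
  also have "S (\<lambda>a m. C a b m * C m e a) = - ?T"
  proof -
    have "S (\<lambda>a m. C a b m * C m e a) = (\<Sum>a\<in>rng n. \<Sum>m\<in>rng n. C a b (\<sigma> m) * C (\<sigma> m) e a)"
      unfolding S_def by (intro sum.cong refl sum.reindex_bij_betw[OF bij_\<sigma>, symmetric])
    also have "\<dots> = (\<Sum>a\<in>rng n. \<Sum>m\<in>rng n.
        - (c m a (\<sigma> b) * c (\<sigma> m) (\<sigma> a) (\<sigma> e) * g b * g e / (g m * g a)))"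
    proof (intro sum.cong refl)
      fix a m assume [simp]: "a \<in> rng n" "m \<in> rng n"
      show "C a b (\<sigma> m) * C (\<sigma> m) e a = - (c m a (\<sigma> b) * c (\<sigma> m) (\<sigma> a) (\<sigma> e) * g b * g e / (g m * g a))"
        using anti[of "\<sigma> a" "\<sigma> m" "\<sigma> e"] by (simp add: C_def)
    qed
    also have "\<dots> = - ?T" by (subst sum.swap) (simp add: sum_negf)
    finally show ?thesis .
  qed
  finally show ?thesis by (simp add: S_def)
qed

section \<open>Ricci-flatness as balance at the nodes\<close>

abbreviation X where "X \<equiv> arrow_val c \<sigma> g"

lemma X_\<sigma>: "\<lbrakk>i \<in> rng n; j \<in> rng n; k \<in> rng n\<rbrakk> \<Longrightarrow> X (\<sigma> i) (\<sigma> j) (\<sigma> k) = X i j k"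
  by (simp add: arrow_val_def \<sigma>_\<sigma> g_\<sigma>)

lemma X_sym: "\<lbrakk>i \<in> rng n; j \<in> rng n; k \<in> rng n\<rbrakk> \<Longrightarrow> X i j k = X j i k"
  using anti[of i j k] anti[of "\<sigma> i" "\<sigma> j" "\<sigma> k"] \<sigma>_rng by (simp add: arrow_val_def mult.commute)

lemma X_eq_0_iff: "\<lbrakk>i \<in> rng n; j \<in> rng n; k \<in> rng n\<rbrakk> \<Longrightarrow> X i j k = 0 \<longleftrightarrow> c i j k = 0"
  using \<sigma>_edge by (auto simp: arrow_val_def g_nonzero)

text \<open>A nonzero term off the \<open>\<sigma>\<close>-diagonal would give one source pair two
  targets, or one source and target two partners, against niceness. The factor 2 arises because the
  incoming sum runs over ordered source pairs and so counts each arrow twice, while the outgoing sum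
  counts it once.\<close>

lemma ricci_flat_iff:
  "ricci_flat n c (sdmetric \<sigma> g) \<longleftrightarrow>
    (\<forall>b\<in>rng n. (\<Sum>i\<in>rng n. \<Sum>j\<in>rng n. X i j b) = 2 * (\<Sum>j\<in>rng n. \<Sum>k\<in>rng n. X b j k))"
proof -
  have off: "ricci n c (sdmetric \<sigma> g) b e = 0" if b: "b \<in> rng n" and e: "e \<in> rng n" and "e \<noteq> \<sigma> b" for b e
  proof -
    have neq: "\<sigma> e \<noteq> b" using \<sigma>_\<sigma>[OF e] \<open>e \<noteq> \<sigma> b\<close> by metis
    have "c i j (\<sigma> b) * c (\<sigma> i) (\<sigma> j) (\<sigma> e) * g b * g e / (g i * g j) = 0" if ij: "i \<in> rng n" "j \<in> rng n" for i j
    proof -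
      have "c (\<sigma> i) (\<sigma> j) (\<sigma> e) = 0" if "c i j (\<sigma> b) \<noteq> 0"
        using \<sigma>_edge[of i j "\<sigma> b"] target_unique[of "\<sigma> i" "\<sigma> j" b "\<sigma> e"] that ij b e neq
          \<sigma>_rng[OF b] \<sigma>_rng[OF e] \<sigma>_rng[OF ij(1)] \<sigma>_rng[OF ij(2)] \<sigma>_\<sigma>[OF b]
        by metis
      then show ?thesis by (cases "c i j (\<sigma> b) = 0") auto
    qed
    moreover have "c b a m * c e (\<sigma> a) (\<sigma> m) * g m / g a = 0" if am: "a \<in> rng n" "m \<in> rng n" for a m
    proof -
      have "c e (\<sigma> a) (\<sigma> m) = 0" if "c b a m \<noteq> 0"
        using \<sigma>_edge[of b a m] source_unique[of "\<sigma> a" e "\<sigma> b" "\<sigma> m"] anti[of e "\<sigma> a" "\<sigma> m"]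
          anti[of "\<sigma> b" "\<sigma> a" "\<sigma> m"] that am b e \<open>e \<noteq> \<sigma> b\<close>
          \<sigma>_rng[OF b] \<sigma>_rng[OF am(1)] \<sigma>_rng[OF am(2)]
        by (metis neg_equal_0_iff_equal)
      then show ?thesis by (cases "c b a m = 0") auto
    qed
    ultimately show ?thesis using ricci_eq[OF b e] by (simp del: divide_eq_0_iff mult_eq_0_iff cong: sum.cong)
  qed
  have diag: "4 * ricci n c (sdmetric \<sigma> g) b (\<sigma> b) =
      g b * ((\<Sum>i\<in>rng n. \<Sum>j\<in>rng n. X i j b) - 2 * (\<Sum>j\<in>rng n. \<Sum>k\<in>rng n. X b j k))"
    if b: "b \<in> rng n" for b
  proof -
    \<comment> \<open>The sources are written as \<open>\<sigma> j\<close>,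
      \<open>\<sigma> i\<close> to match the reindexing of \<open>sum2_swap\<close>; the two
      antisymmetry signs of the exchange cancel.\<close>
    have "(\<Sum>i\<in>rng n. \<Sum>j\<in>rng n. c i j (\<sigma> b) * c (\<sigma> i) (\<sigma> j) (\<sigma> (\<sigma> b)) * g b * g (\<sigma> b) / (g i * g j))
      = (\<Sum>i\<in>rng n. \<Sum>j\<in>rng n. g b * X (\<sigma> j) (\<sigma> i) b)"
    proof (intro sum.cong refl)
      fix i j assume "i \<in> rng n" "j \<in> rng n"
      then show "c i j (\<sigma> b) * c (\<sigma> i) (\<sigma> j) (\<sigma> (\<sigma> b)) * g b * g (\<sigma> b) / (g i * g j) = g b * X (\<sigma> j) (\<sigma> i) b"
        using b anti[of i j "\<sigma> b"] anti[of "\<sigma> i" "\<sigma> j" b]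
        by (simp add: arrow_val_def g_\<sigma> \<sigma>_\<sigma> \<sigma>_rng mult_ac)
    qed
    also have "\<dots> = (\<Sum>i\<in>rng n. \<Sum>j\<in>rng n. g b * X i j b)"
      by (rule sum2_swap[symmetric])
    finally have 1: "(\<Sum>i\<in>rng n. \<Sum>j\<in>rng n. c i j (\<sigma> b) * c (\<sigma> i) (\<sigma> j) (\<sigma> (\<sigma> b)) * g b * g (\<sigma> b) / (g i * g j))
      = g b * (\<Sum>i\<in>rng n. \<Sum>j\<in>rng n. X i j b)" by (simp add: sum_distrib_left)
    have 2: "(\<Sum>a\<in>rng n. \<Sum>m\<in>rng n. c b a m * c (\<sigma> b) (\<sigma> a) (\<sigma> m) * g m / g a)
      = g b * (\<Sum>j\<in>rng n. \<Sum>k\<in>rng n. X b j k)"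
      unfolding sum_distrib_left
      by (intro sum.cong refl) (use b g_nonzero in \<open>simp add: arrow_val_def\<close>)
    show ?thesis using ricci_eq[OF b \<sigma>_rng[OF b]] 1 2 by (simp add: algebra_simps)
  qed
  show ?thesis
  proof
    assume flat: "ricci_flat n c (sdmetric \<sigma> g)"
    show "\<forall>b\<in>rng n. (\<Sum>i\<in>rng n. \<Sum>j\<in>rng n. X i j b) = 2 * (\<Sum>j\<in>rng n. \<Sum>k\<in>rng n. X b j k)"
    proof
      fix b assume b: "b \<in> rng n"
      have "ricci n c (sdmetric \<sigma> g) b (\<sigma> b) = 0"
        using flat b \<sigma>_rng[OF b] unfolding ricci_flat_def by blast
      with diag[OF b] g_nonzero[OF b]
      show "(\<Sum>i\<in>rng n. \<Sum>j\<in>rng n. X i j b) = 2 * (\<Sum>j\<in>rng n. \<Sum>k\<in>rng n. X b j k)"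
        by auto
    qed
  next
    assume *: "\<forall>b\<in>rng n. (\<Sum>i\<in>rng n. \<Sum>j\<in>rng n. X i j b) = 2 * (\<Sum>j\<in>rng n. \<Sum>k\<in>rng n. X b j k)"
    show "ricci_flat n c (sdmetric \<sigma> g)"
      unfolding ricci_flat_def
    proof (intro ballI)
      fix b e assume "b \<in> rng n" "e \<in> rng n"
      then show "ricci n c (sdmetric \<sigma> g) b e = 0"
        using off[of b e] diag[of b] * by (cases "e = \<sigma> b") auto
    qed
  qed
qed

end

section \<open>Heights in a nilpotent nice algebra\<close>

text \<open>A path of \<open>m\<close> arrows into \<open>k\<close>, followed backwards through
  second sources. It witnesses that \<open>e\<^sub>k\<close> is a multiple of an
  \<open>m\<close>-fold iterated bracket.\<close>

primrec chain :: "nat \<Rightarrow> sconst \<Rightarrow> nat \<Rightarrow> nat \<Rightarrow> bool" where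
  "chain n c 0 k \<longleftrightarrow> k \<in> rng n"
| "chain n c (Suc m) k \<longleftrightarrow> k \<in> rng n \<and> (\<exists>i\<in>rng n. \<exists>j\<in>rng n. chain n c m j \<and> c i j k \<noteq> 0)"

lemma nice_target_unique:
  assumes "nice_sc n c" "i \<in> rng n" "j \<in> rng n" "k \<in> rng n" "k' \<in> rng n" "c i j k \<noteq> 0" "c i j k' \<noteq> 0"
  shows "k = k'"
  using assms unfolding nice_sc_def by metis

lemma nice_source_unique:
  assumes "nice_sc n c" "i \<in> rng n" "j \<in> rng n" "j' \<in> rng n" "k \<in> rng n" "c i j k \<noteq> 0" "c i j' k \<noteq> 0"
  shows "j = j'"
  using assms unfolding nice_sc_def by metis

text \<open>In a nice basis a bracket of basis vectors meets a single coordinate, so bracketing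
  along a path never leaves the basis directions. That all other coordinates vanish is what carries
  the induction.\<close>

lemma chain_imp_iterated_bracket:
  assumes nice: "nice_sc n c" and "chain n c m k"
  shows "\<exists>xs x. length xs = m \<and> foldr (br n c) xs x k \<noteq> 0 \<and> (\<forall>l. l \<noteq> k \<longrightarrow> foldr (br n c) xs x l = 0)"
  using assms(2)
proof (induction m arbitrary: k)
  case 0
  then show ?case by (intro exI[of _ "[]"] exI[of _ "\<lambda>l. if l = k then 1 else 0"]) auto
next
  case (Suc m)
  then obtain i j where ij: "i \<in> rng n" "j \<in> rng n" "chain n c m j" "c i j k \<noteq> 0" and k: "k \<in> rng n"
    by auto
  from Suc.IH[OF ij(3)] obtain xs x where x: "length xs = m" "foldr (br n c) xs x j \<noteq> 0"
    "\<And>l. l \<noteq> j \<Longrightarrow> foldr (br n c) xs x l = 0" by blast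
  define y where "y = foldr (br n c) xs x"
  define e where "e = (\<lambda>l. if l = i then 1 else 0 :: real)"
  have "br n c e y l = (if l \<in> rng n then y j * c i j l else 0)" for l
  proof -
    have "(\<Sum>j'\<in>rng n. y j' * c i j' l) = (\<Sum>j'\<in>rng n. if j' = j then y j' * c i j' l else 0)"
      by (rule sum.cong) (auto simp: y_def x(3))
    then have y: "(\<Sum>j'\<in>rng n. y j' * c i j' l) = y j * c i j l" using ij by simp
    have "(\<Sum>i'\<in>rng n. \<Sum>j'\<in>rng n. e i' * y j' * c i' j' l) =
      (\<Sum>i'\<in>rng n. if i' = i then (\<Sum>j'\<in>rng n. y j' * c i j' l) else 0)"
      by (rule sum.cong) (auto simp: e_def)
    also have "\<dots> = y j * c i j l" using ij y by simp
    finally show ?thesis by (simp add: br_def)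
  qed
  moreover have "c i j l = 0" if "l \<noteq> k" "l \<in> rng n" for l
    using nice_target_unique[OF nice ij(1,2) k that(2) ij(4)] that by auto
  ultimately show ?case
    using x ij(4) k
    by (intro exI[of _ "e # xs"] exI[of _ x]) (auto simp: y_def[symmetric] simp del: One_nat_def atLeastAtMost_iff)
qed

text \<open>The height of \<open>k\<close> is the least length that no path into \<open>k\<close>
  has; nilpotency bounds it. A path into \<open>j\<close> extends along an arrow from
  \<open>j\<close> to \<open>k\<close>, so the height grows along that arrow.\<close>

lemma nilpotent_height:
  assumes nice: "nice_sc n c" and "nilpotent_sc n c"
  obtains h :: "nat \<Rightarrow> nat" where
    "\<And>i j k. \<lbrakk>i \<in> rng n; j \<in> rng n; k \<in> rng n; c i j k \<noteq> 0\<rbrakk> \<Longrightarrow> h j < h k"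
proof
  from assms(2) obtain N where "\<forall>xs x. length xs = N \<longrightarrow> (\<forall>k\<in>rng n. foldr (br n c) xs x k = 0)"
    unfolding nilpotent_sc_def by blast
  then have N: "\<not> chain n c N k" for k
    using chain_imp_iterated_bracket[OF nice, of N k] by (cases N; fastforce)
  define h where "h k = (LEAST m. \<not> chain n c m k)" for k
  fix i j k assume *: "i \<in> rng n" "j \<in> rng n" "k \<in> rng n" "c i j k \<noteq> 0"
  have "\<not> chain n c (h k) k" unfolding h_def by (rule LeastI[of _ N]) (rule N)
  \<comment> \<open>The height is not 0 because the empty path ends at \<open>k\<close>.\<close>
  with * obtain m where m: "h k = Suc m" by (cases "h k") auto
  have "\<not> chain n c m j" using \<open>\<not> chain n c (h k) k\<close> * unfolding m by auto
  then have "h j \<le> m" unfolding h_def by (rule Least_le)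
  then show "h j < h k" using m by simp
qed

lemma diag_edge_iff:
  assumes "nice_sc n c" "i \<in> rng n" "j \<in> rng n" "k \<in> rng n"
  shows "diag_edge n c i j k \<longleftrightarrow> c i j k \<noteq> 0"
  using nice_target_unique[OF assms] unfolding diag_edge_def by blast

lemma diagonal_niceI:
  assumes nice: "nice_sc n c" and lie: "lie_sc n c"
    and h: "\<And>i j k. \<lbrakk>i \<in> rng n; j \<in> rng n; k \<in> rng n; c i j k \<noteq> 0\<rbrakk> \<Longrightarrow> h j < h k"
    and \<sigma>: "diagram_involution n c \<sigma>" and g: "sigma_diagonal n \<sigma> g"
  shows "diagonal_nice n c \<sigma> g h"
proof
  fix i j k assume ijk: "i \<in> rng n" "j \<in> rng n" "k \<in> rng n"
  show "c i j k = - c j i k" using lie ijk unfolding lie_sc_def by blast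
  have "\<sigma> i \<in> rng n" "\<sigma> j \<in> rng n" "\<sigma> k \<in> rng n"
    using \<sigma> ijk unfolding diagram_involution_def by blast+
  moreover assume "c i j k \<noteq> 0"
  ultimately show "c (\<sigma> i) (\<sigma> j) (\<sigma> k) \<noteq> 0"
    using \<sigma> ijk diag_edge_iff[OF nice] unfolding diagram_involution_def by blast
next
  fix i assume i: "i \<in> rng n"
  show "\<sigma> i \<in> rng n" "\<sigma> (\<sigma> i) = i" using \<sigma> i unfolding diagram_involution_def by blast+
  show "g i \<noteq> 0" "g (\<sigma> i) = g i" using g i unfolding sigma_diagonal_def by blast+
qed (use nice_target_unique[OF nice] nice_source_unique[OF nice] h in blast)+

section \<open>Enumeration of nice diagrams with seven nodes\<close>

type_synonym arrow = "nat \<times> nat \<times> nat"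
type_synonym pairing = "(nat \<times> nat) list"

text \<open>The search is evaluated by the simplifier, which also rewrites under binders. For this reason every
  loop is a first-order recursion, and conditionals replace the Boolean connectives wherever the
  second argument should not be evaluated eagerly.\<close>

fun paired :: "nat \<Rightarrow> nat \<Rightarrow> pairing \<Rightarrow> bool" where
  "paired i j [] = False"
| "paired i j ((a, b) # m) = (if i = a \<and> j = b \<or> i = b \<and> j = a then True else paired i j m)"

fun has_sources :: "nat \<Rightarrow> nat \<Rightarrow> arrow list \<Rightarrow> bool" where
  "has_sources i j [] = False"
| "has_sources i j ((a, b, k) # A) = (if i = a \<and> j = b then True else has_sources i j A)"

fun has_arrow :: "nat \<Rightarrow> nat \<Rightarrow> nat \<Rightarrow> arrow list \<Rightarrow> bool" where
  "has_arrow i j k [] = False"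
| "has_arrow i j k ((a, b, l) # A) =
    (if k = l \<and> (i = a \<and> j = b \<or> i = b \<and> j = a) then True else has_arrow i j k A)"

text \<open>For a pairing \<open>m\<close> into the next node, \<open>cancels A m i j k\<close> says that the nonzero term
  \<open>[[e\<^sub>i, e\<^sub>j], e\<^sub>k]\<close> of the Jacobi identity is met by a nonzero term with another inner pair.\<close>

fun cancels :: "arrow list \<Rightarrow> pairing \<Rightarrow> nat \<Rightarrow> nat \<Rightarrow> nat \<Rightarrow> bool" where
  "cancels [] m i j k = False"
| "cancels ((a, b, l) # A) m i j k =
    (if (if a = j \<and> b = k \<or> a = k \<and> b = j then paired l i m
         else if a = i \<and> b = k \<or> a = k \<and> b = i then paired l j m else False)
     then True else cancels A m i j k)"

text \<open>A repeated entry, \<open>k = i\<close> or \<open>k = j\<close>, is exempt: there the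
  Jacobi identity already holds by antisymmetry and forces no partner term.\<close>

fun jacobi_at :: "arrow list \<Rightarrow> arrow list \<Rightarrow> pairing \<Rightarrow> nat \<Rightarrow> nat \<Rightarrow> bool" where
  "jacobi_at A [] m x k = True"
| "jacobi_at A ((i, j, l) # B) m x k =
    (if (if l = x then (if k = i \<or> k = j then True else cancels A m i j k) else True)
     then jacobi_at A B m x k else False)"

fun jacobi_ok :: "arrow list \<Rightarrow> pairing \<Rightarrow> pairing \<Rightarrow> bool" where
  "jacobi_ok A m [] = True"
| "jacobi_ok A m ((x, y) # m') =
    (if jacobi_at A A m x y then if jacobi_at A A m y x then jacobi_ok A m m' else False else False)"

fun add_arrows :: "nat \<Rightarrow> pairing \<Rightarrow> arrow list \<Rightarrow> arrow list" where
  "add_arrows k [] A = A"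
| "add_arrows k ((i, j) # m) A = (i, j, k) # add_arrows k m A"

text \<open>A node on exactly one arrow: its indicator weight is violated by that arrow alone,
  whatever the involution. Hence this test comes before involutions are enumerated.\<close>

fun lone :: "nat \<Rightarrow> bool \<Rightarrow> arrow list \<Rightarrow> bool" where
  "lone v found [] = found"
| "lone v found ((i, j, k) # A) =
    (if v = i \<or> v = j \<or> v = k then if found then False else lone v True A else lone v found A)"

fun some_lone :: "nat list \<Rightarrow> arrow list \<Rightarrow> bool" where
  "some_lone [] A = False"
| "some_lone (v # vs) A = (if lone v False A then True else some_lone vs A)"

fun swaps :: "pairing \<Rightarrow> nat \<Rightarrow> nat" where
  "swaps [] i = i"
| "swaps ((a, b) # m) i = (if i = a then b else if i = b then a else swaps m i)"

fun symmetric :: "pairing \<Rightarrow> arrow list \<Rightarrow> arrow list \<Rightarrow> bool" where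
  "symmetric m A [] = True"
| "symmetric m A ((i, j, k) # B) =
    (if has_arrow (swaps m i) (swaps m j) (swaps m k) A then symmetric m A B else False)"

fun degree :: "nat \<Rightarrow> nat \<Rightarrow> nat \<Rightarrow> arrow list \<Rightarrow> nat \<times> nat" where
  "degree v p q [] = (p, q)"
| "degree v p q ((i, j, k) # A) =
    (if v = k then degree v (Suc p) q A
     else if v = i \<or> v = j then degree v p (Suc q) A else degree v p q A)"

fun degrees :: "nat list \<Rightarrow> arrow list \<Rightarrow> (nat \<times> nat \<times> nat) list" where
  "degrees [] A = []"
| "degrees (v # vs) A = (v, degree v 0 0 A) # degrees vs A"

type_synonym weight = "nat list \<times> nat list"

fun mem :: "nat \<Rightarrow> nat list \<Rightarrow> bool" where
  "mem i [] = False"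
| "mem i (x # xs) = (if i = x then True else mem i xs)"

fun wt :: "weight \<Rightarrow> nat \<Rightarrow> int" where
  "wt (P, N) i = (if mem i P then 1 else if mem i N then - 1 else 0)"

fun defect :: "weight \<Rightarrow> arrow \<Rightarrow> int" where
  "defect w (i, j, k) = wt w k - wt w i - wt w j"

fun violations :: "weight \<Rightarrow> arrow list \<Rightarrow> arrow list" where
  "violations w [] = []"
| "violations w (x # A) = (if defect w x = 0 then violations w A else x # violations w A)"

fun image_of :: "pairing \<Rightarrow> arrow \<Rightarrow> arrow \<Rightarrow> bool" where
  "image_of m (i, j, k) (a, b, l) \<longleftrightarrow> swaps m k = l \<and>
     (swaps m i = a \<and> swaps m j = b \<or> swaps m i = b \<and> swaps m j = a)"

text \<open>Orbits of an involution have at most two elements. For one violating arrow nothing is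
  compared, since a single nonzero term already contradicts a vanishing sum.\<close>

fun single_orbit :: "weight \<Rightarrow> pairing \<Rightarrow> arrow list \<Rightarrow> bool" where
  "single_orbit w m [x] = True"
| "single_orbit w m [x, y] = (if defect w x = defect w y then image_of m x y else False)"
| "single_orbit w m _ = False"

fun obstructed :: "weight list \<Rightarrow> pairing \<Rightarrow> arrow list \<Rightarrow> bool" where
  "obstructed [] m A = False"
| "obstructed (w # ws) m A =
    (if single_orbit w m (violations w A) then True else obstructed ws m A)"

fun contains :: "arrow list \<Rightarrow> arrow list \<Rightarrow> bool" where
  "contains A [] = True"
| "contains A ((i, j, k) # B) = (if has_arrow i j k A then contains A B else False)"

text \<open>A pair \<open>(P, N)\<close> stands for the weight that is \<open>1\<close> on \<open>P\<close>, \<open>-1\<close> on \<open>N\<close> and \<open>0\<close> elsewhere. The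
  last eight weights come from a greedy computer search over all weights with values in
  \<open>{-1, 0, 1}\<close>.\<close>

definition weights :: "weight list" where
  "weights = [([1],[]), ([2],[]), ([3],[]), ([4],[]), ([5],[]), ([6],[]), ([7],[]),
   ([4,5,6,7],[]), ([3,5,6,7],[]), ([3,4,5,6],[]),
   ([3,4,6,7],[]), ([3,4,5,7],[]), ([2,3,6],[1]), ([1,3,6],[2]), ([1,2,6],[3])]"

text \<open>\<open>B_arrows\<close> is the diagram of the family. \<open>C_arrows\<close> is the diagram that violates no linear
  condition and is excluded by signs.\<close>

definition B_arrows :: "nat \<Rightarrow> nat \<Rightarrow> nat \<Rightarrow> arrow list" where
  "B_arrows s t u = [(1,2,s),(1,3,t),(2,3,u),(1,u,7),(2,t,7),(3,s,7)]"

definition C_arrows :: "nat \<Rightarrow> nat \<Rightarrow> nat \<Rightarrow> nat \<Rightarrow> nat \<Rightarrow> arrow list" where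
  "C_arrows q a b s t = [(q,b,s),(q,a,t),(a,s,6),(b,t,6),(q,6,7),(s,t,7)]"

fun is_B :: "(nat \<times> nat \<times> nat) list \<Rightarrow> arrow list \<Rightarrow> bool" where
  "is_B [] A = False"
| "is_B ((s, t, u) # ps) A = (if contains A (B_arrows s t u) then True else is_B ps A)"

fun is_C :: "(nat \<times> nat \<times> nat \<times> nat \<times> nat) list \<Rightarrow> pairing \<Rightarrow> arrow list \<Rightarrow> bool" where
  "is_C [] m A = False"
| "is_C ((q, a, b, s, t) # ps) m A =
    (if contains A (C_arrows q a b s t)
     then swaps m q = q \<and> swaps m a = b \<and> swaps m s = t \<and> swaps m 6 = 6 \<and> swaps m 7 = 7
     else is_C ps m A)"

text \<open>The three sources come first and \<open>7\<close> comes last, so the freedom left is the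
  order of the middle nodes.\<close>

definition B_params :: "(nat \<times> nat \<times> nat) list" where
  "B_params = [(4,5,6),(4,6,5),(5,4,6),(5,6,4),(6,4,5),(6,5,4)]"

text \<open>Exchanging \<open>a\<close> with \<open>b\<close> and \<open>s\<close> with
  \<open>t\<close> gives the same diagram, so the twelve labellings reduce to six.\<close>

definition C_params :: "(nat \<times> nat \<times> nat \<times> nat \<times> nat) list" where
  "C_params = [(1,2,3,4,5),(1,2,3,5,4),(2,1,3,4,5),(2,1,3,5,4),(3,1,2,4,5),(3,1,2,5,4)]"

text \<open>The empty pairing is the identity, which is no involution. The length test turns
  containment of six given arrows into equality of diagrams.\<close>

definition settled :: "pairing \<Rightarrow> arrow list \<Rightarrow> bool" where
  "settled m A = (case m of [] \<Rightarrow> True | _ # _ \<Rightarrow>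
     if symmetric m A A then
       if obstructed weights m A then True
       else if length A = 6 then if is_B B_params A then True else is_C C_params m A
       else False
     else True)"

text \<open>The second components of the list are degrees. Comparing them only prunes the search, since a diagram
  involution preserves in- and out-degrees.\<close>

function all_syms :: "arrow list \<Rightarrow> pairing \<Rightarrow> (nat \<times> nat \<times> nat) list \<Rightarrow> bool"
  and some_syms :: "arrow list \<Rightarrow> pairing \<Rightarrow> nat \<times> nat \<times> nat \<Rightarrow> (nat \<times> nat \<times> nat) list \<Rightarrow> (nat \<times> nat \<times> nat) list \<Rightarrow> bool" where
  "all_syms A m [] = settled m A"
| "all_syms A m (a # xs) =
     (if all_syms A m xs then some_syms A m a xs xs else False)"
| "some_syms A m a xs [] = True"
| "some_syms A m a xs (b # bs) =
     (if snd a = snd b then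
        if all_syms A ((fst a, fst b) # m) (remove1 b xs) then some_syms A m a xs bs else False
      else some_syms A m a xs bs)"
  by pat_completeness auto
termination
  by (relation "inv_image (less_than <*lex*> less_than) (case_sum (\<lambda>(A, m, xs). (2 * length xs + 1, 0))
     (\<lambda>(A, m, a, xs, bs). (2 * length xs + 2, length bs)))") (auto simp: length_remove1)

definition checked :: "arrow list \<Rightarrow> bool" where
  "checked A = (case A of [] \<Rightarrow> True | _ # _ \<Rightarrow>
     if some_lone [1,2,3,4,5,6,7] A then True
     else all_syms A [] (degrees [1,2,3,4,5,6,7] A))"

text \<open>The clause for the empty pairing expresses that sources come first.\<close>

definition admissible :: "arrow list \<Rightarrow> pairing \<Rightarrow> bool" where
  "admissible A m = (case m of [] \<Rightarrow> A = [] | _ # _ \<Rightarrow> jacobi_ok A m m)"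

text \<open>A stage adds one node \<open>k\<close> and tries all matchings of the earlier nodes as
  the arrows into \<open>k\<close>. The test \<open>has_sources\<close> enforces that a source pair
  has only one target.\<close>

function (sequential) all_exts :: "(nat \<times> nat list) list \<Rightarrow> arrow list \<Rightarrow> bool"
  and all_pairs :: "(nat \<times> nat list) list \<Rightarrow> arrow list \<Rightarrow> nat \<Rightarrow> pairing \<Rightarrow> nat list \<Rightarrow> bool"
  and some_pairs :: "(nat \<times> nat list) list \<Rightarrow> arrow list \<Rightarrow> nat \<Rightarrow> pairing \<Rightarrow> nat \<Rightarrow> nat list \<Rightarrow> nat list \<Rightarrow> bool" where
  "all_exts [] A = checked A"
| "all_exts ((k, xs) # r) A = all_pairs r A k [] xs"
| "all_pairs r A k m [] = (if admissible A m then all_exts r (add_arrows k m A) else True)"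
| "all_pairs r A k m (a # xs) =
     (if all_pairs r A k m xs then some_pairs r A k m a xs xs else False)"
| "some_pairs r A k m a xs [] = True"
| "some_pairs r A k m a xs (b # bs) =
     (if has_sources a b A then some_pairs r A k m a xs bs
      else if all_pairs r A k ((a, b) # m) (remove1 b xs) then some_pairs r A k m a xs bs else False)"
  by pat_completeness auto
termination
  by (relation "inv_image (less_than <*lex*> less_than <*lex*> less_than)
     (case_sum (\<lambda>(r, A). (length r, 0, 0)) (case_sum (\<lambda>(r, A, k, m, xs). (length r, 2 * length xs + 1, 0))
     (\<lambda>(r, A, k, m, a, xs, bs). (length r, 2 * length xs + 2, length bs))))") (auto simp: length_remove1)

text \<open>An arrow needs two distinct earlier sources, so node \<open>3\<close> is the first that
  can receive one.\<close>

definition stages :: "(nat \<times> nat list) list" where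
  "stages = [(3,[1,2]),(4,[1,2,3]),(5,[1,2,3,4]),(6,[1,2,3,4,5]),(7,[1,2,3,4,5,6])]"
lemma search: "all_exts stages []" by code_simp

section \<open>Soundness of the enumeration\<close>

text \<open>The branching shared by \<open>all_pairs\<close> and \<open>all_syms\<close>: the head
  of the list stays single or is matched with a later element.\<close>

inductive pairing_of :: "nat list \<Rightarrow> pairing \<Rightarrow> bool" where
  Nil: "pairing_of [] []"
| Skip: "pairing_of xs m \<Longrightarrow> pairing_of (a # xs) m"
| Pair: "b \<in> set xs \<Longrightarrow> pairing_of (remove1 b xs) m \<Longrightarrow> pairing_of (a # xs) ((a, b) # m)"

lemma pairing_of_subset: "pairing_of xs m \<Longrightarrow> set m \<subseteq> set xs \<times> set xs"
proof (induction rule: pairing_of.induct)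
  case (Pair b xs m a)
  then show ?case using set_remove1_subset[of b xs] by auto
qed auto

lemma pairing_of_distinct: "pairing_of xs m \<Longrightarrow> distinct xs \<Longrightarrow> distinct m"
proof (induction rule: pairing_of.induct)
  case (Pair b xs m a)
  have "a \<notin> set (remove1 b xs)" using Pair.prems notin_set_remove1 by force
  then have "(a, b) \<notin> set m" using pairing_of_subset[OF Pair.hyps(2)] by auto
  with Pair show ?case by (simp add: distinct_remove1)
qed auto

lemma sorted_wrt_remove1: "sorted_wrt P xs \<Longrightarrow> sorted_wrt P (remove1 b xs)"
  by (induction xs) (auto dest: notin_set_remove1)

text \<open>The list is sorted, so its head can only be the smaller end of a pair, and of at most
  one by disjointness. Deleting the head and its partner, if any, leaves a shorter instance.\<close>

lemma pairing_of_exists: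
  fixes xs :: "nat list"
  assumes "sorted_wrt (<) xs"
    and "\<And>a b. (a, b) \<in> M \<Longrightarrow> a < b \<and> a \<in> set xs \<and> b \<in> set xs"
    and "\<And>a b a' b'. \<lbrakk>(a, b) \<in> M; (a', b') \<in> M; {a, b} \<inter> {a', b'} \<noteq> {}\<rbrakk> \<Longrightarrow> a = a' \<and> b = b'"
  shows "\<exists>m. pairing_of xs m \<and> set m = M"
  using assms
proof (induction "length xs" arbitrary: xs M rule: less_induct)
  case less
  show ?case
  proof (cases xs)
    case Nil
    then have "M = {}" using less.prems(2) by fastforce
    then show ?thesis using Nil pairing_of.Nil by auto
  next
    case (Cons a ys)
    show ?thesis
    proof (cases "\<exists>b. (a, b) \<in> M")
      case False
      have "\<exists>m. pairing_of ys m \<and> set m = M"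
      proof (rule less.hyps)
        fix c d assume cd: "(c, d) \<in> M"
        then have "c \<noteq> a" using False by auto
        moreover have "d \<noteq> a" using less.prems(1) less.prems(2)[OF cd] \<open>c \<noteq> a\<close> by (auto simp: Cons)
        ultimately show "c < d \<and> c \<in> set ys \<and> d \<in> set ys" using less.prems(2)[OF cd] by (auto simp: Cons)
      next
        show "length ys < length xs" using Cons by simp
        show "sorted_wrt (<) ys" using less.prems(1) Cons by simp
      qed (rule less.prems(3))
      then show ?thesis using Cons pairing_of.Skip by auto
    next
      case True
      then obtain b where b: "(a, b) \<in> M" by auto
      then have bys: "b \<in> set ys" using less.prems(2) Cons by fastforce
      have dist: "distinct ys" using less.prems(1) Cons by (simp add: strict_sorted_iff)
      have "\<exists>m. pairing_of (remove1 b ys) m \<and> set m = M - {(a, b)}"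
      proof (rule less.hyps)
        show "length (remove1 b ys) < length xs" using Cons by (auto simp: length_remove1)
        show "sorted_wrt (<) (remove1 b ys)" using less.prems(1) Cons by (simp add: sorted_wrt_remove1)
      next
        fix c d assume cd: "(c, d) \<in> M - {(a, b)}"
        then have "{a, b} \<inter> {c, d} = {}" using less.prems(3)[OF b, of c d] by blast
        then show "c < d \<and> c \<in> set (remove1 b ys) \<and> d \<in> set (remove1 b ys)"
          using less.prems(2)[of c d] cd Cons by (simp add: set_remove1_eq[OF dist])
      next
        fix c d c' d' assume "(c, d) \<in> M - {(a, b)}" "(c', d') \<in> M - {(a, b)}" "{c, d} \<inter> {c', d'} \<noteq> {}"
        then show "c = c' \<and> d = d'" using less.prems(3)[of c d c' d'] by blast
      qed
      then obtain m where "pairing_of (remove1 b ys) m" "set m = M - {(a, b)}" by auto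
      then have "pairing_of xs ((a, b) # m)" "set ((a, b) # m) = M"
        using Cons b bys by (auto intro: pairing_of.Pair)
      then show ?thesis by blast
    qed
  qed
qed

lemma some_pairsD:
  "some_pairs r A k m a xs bs \<Longrightarrow> b \<in> set bs \<Longrightarrow> \<not> has_sources a b A \<Longrightarrow>
    all_pairs r A k ((a, b) # m) (remove1 b xs)"
  by (induction bs) (auto split: if_splits)

text \<open>The accumulator collects pairs in the opposite order, hence \<open>rev\<close>.\<close>

lemma all_pairsD:
  assumes "pairing_of xs m'" "all_pairs r A k m xs" "\<And>a b. (a, b) \<in> set m' \<Longrightarrow> \<not> has_sources a b A"
    "admissible A (rev m' @ m)"
  shows "all_exts r (add_arrows k (rev m' @ m) A)"
  using assms
proof (induction arbitrary: m rule: pairing_of.induct)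
  case (Pair b xs m' a)
  have "some_pairs r A k m a xs xs" using Pair.prems(1) by (simp split: if_splits)
  from some_pairsD[OF this Pair.hyps(1)] Pair.prems(2)
  have "all_pairs r A k ((a, b) # m) (remove1 b xs)" by simp
  from Pair.IH[OF this] Pair.prems(2,3) show ?case by simp
qed (auto split: if_splits)

lemma some_symsD:
  "some_syms A m a xs bs \<Longrightarrow> b \<in> set bs \<Longrightarrow> snd a = snd b \<Longrightarrow>
    all_syms A ((fst a, fst b) # m) (remove1 b xs)"
  by (induction bs) (auto split: if_splits)

lemma map_fst_remove1:
  "distinct (map fst xs) \<Longrightarrow> b \<in> set xs \<Longrightarrow> map fst (remove1 b xs) = remove1 (fst b) (map fst xs)"
proof (induction xs)
  case (Cons x xs)
  show ?case
  proof (cases "b = x")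
    case False
    then have "b \<in> set xs" using Cons.prems(2) by simp
    then have "fst b \<noteq> fst x" using Cons.prems(1) by (metis distinct.simps(2) imageI list.simps(9) set_map)
    with Cons.IH Cons.prems(1) \<open>b \<in> set xs\<close> False show ?thesis by simp
  qed simp
qed simp

text \<open>The last assumption says that matched nodes carry equal labels, so that pruning by
  degrees never cuts the branch of \<open>m'\<close>.\<close>

lemma all_symsD:
  assumes "pairing_of ys m'" "ys = map fst xs" "distinct ys" "all_syms A m xs"
    "\<And>a b d e. (a, b) \<in> set m' \<Longrightarrow> (a, d) \<in> set xs \<Longrightarrow> (b, e) \<in> set xs \<Longrightarrow> d = e"
  shows "settled (rev m' @ m) A"
  using assms
proof (induction arbitrary: m xs rule: pairing_of.induct)
  case (Skip ys m' a)
  from Skip.prems(1) obtain d zs where xs: "xs = (a, d) # zs" "ys = map fst zs" by (cases xs) auto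
  show ?case using Skip.IH[OF xs(2)] Skip.prems xs by (auto split: if_splits)
next
  case (Pair b ys m' a)
  from Pair.prems(1) obtain d zs where xs: "xs = (a, d) # zs" "ys = map fst zs" by (cases xs) auto
  from Pair.hyps(1) xs(2) obtain e where e: "(b, e) \<in> set zs" by auto
  have "d = e" using Pair.prems(4)[of a b d e] e xs by auto
  have "some_syms A m (a, d) zs zs" using Pair.prems(3) xs by (simp split: if_splits)
  from some_symsD[OF this e] \<open>d = e\<close> have *: "all_syms A ((a, b) # m) (remove1 (b, e) zs)" by simp
  have rem: "remove1 b ys = map fst (remove1 (b, e) zs)"
    using map_fst_remove1[of zs "(b, e)"] e xs(2) Pair.prems(2) by simp
  show ?case
  proof -
    have "settled (rev m' @ (a, b) # m) A"
    proof (rule Pair.IH[OF rem _ *])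
      show "distinct (remove1 b ys)" using Pair.prems(2) by (simp add: distinct_remove1)
    next
      fix a' b' d' e' assume "(a', b') \<in> set m'" "(a', d') \<in> set (remove1 (b, e) zs)"
        "(b', e') \<in> set (remove1 (b, e) zs)"
      then show "d' = e'" using Pair.prems(4)[of a' b' d' e'] xs(1) by (auto dest: notin_set_remove1)
    qed
    then show ?thesis by simp
  qed
qed auto

section \<open>Meaning of the executable tests\<close>

lemma has_sources_iff: "has_sources i j A \<longleftrightarrow> (\<exists>k. (i, j, k) \<in> set A)"
  by (induction A) (auto split: if_splits)

lemma has_arrow_iff: "has_arrow i j k A \<longleftrightarrow> (i, j, k) \<in> set A \<or> (j, i, k) \<in> set A"
  by (induction A) (auto split: if_splits)

lemma paired_iff: "paired i j m \<longleftrightarrow> (i, j) \<in> set m \<or> (j, i) \<in> set m"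
  by (induction m) (auto split: if_splits)

text \<open>Because \<open>i \<noteq> j\<close>, the first branch of the nested conditional cannot
  shadow the second.\<close>

lemma cancelsI:
  assumes "(a, b, l) \<in> set A" "i \<noteq> j"
    "{a, b} = {j, k} \<and> paired l i m \<or> {a, b} = {i, k} \<and> paired l j m"
  shows "cancels A m i j k"
  using assms(1)
proof (induction A)
  case (Cons x A)
  obtain a' b' l' where x: "x = (a', b', l')" by (cases x)
  show ?case
  proof (cases "x = (a, b, l)")
    case True
    from assms(2,3) have hit: "if a = j \<and> b = k \<or> a = k \<and> b = j then paired l i m
      else if a = i \<and> b = k \<or> a = k \<and> b = i then paired l j m else False"
      unfolding doubleton_eq_iff by argo
    show ?thesis unfolding True cancels.simps by (subst if_P[OF hit]) (rule TrueI)
  next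
    case False
    then have "cancels A m i j k" using Cons by auto
    then show ?thesis by (simp add: x)
  qed
qed simp

lemma jacobi_atI:
  "(\<And>i j. (i, j, x) \<in> set B \<Longrightarrow> k \<noteq> i \<Longrightarrow> k \<noteq> j \<Longrightarrow> cancels A m i j k) \<Longrightarrow> jacobi_at A B m x k"
  by (induction B) auto

lemma jacobi_okI:
  "(\<And>x y. (x, y) \<in> set m' \<Longrightarrow> jacobi_at A A m x y \<and> jacobi_at A A m y x) \<Longrightarrow> jacobi_ok A m m'"
  by (induction m') auto

lemma set_add_arrows: "set (add_arrows k m A) = (\<lambda>(i, j). (i, j, k)) ` set m \<union> set A"
  by (induction m) auto

lemma distinct_add_arrows:
  "distinct m \<Longrightarrow> distinct A \<Longrightarrow> (\<And>i j. (i, j, k) \<notin> set A) \<Longrightarrow> distinct (add_arrows k m A)"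
  by (induction m) (auto simp: set_add_arrows)

definition touches :: "nat \<Rightarrow> arrow \<Rightarrow> bool" where
  "touches v x = (case x of (i, j, k) \<Rightarrow> v = i \<or> v = j \<or> v = k)"

lemma touches_iff [simp]: "touches v (i, j, k) \<longleftrightarrow> v = i \<or> v = j \<or> v = k"
  by (simp add: touches_def)

lemma lone_True: "lone v True A \<Longrightarrow> filter (touches v) A = []"
  by (induction A) (auto split: if_splits)

lemma lone_False: "lone v False A \<Longrightarrow> \<exists>x. filter (touches v) A = [x]"
proof (induction A)
  case (Cons x A)
  then show ?case by (cases x) (auto simp: lone_True split: if_splits)
qed simp

lemma some_loneD: "some_lone vs A \<Longrightarrow> \<exists>v\<in>set vs. \<exists>x. filter (touches v) A = [x]"
  by (induction vs) (auto split: if_splits dest: lone_False)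

lemma violations_filter: "violations w A = filter (\<lambda>x. defect w x \<noteq> 0) A"
  by (induction A) auto

lemma obstructedD: "obstructed ws m A \<Longrightarrow> \<exists>w\<in>set ws. single_orbit w m (violations w A)"
  by (induction ws) (auto split: if_splits)

lemma contains_iff: "contains A B \<longleftrightarrow> (\<forall>(i, j, k)\<in>set B. has_arrow i j k A)"
  by (induction B) (auto split: if_splits)

lemma is_BD: "is_B ps A \<Longrightarrow> \<exists>(s, t, u)\<in>set ps. contains A (B_arrows s t u)"
  by (induction ps) (auto split: if_splits)

lemma is_CD: "is_C ps m A \<Longrightarrow> \<exists>(q, a, b, s, t)\<in>set ps. contains A (C_arrows q a b s t) \<and>
    swaps m q = q \<and> swaps m a = b \<and> swaps m s = t \<and> swaps m 6 = 6 \<and> swaps m 7 = 7"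
  by (induction ps) (auto split: if_splits)

lemma symmetricI: "(\<And>i j k. (i, j, k) \<in> set B \<Longrightarrow> has_arrow (swaps m i) (swaps m j) (swaps m k) A)
   \<Longrightarrow> symmetric m A B"
  by (induction B) auto

lemma swaps_eq:
  assumes "\<And>a b. (a, b) \<in> set m \<Longrightarrow> f a = b \<and> f b = a"
    "\<And>i. f i \<noteq> i \<Longrightarrow> (i, f i) \<in> set m \<or> (f i, i) \<in> set m"
  shows "swaps m i = f i"
proof -
  have "swaps m i = (if i \<in> fst ` set m \<union> snd ` set m then f i else i)"
    using assms(1)
  proof (induction m)
    case (Cons x m)
    obtain a b where x: "x = (a, b)" by (cases x)
    have "f a = b" "f b = a" using Cons.prems[of a b] x by auto
    moreover have "swaps m i = (if i \<in> fst ` set m \<union> snd ` set m then f i else i)"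
      using Cons.prems by (intro Cons.IH) auto
    ultimately show ?case by (cases "i = a"; cases "i = b") (simp_all add: x)
  qed simp
  moreover have "i \<in> fst ` set m \<union> snd ` set m" if "f i \<noteq> i"
    using assms(2)[OF that] by force
  ultimately show ?thesis by (cases "f i = i") auto
qed

lemma degree_eq: "degree v p q A = (p + length (filter (\<lambda>(i, j, k). k = v) A),
    q + length (filter (\<lambda>(i, j, k). k \<noteq> v \<and> (i = v \<or> j = v)) A))"
  by (induction v p q A rule: degree.induct) auto

lemma degrees_eq: "degrees vs A = map (\<lambda>v. (v, degree v 0 0 A)) vs"
  by (induction vs) auto

text \<open>The situation that the search describes: the height is \<open>id\<close>, so arrows
  point to larger numbers, and every node after a target is itself a target.\<close>

locale ordered_flat = diagonal_nice 7 c \<sigma> g id for c \<sigma> g +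
  assumes jacobi: "\<lbrakk>i \<in> rng 7; j \<in> rng 7; k \<in> rng 7; l \<in> rng 7\<rbrakk> \<Longrightarrow>
      (\<Sum>m\<in>rng 7. c i j m * c m k l + c j k m * c m i l + c k i m * c m j l) = 0"
    and balance: "b \<in> rng 7 \<Longrightarrow>
      (\<Sum>i\<in>rng 7. \<Sum>j\<in>rng 7. X i j b) = 2 * (\<Sum>j\<in>rng 7. \<Sum>k\<in>rng 7. X b j k)"
    and sources_first: "\<lbrakk>i \<in> rng 7; j \<in> rng 7; k \<in> rng 7; c i j k \<noteq> 0; l \<in> rng 7; k < l\<rbrakk> \<Longrightarrow>
      \<exists>i'\<in>rng 7. \<exists>j'\<in>rng 7. c i' j' l \<noteq> 0"
    and moved: "\<exists>i\<in>rng 7. \<sigma> i \<noteq> i"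
    and nonabelian: "\<exists>i\<in>rng 7. \<exists>j\<in>rng 7. \<exists>k\<in>rng 7. c i j k \<noteq> 0"
begin

lemma less: "\<lbrakk>i \<in> rng 7; j \<in> rng 7; k \<in> rng 7; c i j k \<noteq> 0\<rbrakk> \<Longrightarrow> i < k \<and> j < k"
  using height[of i j k] height2[of i j k] by simp

text \<open>Each arrow is kept with increasing sources and without repetition, so list length and
  sums over the set count it once. With \<open>n = 8\<close> all arrows are listed.\<close>

definition lists_below :: "nat \<Rightarrow> arrow list \<Rightarrow> bool" where
  "lists_below n A \<longleftrightarrow> distinct A \<and>
     set A = {(i, j, k). i \<in> rng 7 \<and> j \<in> rng 7 \<and> k \<in> rng 7 \<and> k < n \<and> i < j \<and> c i j k \<noteq> 0}"

lemma mem_listed: "lists_below n A \<Longrightarrow> (i, j, k) \<in> set A \<longleftrightarrow>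
    i \<in> rng 7 \<and> j \<in> rng 7 \<and> k \<in> rng 7 \<and> k < n \<and> i < j \<and> c i j k \<noteq> 0"
  by (simp add: lists_below_def)

lemma has_arrow_listed:
  assumes "lists_below n A" "i \<in> rng 7" "j \<in> rng 7" "k \<in> rng 7"
  shows "has_arrow i j k A \<longleftrightarrow> k < n \<and> c i j k \<noteq> 0"
proof -
  have "c i j k \<noteq> 0 \<longleftrightarrow> c j i k \<noteq> 0" using anti[of i j k] assms by simp
  moreover have "c i j k = 0" if "i = j" using anti[of i i k] assms that by simp
  ultimately show ?thesis
    using assms by (auto simp: has_arrow_iff mem_listed[OF assms(1)] not_less_iff_gr_or_eq)
qed

text \<open>By niceness only \<open>m = x\<close> contributes to the first of the three Jacobi sums.
  That single nonzero term has to be cancelled by one of the other two sums.\<close>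

lemma jacobi_witness:
  assumes "i \<in> rng 7" "j \<in> rng 7" "y \<in> rng 7" "x \<in> rng 7" "k \<in> rng 7" "c i j x \<noteq> 0" "c x y k \<noteq> 0"
  shows "\<exists>l\<in>rng 7. c j y l \<noteq> 0 \<and> c l i k \<noteq> 0 \<or> c y i l \<noteq> 0 \<and> c l j k \<noteq> 0"
proof (rule ccontr)
  assume "\<not> ?thesis"
  then have "c j y l * c l i k = 0 \<and> c y i l * c l j k = 0" if "l \<in> rng 7" for l using that by auto
  then have *: "c j y l * c l i k + c y i l * c l j k = 0" if "l \<in> rng 7" for l
    using that by (metis add_0)
  then have "(\<Sum>m\<in>rng 7. c i j m * c m y k + c j y m * c m i k + c y i m * c m j k)
    = (\<Sum>m\<in>rng 7. c i j m * c m y k)" by (intro sum.cong refl) (simp add: add.assoc *)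
  also have "\<dots> = (\<Sum>m\<in>rng 7. if m = x then c i j x * c x y k else 0)"
  proof (rule sum.cong[OF refl])
    fix m assume m: "m \<in> rng 7"
    show "c i j m * c m y k = (if m = x then c i j x * c x y k else 0)"
    proof (cases "m = x")
      case False
      then have "c i j m = 0" using target_unique[OF assms(1,2,4) m assms(6)] by blast
      then show ?thesis using False by simp
    qed simp
  qed
  also have "\<dots> = c i j x * c x y k" using assms by simp
  finally show False using jacobi[of i j y k] assms by simp
qed

lemma admissible_pairing:
  assumes A: "lists_below k A" and k: "k \<in> rng 7" and m: "distinct m"
    "set m = {(i, j). i \<in> rng 7 \<and> j \<in> rng 7 \<and> i < j \<and> c i j k \<noteq> 0}"
  shows "admissible A m"
proof (cases m)
  case Nil
  \<comment> \<open>If an earlier node were a target, \<open>sources_first\<close> would make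
    \<open>k\<close> one too.\<close>
  have "A = []"
  proof (rule ccontr)
    assume "A \<noteq> []"
    then obtain i j l where "(i, j, l) \<in> set A" by (cases A) auto
    with sources_first[of i j l k] k obtain i' j' where ij': "i' \<in> rng 7" "j' \<in> rng 7" "c i' j' k \<noteq> 0"
      unfolding mem_listed[OF A] by blast
    then have "(i', j') \<in> set m \<or> (j', i') \<in> set m"
      using anti[of i' j' k] c_diag anti[of i' i' k] k m(2) by (auto simp: not_less_iff_gr_or_eq)
    then show False using Nil by simp
  qed
  then show ?thesis using Nil by (simp add: admissible_def)
next
  case (Cons _ _)
  have paired: "paired i j m \<longleftrightarrow> c i j k \<noteq> 0" if "i \<in> rng 7" "j \<in> rng 7" for i j
    using that anti[of i j k] anti[of i i k] k unfolding paired_iff m(2)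
    by (auto simp: not_less_iff_gr_or_eq)
  have "jacobi_at A A m x y" if xy: "x \<in> rng 7" "y \<in> rng 7" "c x y k \<noteq> 0" for x y
  proof (rule jacobi_atI)
    fix i j assume "(i, j, x) \<in> set A" "y \<noteq> i" "y \<noteq> j"
    then have ij: "i \<in> rng 7" "j \<in> rng 7" "i < j" "c i j x \<noteq> 0" unfolding mem_listed[OF A] by auto
    from jacobi_witness[OF ij(1,2) xy(2,1) k ij(4) xy(3)]
    obtain l where l: "l \<in> rng 7" "c j y l \<noteq> 0 \<and> c l i k \<noteq> 0 \<or> c y i l \<noteq> 0 \<and> c l j k \<noteq> 0" by blast
    from l(2) show "cancels A m i j y"
    proof
      assume h: "c j y l \<noteq> 0 \<and> c l i k \<noteq> 0"
      then have "l < k" using less[of l i k] l ij k by blast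
      then have "has_arrow j y l A" using has_arrow_listed[OF A] l(1) ij xy h by blast
      then have "(j, y, l) \<in> set A \<or> (y, j, l) \<in> set A" unfolding has_arrow_iff .
      moreover have "paired l i m" using h paired[of l i] l(1) ij(1) by blast
      ultimately show ?thesis
        using cancelsI[of j y l A i j y m] cancelsI[of y j l A i j y m] ij(3) by auto
    next
      assume h: "c y i l \<noteq> 0 \<and> c l j k \<noteq> 0"
      then have "l < k" using less[of l j k] l ij k by blast
      then have "has_arrow y i l A" using has_arrow_listed[OF A] l(1) ij xy h by blast
      then have "(i, y, l) \<in> set A \<or> (y, i, l) \<in> set A" unfolding has_arrow_iff by blast
      moreover have "paired l j m" using h paired[of l j] l(1) ij(2) by blast
      ultimately show ?thesis
        using cancelsI[of i y l A i j y m] cancelsI[of y i l A i j y m] ij(3) by auto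
    qed
  qed
  moreover have "c y x k \<noteq> 0" if "c x y k \<noteq> 0" "x \<in> rng 7" "y \<in> rng 7" for x y
    using anti[of x y k] that k by simp
  ultimately have "jacobi_ok A m m" by (intro jacobi_okI) (auto simp: m(2))
  then show ?thesis using Cons by (simp add: admissible_def)
qed

text \<open>Uniqueness of the partner makes the source pairs of \<open>k\<close> a matching, which
  is one of the branches; uniqueness of the target shows that \<open>has_sources\<close> does not
  prune it.\<close>

lemma all_exts_step:
  assumes A: "lists_below k A" and k: "k \<in> rng 7" and xs: "xs = [1..<k]"
    and ext: "all_exts ((k, xs) # r) A"
  shows "\<exists>A'. lists_below (Suc k) A' \<and> all_exts r A'"
proof -
  define M where "M = {(i, j). i \<in> rng 7 \<and> j \<in> rng 7 \<and> i < j \<and> c i j k \<noteq> 0}"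
  have "\<exists>m. pairing_of xs m \<and> set m = M"
  proof (rule pairing_of_exists)
    show "sorted_wrt (<) xs" by (simp add: xs)
  next
    fix a b assume "(a, b) \<in> M"
    then show "a < b \<and> a \<in> set xs \<and> b \<in> set xs"
      using less[of a b k] k by (auto simp: M_def xs atLeastAtMost_iff)
  next
    fix a b a' b' assume ab: "(a, b) \<in> M" "(a', b') \<in> M" "{a, b} \<inter> {a', b'} \<noteq> {}"
    then have *: "c a b k \<noteq> 0" "c b a k \<noteq> 0" "c a' b' k \<noteq> 0" "c b' a' k \<noteq> 0" "a < b" "a' < b'"
      and in7: "a \<in> rng 7" "b \<in> rng 7" "a' \<in> rng 7" "b' \<in> rng 7"
      using anti[of a b k] anti[of a' b' k] k by (auto simp: M_def)
    from ab(3) consider "a = a'" | "a = b'" | "b = a'" | "b = b'" by auto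
    then show "a = a' \<and> b = b'"
    proof cases
      case 1
      then show ?thesis using source_unique[of a b b' k] * in7 k by blast
    next
      case 2
      then have "b = a'" using source_unique[of a b a' k] * in7 k by blast
      then show ?thesis using 2 * by linarith
    next
      case 3
      then have "a = b'" using source_unique[of b a b' k] * in7 k by blast
      then show ?thesis using 3 * by linarith
    next
      case 4
      then show ?thesis using source_unique[of b a a' k] * in7 k by blast
    qed
  qed
  then obtain m where m: "pairing_of xs m" "set m = M" by auto
  have dm: "distinct m" using pairing_of_distinct[OF m(1)] xs by simp
  have "all_exts r (add_arrows k (rev m @ []) A)"
  proof (rule all_pairsD[OF m(1)])
    show "all_pairs r A k [] xs" using ext by simp
    show "admissible A (rev m @ [])"
      by (rule admissible_pairing[OF A k]) (use dm m(2) in \<open>auto simp: M_def\<close>)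
  next
    fix a b assume ab: "(a, b) \<in> set m"
    show "\<not> has_sources a b A"
    proof
      assume "has_sources a b A"
      then obtain l where "(a, b, l) \<in> set A" by (auto simp: has_sources_iff)
      then have "l < k" "a \<in> rng 7" "b \<in> rng 7" "l \<in> rng 7" "c a b l \<noteq> 0"
        unfolding mem_listed[OF A] by blast+
      moreover have "c a b k \<noteq> 0" using ab unfolding m(2) M_def by blast
      ultimately show False using target_unique[of a b k l] k by blast
    qed
  qed
  moreover have "lists_below (Suc k) (add_arrows k (rev m @ []) A)"
    unfolding lists_below_def
  proof
    show "distinct (add_arrows k (rev m @ []) A)"
      using A dm by (intro distinct_add_arrows) (auto simp: lists_below_def)
    have "set (add_arrows k (rev m @ []) A) = (\<lambda>(i, j). (i, j, k)) ` M \<union> set A"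
      by (simp add: set_add_arrows m(2))
    also have "\<dots> = {(i, j, l). i \<in> rng 7 \<and> j \<in> rng 7 \<and> l \<in> rng 7 \<and> l < Suc k \<and> i < j \<and> c i j l \<noteq> 0}"
      using A k by (auto simp: lists_below_def M_def less_Suc_eq)
    finally show "set (add_arrows k (rev m @ []) A) = \<dots>" .
  qed
  ultimately show ?thesis by blast
qed

lemma checked_arrows: "\<exists>A. lists_below 8 A \<and> checked A"
proof -
  have r7: "k \<in> rng 7 \<longleftrightarrow> k \<ge> 1 \<and> k \<le> 7" for k :: nat by (simp add: atLeastAtMost_iff)
  \<comment> \<open>Since \<open>1 \<le> i < j < k\<close>, no arrow ends at node \<open>1\<close>
    or \<open>2\<close>.\<close>
  have "\<not> (i \<in> rng 7 \<and> j \<in> rng 7 \<and> k \<in> rng 7 \<and> k < 3 \<and> i < j \<and> c i j k \<noteq> 0)" for i j k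
  proof
    assume *: "i \<in> rng 7 \<and> j \<in> rng 7 \<and> k \<in> rng 7 \<and> k < 3 \<and> i < j \<and> c i j k \<noteq> 0"
    then have "j < k" using less[of i j k] by blast
    with * show False unfolding r7 by linarith
  qed
  then have l3: "lists_below 3 []" by (auto simp: lists_below_def)
  have s3: "all_exts [(3,[1,2]),(4,[1,2,3]),(5,[1,2,3,4]),(6,[1,2,3,4,5]),(7,[1,2,3,4,5,6])] []"
    using search unfolding stages_def .
  have upt: "[1,2] = [1..<3]" "[1,2,3] = [1..<4]" "[1,2,3,4] = [1..<5]"
    "[1,2,3,4,5] = [1..<6]" "[1,2,3,4,5,6] = [1..<7]" by (simp_all add: upt_rec)
  have r: "3 \<in> rng 7" "4 \<in> rng 7" "5 \<in> rng 7" "6 \<in> rng 7" "7 \<in> rng 7" unfolding r7 by simp_all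
  have suc: "Suc 3 = 4" "Suc 4 = 5" "Suc 5 = 6" "Suc 6 = 7" "Suc 7 = 8" by simp_all
  obtain A4 where A4: "lists_below 4 A4" "all_exts [(4,[1,2,3]),(5,[1,2,3,4]),(6,[1,2,3,4,5]),(7,[1,2,3,4,5,6])] A4"
    using all_exts_step[OF l3 r(1) upt(1) s3] unfolding suc by blast
  obtain A5 where A5: "lists_below 5 A5" "all_exts [(5,[1,2,3,4]),(6,[1,2,3,4,5]),(7,[1,2,3,4,5,6])] A5"
    using all_exts_step[OF A4(1) r(2) upt(2) A4(2)] unfolding suc by blast
  obtain A6 where A6: "lists_below 6 A6" "all_exts [(6,[1,2,3,4,5]),(7,[1,2,3,4,5,6])] A6"
    using all_exts_step[OF A5(1) r(3) upt(3) A5(2)] unfolding suc by blast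
  obtain A7 where A7: "lists_below 7 A7" "all_exts [(7,[1,2,3,4,5,6])] A7"
    using all_exts_step[OF A6(1) r(4) upt(4) A6(2)] unfolding suc by blast
  obtain A8 where "lists_below 8 A8" "all_exts [] A8"
    using all_exts_step[OF A7(1) r(5) upt(5) A7(2)] unfolding suc by blast
  then show ?thesis by auto
qed

end

section \<open>Weights as obstructions, and the surviving arrow lists\<close>

definition increasing :: "arrow \<Rightarrow> arrow" where
  "increasing = (\<lambda>(i, j, k). (min i j, max i j, k))"

context ordered_flat begin

definition Y :: "arrow \<Rightarrow> real" where "Y = (\<lambda>(i, j, k). X i j k)"

text \<open>Multiply the balance at \<open>b\<close> by \<open>w b\<close> and sum over
  \<open>b\<close>: this gives the identity over ordered triples. The summand is symmetric in the
  sources and vanishes when they coincide, so the part with \<open>i < j\<close> is half of the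
  total.\<close>

lemma weighted_balance:
  fixes w :: "nat \<Rightarrow> real"
  assumes A: "lists_below 8 A"
  shows "(\<Sum>x\<in>set A. Y x * (case x of (i, j, k) \<Rightarrow> w k - w i - w j)) = 0"
proof -
  let ?R = "rng 7"
  define F where "F i j k = X i j k * (w k - w i - w j)" for i j k
  define G where "G i j = (\<Sum>k\<in>?R. F i j k)" for i j
  have F_sym: "F i j k = F j i k" if "i \<in> ?R" "j \<in> ?R" "k \<in> ?R" for i j k
    using X_sym[OF that] by (simp add: F_def algebra_simps)
  have G_sym: "G i j = G j i" if "i \<in> ?R" "j \<in> ?R" for i j
    unfolding G_def by (intro sum.cong refl F_sym that)
  have G_diag: "G i i = 0" if "i \<in> ?R" for i
    unfolding G_def using that anti[of i i] by (intro sum.neutral ballI) (simp add: F_def arrow_val_def)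
  have out1: "(\<Sum>i\<in>?R. \<Sum>j\<in>?R. \<Sum>k\<in>?R. X i j k * w i) = (\<Sum>b\<in>?R. w b * (\<Sum>j\<in>?R. \<Sum>k\<in>?R. X b j k))"
    by (simp add: sum_distrib_left mult.commute)
  have "(\<Sum>i\<in>?R. \<Sum>j\<in>?R. \<Sum>k\<in>?R. X i j k * w j) = (\<Sum>j\<in>?R. \<Sum>i\<in>?R. \<Sum>k\<in>?R. X j i k * w j)"
    by (subst sum.swap, intro sum.cong refl) (use X_sym in simp)
  then have out2: "(\<Sum>i\<in>?R. \<Sum>j\<in>?R. \<Sum>k\<in>?R. X i j k * w j) = (\<Sum>b\<in>?R. w b * (\<Sum>j\<in>?R. \<Sum>k\<in>?R. X b j k))"
    using out1 by simp
  have "(\<Sum>i\<in>?R. \<Sum>j\<in>?R. \<Sum>k\<in>?R. X i j k * w k) = (\<Sum>i\<in>?R. \<Sum>k\<in>?R. \<Sum>j\<in>?R. X i j k * w k)"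
    by (intro sum.cong refl sum.swap)
  also have "\<dots> = (\<Sum>b\<in>?R. \<Sum>i\<in>?R. \<Sum>j\<in>?R. X i j b * w b)" by (rule sum.swap)
  also have "\<dots> = (\<Sum>b\<in>?R. w b * (\<Sum>i\<in>?R. \<Sum>j\<in>?R. X i j b))"
    by (simp add: sum_distrib_left mult.commute)
  also have "\<dots> = (\<Sum>b\<in>?R. w b * (2 * (\<Sum>j\<in>?R. \<Sum>k\<in>?R. X b j k)))"
    using balance by (intro sum.cong refl) simp
  also have "\<dots> = 2 * (\<Sum>b\<in>?R. w b * (\<Sum>j\<in>?R. \<Sum>k\<in>?R. X b j k))"
    by (simp add: sum_distrib_left mult.left_commute)
  finally have "(\<Sum>i\<in>?R. \<Sum>j\<in>?R. G i j) = 0"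
    unfolding G_def F_def using out1 out2 by (simp add: right_diff_distrib sum_subtractf)
  also have "(\<Sum>i\<in>?R. \<Sum>j\<in>?R. G i j) =
      (\<Sum>i\<in>?R. \<Sum>j\<in>?R. (if i < j then G i j else 0) + (if j < i then G i j else 0))"
    by (intro sum.cong refl) (use G_diag in \<open>auto simp: not_less_iff_gr_or_eq\<close>)
  also have "\<dots> = (\<Sum>i\<in>?R. \<Sum>j\<in>?R. if i < j then G i j else 0) + (\<Sum>i\<in>?R. \<Sum>j\<in>?R. if j < i then G i j else 0)"
    by (simp add: sum.distrib)
  also have "(\<Sum>i\<in>?R. \<Sum>j\<in>?R. if j < i then G i j else 0) = (\<Sum>i\<in>?R. \<Sum>j\<in>?R. if i < j then G i j else 0)"
    by (subst sum.swap, intro sum.cong refl) (use G_sym in simp)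
  finally have "(\<Sum>i\<in>?R. \<Sum>j\<in>?R. if i < j then G i j else 0) = 0" by simp
  also have "(\<Sum>i\<in>?R. \<Sum>j\<in>?R. if i < j then G i j else 0) =
      (\<Sum>i\<in>?R. \<Sum>j\<in>?R. \<Sum>k\<in>?R. if i < j then F i j k else 0)"
    unfolding G_def by (intro sum.cong refl) simp
  also have "\<dots> = (\<Sum>(i, j, k)\<in>?R \<times> ?R \<times> ?R. if i < j then F i j k else 0)"
    by (simp add: sum.cartesian_product)
  also have "\<dots> = (\<Sum>(i, j, k)\<in>set A. F i j k)"
  proof (rule sum.mono_neutral_cong_right)
    show "set A \<subseteq> ?R \<times> ?R \<times> ?R" using mem_listed[OF A] by auto
    show "\<forall>x\<in>?R \<times> ?R \<times> ?R - set A. (case x of (i, j, k) \<Rightarrow> if i < j then F i j k else 0) = 0"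
      using mem_listed[OF A] by (auto simp: F_def arrow_val_def atLeastAtMost_iff)
    show "(case x of (i, j, k) \<Rightarrow> if i < j then F i j k else 0) = (case x of (i, j, k) \<Rightarrow> F i j k)"
      if "x \<in> set A" for x
    proof -
      obtain i j k where "x = (i, j, k)" by (cases x)
      then show ?thesis using that mem_listed[OF A] by simp
    qed
  qed simp
  finally show ?thesis by (simp add: F_def Y_def case_prod_unfold)
qed

lemma Y_nonzero: "lists_below 8 A \<Longrightarrow> x \<in> set A \<Longrightarrow> Y x \<noteq> 0"
  using X_eq_0_iff by (auto simp: Y_def mem_listed split: prod.splits)

lemma weighted_violations:
  fixes w :: "nat \<Rightarrow> real"
  assumes A: "lists_below 8 A" and P: "\<And>i j k. (i, j, k) \<in> set A \<Longrightarrow> P (i, j, k) \<longleftrightarrow> w k - w i - w j \<noteq> 0"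
  shows "(\<Sum>x\<in>set (filter P A). Y x * (case x of (i, j, k) \<Rightarrow> w k - w i - w j)) = 0"
proof -
  have "(\<Sum>x\<in>set (filter P A). Y x * (case x of (i, j, k) \<Rightarrow> w k - w i - w j))
    = (\<Sum>x\<in>set A. Y x * (case x of (i, j, k) \<Rightarrow> w k - w i - w j))"
    by (rule sum.mono_neutral_left) (use P in auto)
  then show ?thesis using weighted_balance[OF A, of w] by simp
qed

lemma no_lone:
  assumes A: "lists_below 8 A" and "some_lone vs A"
  shows False
proof -
  from some_loneD[OF assms(2)] obtain v x where x: "filter (touches v) A = [x]" by blast
  have "x \<in> set (filter (touches v) A)" unfolding x by simp
  then have xA: "x \<in> set A" and tx: "touches v x" by auto
  let ?w = "\<lambda>i. if i = v then 1 else 0 :: real"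
  \<comment> \<open>The nodes of an arrow are distinct, so a touching arrow has defect 1 or
    -1.\<close>
  have P: "touches v (i, j, k) \<longleftrightarrow> ?w k - ?w i - ?w j \<noteq> 0" if "(i, j, k) \<in> set A" for i j k
    using that less[of i j k] unfolding mem_listed[OF A] by auto
  obtain i j k where ijk: "x = (i, j, k)" by (cases x)
  have "?w k - ?w i - ?w j \<noteq> 0" using P xA ijk tx by blast
  moreover have "Y x * (?w k - ?w i - ?w j) = 0"
    using weighted_violations[OF A, where w = ?w and P = "touches v"] P x by (simp add: ijk)
  ultimately show False using Y_nonzero[OF A xA] by (metis mult_eq_0_iff)
qed

text \<open>Arrows exchanged by \<open>\<sigma>\<close> have the same value, so the weighted balance
  reduces to one or two copies of a nonzero product.\<close>

lemma no_single_orbit: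
  assumes A: "lists_below 8 A" and m: "\<And>i. i \<in> rng 7 \<Longrightarrow> swaps m i = \<sigma> i"
    and orb: "single_orbit w m (violations w A)"
  shows False
proof -
  let ?w = "\<lambda>i. real_of_int (wt w i)"
  have d: "real_of_int (defect w x) = (case x of (i, j, k) \<Rightarrow> ?w k - ?w i - ?w j)" for x
    by (cases x) simp
  have P: "defect w (i, j, k) \<noteq> 0 \<longleftrightarrow> ?w k - ?w i - ?w j \<noteq> 0" for i j k
    using d[of "(i, j, k)"] by (metis case_prod_conv of_int_eq_0_iff)
  have sum0: "(\<Sum>x\<in>set (violations w A). Y x * real_of_int (defect w x)) = 0"
    using weighted_violations[OF A, where w = ?w and P = "\<lambda>x. defect w x \<noteq> 0"] P
    unfolding violations_filter d by blast
  have sub: "x \<in> set A \<and> defect w x \<noteq> 0" if "x \<in> set (violations w A)" for x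
    using that unfolding violations_filter by auto
  have dist: "distinct (violations w A)" using A unfolding violations_filter lists_below_def by simp
  from orb consider x where "violations w A = [x]"
    | x y where "violations w A = [x, y]" "defect w x = defect w y" "image_of m x y"
    by (cases "(w, m, violations w A)" rule: single_orbit.cases) (auto split: if_splits)
  then show False
  proof cases
    case (1 x)
    then have "Y x * real_of_int (defect w x) = 0" using sum0 by simp
    then show False using sub[of x] Y_nonzero[OF A, of x] 1 by simp
  next
    case (2 x y)
    obtain i j k where x: "x = (i, j, k)" by (cases x)
    obtain a b l where y: "y = (a, b, l)" by (cases y)
    have in7: "i \<in> rng 7" "j \<in> rng 7" "k \<in> rng 7" "a \<in> rng 7" "b \<in> rng 7" "l \<in> rng 7"
      using sub[of x] sub[of y] 2(1) unfolding x y mem_listed[OF A] by auto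
    have "\<sigma> k = l" "\<sigma> i = a \<and> \<sigma> j = b \<or> \<sigma> i = b \<and> \<sigma> j = a"
      using 2(3) m in7 by (auto simp: x y)
    then have "X a b l = X i j k"
      using X_\<sigma>[of i j k] X_sym[of a b l] in7 by auto
    then have "Y x = Y y" by (simp add: Y_def x y)
    moreover have "x \<noteq> y" using dist 2(1) by simp
    ultimately have "2 * (Y x * real_of_int (defect w x)) = 0"
      using sum0 2(1,2) by auto
    then show False using sub[of x] Y_nonzero[OF A, of x] 2(1) by simp
  qed
qed

definition \<phi> :: "arrow \<Rightarrow> arrow" where
  "\<phi> = (\<lambda>(i, j, k). increasing (\<sigma> i, \<sigma> j, \<sigma> k))"

text \<open>The map \<open>\<phi>\<close> is an involution of the arrow list that carries the arrows
  counted at \<open>v\<close> to those counted at \<open>\<sigma> v\<close>.\<close>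

lemma degree_\<sigma>:
  assumes A: "lists_below 8 A" and v: "v \<in> rng 7"
  shows "degree (\<sigma> v) 0 0 A = degree v 0 0 A"
proof -
  have inj: "\<sigma> i = \<sigma> j \<longleftrightarrow> i = j" if "i \<in> rng 7" "j \<in> rng 7" for i j
    using \<sigma>_\<sigma> that by metis
  have \<phi>A: "\<phi> x \<in> set A" and \<phi>\<phi>: "\<phi> (\<phi> x) = x" if "x \<in> set A" for x
  proof -
    obtain i j k where x: "x = (i, j, k)" by (cases x)
    with that have in7: "i \<in> rng 7" "j \<in> rng 7" "k \<in> rng 7" "i < j" "c i j k \<noteq> 0" "k < 8"
      unfolding mem_listed[OF A, symmetric] x by (auto simp: mem_listed[OF A])
    have "\<sigma> i \<noteq> \<sigma> j" using inj in7 by auto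
    moreover have "c (\<sigma> i) (\<sigma> j) (\<sigma> k) \<noteq> 0" "c (\<sigma> j) (\<sigma> i) (\<sigma> k) \<noteq> 0"
      using \<sigma>_edge[of i j k] anti[of "\<sigma> i" "\<sigma> j" "\<sigma> k"] in7 \<sigma>_rng by auto
    moreover have "\<sigma> k < 8" using \<sigma>_rng[of k] in7 by (simp add: atLeastAtMost_iff)
    ultimately show "\<phi> x \<in> set A"
      using in7 \<sigma>_rng by (auto simp: x \<phi>_def increasing_def mem_listed[OF A] min_def max_def)
    show "\<phi> (\<phi> x) = x"
      using in7 \<sigma>_\<sigma> by (auto simp: x \<phi>_def increasing_def min_def max_def)
  qed
  have count: "length (filter P A) = length (filter Q A)" if "\<And>x. x \<in> set A \<Longrightarrow> P x \<longleftrightarrow> Q (\<phi> x)" for P Q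
  proof -
    have "P (\<phi> x) \<longleftrightarrow> Q x" if "x \<in> set A" for x
      using \<open>\<And>x. x \<in> set A \<Longrightarrow> P x \<longleftrightarrow> Q (\<phi> x)\<close>[OF \<phi>A[OF that]] \<phi>\<phi>[OF that] by simp
    then have "bij_betw \<phi> {x \<in> set A. P x} {x \<in> set A. Q x}"
      using \<open>\<And>x. x \<in> set A \<Longrightarrow> P x \<longleftrightarrow> Q (\<phi> x)\<close>
      by (intro bij_betw_byWitness[where f' = \<phi>] ballI image_subsetI) (blast intro: \<phi>A \<phi>\<phi>)+
    then have "card {x \<in> set A. P x} = card {x \<in> set A. Q x}" by (rule bij_betw_same_card)
    moreover have "distinct A" using A by (simp add: lists_below_def)
    ultimately show ?thesis
      by (metis Collect_conj_eq Collect_mem_eq distinct_length_filter Int_commute)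
  qed
  show ?thesis unfolding degree_eq
  proof (intro arg_cong2[where f = Pair] arg_cong2[where f = plus] refl count[symmetric])
    fix x assume xA: "x \<in> set A"
    obtain i j k where "x = (i, j, k)" by (cases x)
    with xA have x: "x = (i, j, k)" "i \<in> rng 7" "j \<in> rng 7" "k \<in> rng 7"
      using mem_listed[OF A, of i j k] by auto
    show "(case x of (i, j, k) \<Rightarrow> k = v) \<longleftrightarrow> (case \<phi> x of (i, j, k) \<Rightarrow> k = \<sigma> v)"
      using x inj v by (simp add: \<phi>_def increasing_def)
    show "(case x of (i, j, k) \<Rightarrow> k \<noteq> v \<and> (i = v \<or> j = v)) \<longleftrightarrow>
        (case \<phi> x of (i, j, k) \<Rightarrow> k \<noteq> \<sigma> v \<and> (i = \<sigma> v \<or> j = \<sigma> v))"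
      using x inj[of k v] inj[of i v] inj[of j v] v by (auto simp: \<phi>_def increasing_def min_def max_def)
  qed
qed

lemma classification:
  obtains A where "lists_below 8 A" "length A = 6"
    "(\<exists>(s, t, u)\<in>set B_params. contains A (B_arrows s t u)) \<or>
     (\<exists>(q, a, b, s, t)\<in>set C_params. contains A (C_arrows q a b s t) \<and>
        \<sigma> q = q \<and> \<sigma> a = b \<and> \<sigma> s = t \<and> \<sigma> 6 = 6 \<and> \<sigma> 7 = 7)"
proof -
  from checked_arrows obtain A where A: "lists_below 8 A" and chk: "checked A" by blast
  have r7: "k \<in> rng 7 \<longleftrightarrow> k \<ge> 1 \<and> k \<le> 7" for k :: nat by (simp add: atLeastAtMost_iff)
  have "A \<noteq> []"
  proof
    assume "A = []"
    obtain i j k where ijk: "i \<in> rng 7" "j \<in> rng 7" "k \<in> rng 7" "c i j k \<noteq> 0" using nonabelian by blast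
    then have "has_arrow i j k A" using has_arrow_listed[OF A ijk(1-3)] r7 by simp
    then show False using \<open>A = []\<close> by simp
  qed
  moreover have "\<not> some_lone [1,2,3,4,5,6,7] A" using no_lone[OF A] by blast
  ultimately have syms: "all_syms A [] (degrees [1,2,3,4,5,6,7] A)"
    using chk by (simp only: checked_def split: list.splits if_splits) blast
  define M where "M = {(i, j). i \<in> rng 7 \<and> i < j \<and> \<sigma> i = j}"
  have M_rng: "i \<in> rng 7 \<and> j \<in> rng 7 \<and> i < j \<and> \<sigma> i = j \<and> \<sigma> j = i" if "(i, j) \<in> M" for i j
    using that \<sigma>_rng[of i] \<sigma>_\<sigma>[of i] by (auto simp: M_def)
  have r7set: "set [1,2,3,4,5,6,7] = rng 7" by (auto simp: r7)
  have "\<exists>m. pairing_of [1,2,3,4,5,6,7] m \<and> set m = M"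
  proof (rule pairing_of_exists)
    fix a b assume "(a, b) \<in> M"
    then show "a < b \<and> a \<in> set [1,2,3,4,5,6,7] \<and> b \<in> set [1,2,3,4,5,6,7]"
      unfolding r7set using M_rng by blast
  next
    fix a b a' b' assume *: "(a, b) \<in> M" "(a', b') \<in> M" "{a, b} \<inter> {a', b'} \<noteq> {}"
    then consider "a = a'" | "a = b'" | "b = a'" | "b = b'" by blast
    then show "a = a' \<and> b = b'"
      by cases (use M_rng[OF *(1)] M_rng[OF *(2)] in auto)
  qed simp
  then obtain m where m: "pairing_of [1,2,3,4,5,6,7] m" "set m = M" by blast
  have "settled (rev m @ []) A"
  proof (rule all_symsD[OF m(1) _ _ syms])
    show "[1,2,3,4,5,6,7] = map fst (degrees [1,2,3,4,5,6,7] A)" by (simp add: degrees_eq)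
  next
    fix a b d e assume ab: "(a, b) \<in> set m" and d: "(a, d) \<in> set (degrees [1,2,3,4,5,6,7] A)"
      and e: "(b, e) \<in> set (degrees [1,2,3,4,5,6,7] A)"
    have "d = degree a 0 0 A" "e = degree b 0 0 A" using d e unfolding degrees_eq by auto
    then show "d = e" using degree_\<sigma>[OF A, of a] M_rng[of a b] ab m(2) by metis
  qed simp
  then have settled: "settled (rev m) A" by simp
  have sw: "swaps (rev m) i = \<sigma> i" if "i \<in> rng 7" for i
  proof -
    \<comment> \<open>Outside \<open>rng 7\<close> nothing is known about \<open>\<sigma>\<close>,
      whereas \<open>swaps\<close> is the identity there; so \<open>\<sigma>\<close> is first
      extended by the identity.\<close>
    have "swaps (rev m) i = (if i \<in> rng 7 then \<sigma> i else i)"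
    proof (rule swaps_eq[where f = "\<lambda>i. if i \<in> rng 7 then \<sigma> i else i"])
      fix a b assume "(a, b) \<in> set (rev m)"
      then show "(if a \<in> rng 7 then \<sigma> a else a) = b \<and> (if b \<in> rng 7 then \<sigma> b else b) = a"
        using M_rng[of a b] m(2) by auto
    next
      fix i assume "(if i \<in> rng 7 then \<sigma> i else i) \<noteq> i"
      then have "i \<in> rng 7" "\<sigma> i \<noteq> i" by (auto split: if_splits)
      then have "(i, \<sigma> i) \<in> M \<or> (\<sigma> i, i) \<in> M"
        using \<sigma>_rng[of i] \<sigma>_\<sigma>[of i] by (auto simp: M_def)
      then show "(i, if i \<in> rng 7 then \<sigma> i else i) \<in> set (rev m) \<or> (if i \<in> rng 7 then \<sigma> i else i, i) \<in> set (rev m)"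
        using \<open>i \<in> rng 7\<close> m(2) by simp
    qed
    then show ?thesis using that by simp
  qed
  have "rev m \<noteq> []"
  proof
    assume "rev m = []"
    obtain i where "i \<in> rng 7" "\<sigma> i \<noteq> i" using moved by blast
    then show False using sw[of i] \<open>rev m = []\<close> by simp
  qed
  moreover have "symmetric (rev m) A A"
  proof (rule symmetricI)
    fix i j k assume "(i, j, k) \<in> set A"
    then have ijk: "i \<in> rng 7" "j \<in> rng 7" "k \<in> rng 7" "c i j k \<noteq> 0" unfolding mem_listed[OF A] by auto
    then show "has_arrow (swaps (rev m) i) (swaps (rev m) j) (swaps (rev m) k) A"
      using has_arrow_listed[OF A, of "\<sigma> i" "\<sigma> j" "\<sigma> k"] \<sigma>_edge[of i j k] \<sigma>_rng sw r7[of "\<sigma> k"] by simp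
  qed
  moreover have "\<not> obstructed weights (rev m) A"
    using obstructedD no_single_orbit[OF A sw] by blast
  ultimately have six: "length A = 6" and BC: "is_B B_params A \<or> is_C C_params (rev m) A"
    using settled unfolding settled_def by (auto split: list.splits if_splits)
  have par: "q \<in> rng 7 \<and> a \<in> rng 7 \<and> s \<in> rng 7" if "(q, a, b, s, t) \<in> set C_params" for q a b s t
    using that unfolding C_params_def by (auto simp: r7)
  have r67: "6 \<in> rng 7" "7 \<in> rng 7" by (auto simp: r7)
  from BC show thesis
  proof
    assume "is_B B_params A"
    then show thesis using that[OF A six] is_BD by blast
  next
    assume "is_C C_params (rev m) A"
    from is_CD[OF this] obtain q a b s t where C: "(q, a, b, s, t) \<in> set C_params"
      "contains A (C_arrows q a b s t)" "swaps (rev m) q = q" "swaps (rev m) a = b" "swaps (rev m) s = t"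
      "swaps (rev m) 6 = 6" "swaps (rev m) 7 = 7" by auto
    then have "\<sigma> q = q \<and> \<sigma> a = b \<and> \<sigma> s = t \<and> \<sigma> 6 = 6 \<and> \<sigma> 7 = 7"
      using sw par[OF C(1)] r67 by metis
    with C(1,2) show thesis by (intro that[OF A six] disjI2 bexI[of _ "(q, a, b, s, t)"]) auto
  qed
qed

end

section \<open>The two surviving diagrams\<close>

lemma omL_nonzero:
  assumes "omL lam k i j \<noteq> 0"
  shows "(i, j, k) \<in> {(1,2,4),(1,3,5),(2,3,6),(1,6,7),(2,5,7),(3,4,7)}"
proof (rule ccontr)
  assume neg: "\<not> ?thesis"
  have "(k, i, j) \<noteq> (4,1,2)" "(k, i, j) \<noteq> (5,1,3)" "(k, i, j) \<noteq> (6,2,3)"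
    "(k, i, j) \<noteq> (7,1,6)" "(k, i, j) \<noteq> (7,2,5)" "(k, i, j) \<noteq> (7,3,4)"
    by (rule notI, use neg in simp)+
  then have "omL lam k i j = 0" by (simp only: omL_def if_False simp_thms)
  with assms show False by simp
qed

lemma Lsc_nonzero:
  assumes "Lsc lam x y z \<noteq> 0"
  shows "(x, y, z) \<in> {(1,2,4),(1,3,5),(2,3,6),(1,6,7),(2,5,7),(3,4,7)} \<or>
    (y, x, z) \<in> {(1,2,4),(1,3,5),(2,3,6),(1,6,7),(2,5,7),(3,4,7)}"
proof (cases "x < y")
  case True
  with assms have "omL lam z x y \<noteq> 0" unfolding Lsc_def sc_of_de_def by simp
  from omL_nonzero[OF this] show ?thesis by (rule disjI1)
next
  case False
  with assms have "omL lam z y x \<noteq> 0" unfolding Lsc_def sc_of_de_def by (cases "y < x") simp_all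
  from omL_nonzero[OF this] show ?thesis by (rule disjI2)
qed

lemma Lsc_anti: "Lsc lam x y z = - Lsc lam y x z"
  unfolding Lsc_def sc_of_de_def by (rule linorder_cases[of x y]) simp_all

lemma Lsc_values [simp]:
  "Lsc lam 1 2 4 = 1 - lam" "Lsc lam 1 3 5 = - lam" "Lsc lam 2 3 6 = -1"
  "Lsc lam 1 6 7 = -1" "Lsc lam 2 5 7 = -1" "Lsc lam 3 4 7 = -1"
  by (simp_all add: Lsc_def sc_of_de_def omL_def)

context diagonal_nice begin

lemma sum_target:
  assumes "i \<in> rng n" "j \<in> rng n" "k \<in> rng n" "c i j k \<noteq> 0"
  shows "(\<Sum>m\<in>rng n. c i j m * f m) = c i j k * f k"
proof -
  have "(\<Sum>m\<in>rng n. c i j m * f m) = (\<Sum>m\<in>rng n. if m = k then c i j k * f k else 0)"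
  proof (rule sum.cong[OF refl])
    fix m assume m: "m \<in> rng n"
    show "c i j m * f m = (if m = k then c i j k * f k else 0)"
    proof (cases "m = k")
      case False
      then have "c i j m = 0" using target_unique[OF assms(1-3) m assms(4)] by blast
      then show ?thesis using False by simp
    qed simp
  qed
  then show ?thesis using assms by simp
qed

end

context ordered_flat begin

lemma arrows_eq:
  assumes A: "lists_below 8 A" and six: "length A = 6" and B: "contains A B" "length B = 6"
    "distinct (map increasing B)"
  shows "set A = increasing ` set B"
proof (rule sym, rule card_subset_eq)
  have "card (set (map increasing B)) = 6" using B by (simp only: distinct_card length_map)
  moreover have "card (set A) = 6" using six distinct_card[of A] conjunct1[OF A[unfolded lists_below_def]] by simp
  ultimately show "card (increasing ` set B) = card (set A)" by simp
  show "increasing ` set B \<subseteq> set A"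
  proof
    fix y assume "y \<in> increasing ` set B"
    then obtain i j k where y: "y = increasing (i, j, k)" "(i, j, k) \<in> set B" by auto
    then have "(i, j, k) \<in> set A \<or> (j, i, k) \<in> set A"
      using B(1) unfolding contains_iff has_arrow_iff by auto
    then show "y \<in> set A" using y(1) by (auto simp: increasing_def mem_listed[OF A])
  qed
qed simp

lemma edge_iff:
  assumes A: "lists_below 8 A" and B: "set A = increasing ` set B"
    and ijk: "i \<in> rng 7" "j \<in> rng 7" "k \<in> rng 7" "i \<noteq> j"
  shows "c i j k \<noteq> 0 \<longleftrightarrow> increasing (i, j, k) \<in> increasing ` set B"
proof -
  have "k < 8" using ijk(3) by (simp add: atLeastAtMost_iff)
  moreover have "c i j k \<noteq> 0 \<longleftrightarrow> c j i k \<noteq> 0" using anti[of i j k] ijk by simp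
  ultimately show ?thesis
    unfolding B[symmetric] using ijk by (auto simp: increasing_def mem_listed[OF A] min_def max_def)
qed

lemma balance_list:
  fixes w :: "nat \<Rightarrow> real"
  assumes A: "lists_below 8 A" and B: "set A = increasing ` set B" "distinct (map increasing B)"
    "set B \<subseteq> rng 7 \<times> rng 7 \<times> rng 7"
  shows "(\<Sum>(i, j, k)\<leftarrow>B. X i j k * (w k - w i - w j)) = 0"
proof -
  let ?F = "\<lambda>x. Y x * (case x of (i, j, k) \<Rightarrow> w k - w i - w j)"
  have "0 = (\<Sum>x\<in>set A. ?F x)" using weighted_balance[OF A] by simp
  also have "\<dots> = (\<Sum>x\<in>set B. ?F (increasing x))"
    unfolding B(1) using B(2) by (subst sum.reindex) (auto simp: distinct_map)
  also have "\<dots> = (\<Sum>x\<leftarrow>B. ?F (increasing x))"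
    using B(2) by (simp add: sum.distinct_set_conv_list distinct_map)
  also have "\<dots> = (\<Sum>(i, j, k)\<leftarrow>B. X i j k * (w k - w i - w j))"
  proof (intro arg_cong[where f = sum_list] map_cong refl)
    fix x assume "x \<in> set B"
    moreover obtain i j k where x: "x = (i, j, k)" by (cases x)
    ultimately have "i \<in> rng 7" "j \<in> rng 7" "k \<in> rng 7" using B(3) by auto
    then show "?F (increasing x) = (case x of (i, j, k) \<Rightarrow> X i j k * (w k - w i - w j))"
      using X_sym[of i j k] by (auto simp: x increasing_def Y_def min_def max_def)
  qed
  finally show ?thesis by simp
qed

text \<open>Balance forces \<open>X\<close> to have opposite signs on \<open>{q, b} \<rightarrow> s\<close> and \<open>{a, s} \<rightarrow> 6\<close> and also forces
  \<open>g q * g 6 > 0\<close>, whereas by the Jacobi identity the two values then have the same sign.\<close>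

lemma C_impossible:
  assumes A: "lists_below 8 A" "length A = 6" and par: "(q, a, b, s, t) \<in> set C_params"
    and C: "contains A (C_arrows q a b s t)"
    and \<sigma>: "\<sigma> q = q" "\<sigma> a = b" "\<sigma> s = t" "\<sigma> 6 = 6" "\<sigma> 7 = 7"
  shows False
proof -
  let ?B = "C_arrows q a b s t"
  have r7: "k \<in> rng 7 \<longleftrightarrow> k \<ge> 1 \<and> k \<le> 7" for k :: nat by (simp add: atLeastAtMost_iff)
  have in7: "q \<in> rng 7" "a \<in> rng 7" "b \<in> rng 7" "s \<in> rng 7" "t \<in> rng 7" "6 \<in> rng 7" "7 \<in> rng 7"
    using par by (auto simp: C_params_def r7)
  have dist: "distinct (map increasing ?B)"
    using par by (auto simp: C_params_def C_arrows_def increasing_def)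
  have B: "set A = increasing ` set ?B"
    by (rule arrows_eq[OF A C _ dist]) (simp add: C_arrows_def)
  have neq: "q \<noteq> a" "q \<noteq> b" "a \<noteq> b" "a \<noteq> s" "b \<noteq> t" "q \<noteq> 6" "s \<noteq> t"
    using par by (auto simp: C_params_def)
  have sub: "set ?B \<subseteq> rng 7 \<times> rng 7 \<times> rng 7" using in7 by (simp add: C_arrows_def)
  note bal = balance_list[OF A(1) B dist sub]
  note edge = edge_iff[OF A(1) B]
  have arrows: "c q b s \<noteq> 0" "c q a t \<noteq> 0" "c a s 6 \<noteq> 0" "c b t 6 \<noteq> 0" "c q 6 7 \<noteq> 0" "c s t 7 \<noteq> 0"
    using C in7 unfolding contains_iff by (auto simp: C_arrows_def has_arrow_listed[OF A(1)])
  \<comment> \<open>This removes the third sum from the Jacobi identity of \<open>a\<close>,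
    \<open>q\<close>, \<open>b\<close>.\<close>
  have no_ab: "c b a m = 0" if "m \<in> rng 7" for m
  proof (rule ccontr)
    assume "c b a m \<noteq> 0"
    then have "increasing (b, a, m) \<in> increasing ` set ?B" using edge[of b a m] in7 neq that by simp
    then show False using par by (auto simp: C_params_def C_arrows_def increasing_def)
  qed
  have "X q b s - X a s 6 - X s t 7 = 0"
    using par bal[of "\<lambda>i. if i = s then 1 else 0"] by (auto simp: C_params_def C_arrows_def)
  moreover have "X a s 6 + X b t 6 - X q 6 7 = 0"
    using par bal[of "\<lambda>i. if i = 6 then 1 else 0"] by (auto simp: C_params_def C_arrows_def)
  moreover have "X q 6 7 + X s t 7 = 0"
    using par bal[of "\<lambda>i. if i = 7 then 1 else 0"] by (auto simp: C_params_def C_arrows_def)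
  moreover have \<sigma>': "\<sigma> b = a" "\<sigma> t = s" using \<sigma> \<sigma>_\<sigma> in7 by metis+
  have "X b t 6 = X a s 6" using X_\<sigma>[of a s 6] in7 \<sigma> by simp
  ultimately have eqs: "X q b s = - X a s 6" "X q 6 7 = 2 * X a s 6" "X s t 7 = - (2 * X a s 6)"
    by simp_all
  note gs = g_\<sigma>[OF in7(2)] g_\<sigma>[OF in7(4)]
  have nz: "g q \<noteq> 0" "g a \<noteq> 0" "g s \<noteq> 0" "g 6 \<noteq> 0" "g 7 \<noteq> 0" using g_nonzero in7 by auto
  have gb: "g b = g a" "g t = g s" using gs \<sigma> by simp_all
  have xqbs: "X q b s = c q b s * c q a t * g s / (g q * g a)"
    by (simp add: arrow_val_def \<sigma> \<sigma>' gb)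
  have xas: "X a s 6 = c a s 6 * c b t 6 * g 6 / (g a * g s)"
    by (simp add: arrow_val_def \<sigma> \<sigma>' gb)
  have xq6: "X q 6 7 = (c q 6 7)\<^sup>2 * g 7 / (g q * g 6)"
    by (simp add: arrow_val_def \<sigma> power2_eq_square)
  \<comment> \<open>The minus sign appears because \<open>\<sigma>\<close> exchanges the two sources
    of this arrow.\<close>
  have xst: "X s t 7 = - ((c s t 7)\<^sup>2 * g 7 / (g s)\<^sup>2)"
    using anti[of t s 7] in7 by (simp add: arrow_val_def \<sigma> \<sigma>' gb power2_eq_square)
  have "(c q 6 7)\<^sup>2 * g 7 / (g q * g 6) = (c s t 7)\<^sup>2 * g 7 / (g s)\<^sup>2"
    using eqs xq6 xst by simp
  then have "(c q 6 7)\<^sup>2 * (g s)\<^sup>2 = (c s t 7)\<^sup>2 * (g q * g 6)"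
    using nz by (simp add: field_simps)
  moreover have "(c q 6 7)\<^sup>2 * (g s)\<^sup>2 > 0" "(c s t 7)\<^sup>2 > 0" using arrows nz by simp_all
  ultimately have pos: "g q * g 6 > 0" by (simp add: zero_less_mult_iff)
  have "0 = (\<Sum>m\<in>rng 7. c a q m * c m b 6 + c q b m * c m a 6 + c b a m * c m q 6)"
    using jacobi[of a q b 6] in7 by simp
  also have "\<dots> = (\<Sum>m\<in>rng 7. c a q m * c m b 6) + (\<Sum>m\<in>rng 7. c q b m * c m a 6)"
    using no_ab by (simp add: sum.distrib)
  also have "(\<Sum>m\<in>rng 7. c a q m * c m b 6) = c a q t * c t b 6"
    by (rule sum_target) (use in7 arrows anti[of q a t] in auto)
  also have "(\<Sum>m\<in>rng 7. c q b m * c m a 6) = c q b s * c s a 6"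
    by (rule sum_target) (use in7 arrows in auto)
  finally have jac: "c q a t * c b t 6 = c q b s * c a s 6"
    using anti[of q a t] anti[of b t 6] anti[of a s 6] in7 by simp
  \<comment> \<open>The Jacobi relation pairs the four constants into a square, leaving the sign of
    \<open>g q * g 6\<close>.\<close>
  have "X q b s * X a s 6 = (c q b s * c a s 6) * (c q a t * c b t 6) * g 6 / (g q * (g a)\<^sup>2)"
    using nz unfolding xqbs xas by (simp add: field_simps power2_eq_square)
  also have "\<dots> = (c q b s * c a s 6)\<^sup>2 * (g q * g 6) / (g q * g a)\<^sup>2"
    using nz unfolding jac by (simp add: field_simps power2_eq_square)
  also have "\<dots> > 0" using pos arrows nz by simp
  finally have "X q b s * X a s 6 > 0" .
  then show False unfolding eqs by (simp add: zero_less_mult_iff not_less)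
qed

text \<open>Rescaling makes all constants of \<open>[e\<^sub>2, e\<^sub>3]\<close> and of the brackets into \<open>7\<close> equal to \<open>-1\<close>; the Jacobi
  identity then relates the remaining two constants.\<close>

lemma B_equivalent:
  assumes A: "lists_below 8 A" "length A = 6" and par: "(s, t, u) \<in> set B_params"
    and cont: "contains A (B_arrows s t u)"
  shows "\<exists>lam. lam \<noteq> 0 \<and> lam \<noteq> 1 \<and> nice_equivalent 7 c (Lsc lam)"
proof -
  let ?B = "B_arrows s t u"
  have r7: "k \<in> rng 7 \<longleftrightarrow> k \<ge> 1 \<and> k \<le> 7" for k :: nat by (simp add: atLeastAtMost_iff)
  have "s \<in> rng 7 \<and> t \<in> rng 7 \<and> u \<in> rng 7"
    using par unfolding B_params_def r7 by auto
  then have in7: "s \<in> rng 7" "t \<in> rng 7" "u \<in> rng 7" "1 \<in> rng 7" "2 \<in> rng 7" "3 \<in> rng 7" "7 \<in> rng 7"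
    by (simp_all add: r7)
  have dist: "distinct (map increasing ?B)"
    using par by (auto simp: B_params_def B_arrows_def increasing_def)
  have B: "set A = increasing ` set ?B"
    by (rule arrows_eq[OF A cont _ dist]) (simp add: B_arrows_def)
  have "map increasing ?B = ?B"
    using par by (auto simp: B_params_def B_arrows_def increasing_def)
  then have inc: "increasing ` set ?B = set ?B" by (metis set_map)
  note edge = edge_iff[OF A(1) B]
  have arrows: "c 1 2 s \<noteq> 0" "c 1 3 t \<noteq> 0" "c 2 3 u \<noteq> 0" "c 1 u 7 \<noteq> 0" "c 2 t 7 \<noteq> 0" "c 3 s 7 \<noteq> 0"
    using cont in7 unfolding contains_iff by (auto simp: B_arrows_def has_arrow_listed[OF A(1)])
  have "0 = (\<Sum>m\<in>rng 7. c 1 2 m * c m 3 7 + c 2 3 m * c m 1 7 + c 3 1 m * c m 2 7)"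
    using jacobi[of 1 2 3 7] in7 by simp
  also have "\<dots> = (\<Sum>m\<in>rng 7. c 1 2 m * c m 3 7) + (\<Sum>m\<in>rng 7. c 2 3 m * c m 1 7)
      + (\<Sum>m\<in>rng 7. c 3 1 m * c m 2 7)" by (simp add: sum.distrib)
  also have "(\<Sum>m\<in>rng 7. c 1 2 m * c m 3 7) = c 1 2 s * c s 3 7"
    by (rule sum_target) (use in7 arrows in auto)
  also have "(\<Sum>m\<in>rng 7. c 2 3 m * c m 1 7) = c 2 3 u * c u 1 7"
    by (rule sum_target) (use in7 arrows in auto)
  also have "(\<Sum>m\<in>rng 7. c 3 1 m * c m 2 7) = c 3 1 t * c t 2 7"
    by (rule sum_target) (use in7 arrows anti[of 1 3 t] in auto)
  finally have jac: "c 1 2 s * c 3 s 7 + c 2 3 u * c 1 u 7 = c 1 3 t * c 2 t 7"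
    using anti[of s 3 7] anti[of u 1 7] anti[of 3 1 t] anti[of t 2 7] in7 by simp
  \<comment> \<open>The brackets into \<open>7\<close> express the scales of \<open>s\<close>,
    \<open>t\<close>, \<open>u\<close> through the scale \<open>a7\<close> of node \<open>7\<close>;
    the bracket of \<open>e\<^sub>2\<close> and \<open>e\<^sub>3\<close> then fixes
    \<open>a7\<close>, and the bracket of \<open>e\<^sub>1\<close> and \<open>e\<^sub>3\<close>
    defines \<open>lam\<close>.\<close>
  define a7 where "a7 = 1 / (c 2 3 u * c 1 u 7)"
  define lam where "lam = c 1 3 t * c 2 t 7 * a7"
  define f where "f i = (if i = s then - c 3 s 7 * a7 else if i = t then - c 2 t 7 * a7
     else if i = u then - c 1 u 7 * a7 else if i = 7 then a7 else 1)" for i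
  define p where "p i = (if i = s then 4 else if i = t then 5 else if i = u then 6 else i)" for i :: nat
  have a7: "a7 \<noteq> 0" "c 2 3 u * c 1 u 7 * a7 = 1" using arrows by (simp_all add: a7_def)
  have lam1: "lam - 1 = c 1 2 s * c 3 s 7 * a7"
    using arg_cong[OF jac, of "\<lambda>x. x * a7"] a7(2) by (simp add: lam_def algebra_simps)
  have bij: "bij_betw p (rng 7) (rng 7)"
  proof (rule bij_betw_byWitness)
    let ?p' = "\<lambda>i. if i = 4 then s else if i = 5 then t else if i = 6 then u else i"
    show "\<forall>i\<in>rng 7. ?p' (p i) = i" "\<forall>i\<in>rng 7. p (?p' i) = i"
      using par by (auto simp: p_def B_params_def)
    show "p ` rng 7 \<subseteq> rng 7" "?p' ` rng 7 \<subseteq> rng 7"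
      using par by (auto simp: p_def B_params_def r7)
  qed
  have pv: "p 1 = 1" "p 2 = 2" "p 3 = 3" "p s = 4" "p t = 5" "p u = 6" "p 7 = 7"
    using par by (auto simp: p_def B_params_def)
  have fv: "f 1 = 1" "f 2 = 1" "f 3 = 1" "f s = - c 3 s 7 * a7" "f t = - c 2 t 7 * a7"
    "f u = - c 1 u 7 * a7" "f 7 = a7"
    using par by (auto simp: f_def B_params_def)
  have eqs: "c 1 2 s * f s = f 1 * f 2 * Lsc lam (p 1) (p 2) (p s)"
    "c 1 3 t * f t = f 1 * f 3 * Lsc lam (p 1) (p 3) (p t)"
    "c 2 3 u * f u = f 2 * f 3 * Lsc lam (p 2) (p 3) (p u)"
    "c 1 u 7 * f 7 = f 1 * f u * Lsc lam (p 1) (p u) (p 7)"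
    "c 2 t 7 * f 7 = f 2 * f t * Lsc lam (p 2) (p t) (p 7)"
    "c 3 s 7 * f 7 = f 3 * f s * Lsc lam (p 3) (p s) (p 7)"
    unfolding pv fv Lsc_values using lam1 a7(2) by (simp_all add: lam_def mult.assoc)
  have "nice_equivalent 7 c (Lsc lam)"
    unfolding nice_equivalent_def
  proof (intro exI conjI ballI)
    show "bij_betw p (rng 7) (rng 7)" by (rule bij)
    show "f i \<noteq> 0" if "i \<in> rng 7" for i using a7 arrows by (auto simp: f_def)
    fix i j k assume ijk: "i \<in> rng 7" "j \<in> rng 7" "k \<in> rng 7"
    have p_inj: "p x = p y \<longleftrightarrow> x = y" if "x \<in> rng 7" "y \<in> rng 7" for x y
      using bij that unfolding bij_betw_def inj_on_def by blast
    have main: "c i j k * f k = f i * f j * Lsc lam (p i) (p j) (p k)" if "(i, j, k) \<in> set ?B" for i j k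
      using that eqs unfolding B_arrows_def by auto
    have pre: "(i, j, k) \<in> set ?B" if "(p i, p j, p k) \<in> {(1,2,4),(1,3,5),(2,3,6),(1,6,7),(2,5,7),(3,4,7)}"
      "i \<in> rng 7" "j \<in> rng 7" "k \<in> rng 7" for i j k
    proof -
      have "x = 1" if "p x = 1" "x \<in> rng 7" for x using p_inj[OF that(2) in7(4)] pv that by simp
      moreover have "x = 2" if "p x = 2" "x \<in> rng 7" for x using p_inj[OF that(2) in7(5)] pv that by simp
      moreover have "x = 3" if "p x = 3" "x \<in> rng 7" for x using p_inj[OF that(2) in7(6)] pv that by simp
      moreover have "x = 7" if "p x = 7" "x \<in> rng 7" for x using p_inj[OF that(2) in7(7)] pv that by simp
      moreover have "x = s" if "p x = 4" "x \<in> rng 7" for x using p_inj[OF that(2) in7(1)] pv that by simp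
      moreover have "x = t" if "p x = 5" "x \<in> rng 7" for x using p_inj[OF that(2) in7(2)] pv that by simp
      moreover have "x = u" if "p x = 6" "x \<in> rng 7" for x using p_inj[OF that(2) in7(3)] pv that by simp
      ultimately have inv: "\<And>x. x \<in> rng 7 \<Longrightarrow> (p x = 1 \<longrightarrow> x = 1) \<and> (p x = 2 \<longrightarrow> x = 2) \<and> (p x = 3 \<longrightarrow> x = 3)
        \<and> (p x = 7 \<longrightarrow> x = 7) \<and> (p x = 4 \<longrightarrow> x = s) \<and> (p x = 5 \<longrightarrow> x = t) \<and> (p x = 6 \<longrightarrow> x = u)"
        by blast
      show ?thesis
        using that(1) inv[OF that(2)] inv[OF that(3)] inv[OF that(4)]
        unfolding B_arrows_def insert_iff empty_iff prod.inject list.set by argo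
    qed
    show "c i j k * f k = f i * f j * Lsc lam (p i) (p j) (p k)"
    proof (cases "(i, j, k) \<in> set ?B \<or> (j, i, k) \<in> set ?B")
      case True
      then show ?thesis
      proof
        assume "(j, i, k) \<in> set ?B"
        then have "c j i k * f k = f j * f i * Lsc lam (p j) (p i) (p k)" by (rule main)
        then show ?thesis unfolding anti[OF ijk] Lsc_anti[of lam "p i" "p j" "p k"] by simp
      qed (rule main)
    next
      case False
      have "c i j k = 0"
      proof (cases "i = j")
        case True
        then show ?thesis using anti[of i i k] ijk by simp
      next
        case neq: False
        then show ?thesis
          using edge[OF ijk neq] False unfolding inc by (cases "i \<le> j") (simp_all add: increasing_def min_def max_def)
      qed
      moreover have "Lsc lam (p i) (p j) (p k) = 0"
      proof (rule ccontr)
        assume "Lsc lam (p i) (p j) (p k) \<noteq> 0"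
        from Lsc_nonzero[OF this] show False
        proof
          assume "(p i, p j, p k) \<in> {(1,2,4),(1,3,5),(2,3,6),(1,6,7),(2,5,7),(3,4,7)}"
          from pre[OF this ijk] False show False by blast
        next
          assume "(p j, p i, p k) \<in> {(1,2,4),(1,3,5),(2,3,6),(1,6,7),(2,5,7),(3,4,7)}"
          from pre[OF this ijk(2,1,3)] False show False by blast
        qed
      qed
      ultimately show ?thesis by simp
    qed
  qed
  moreover have "lam \<noteq> 0" using arrows a7 by (simp add: lam_def)
  moreover have "lam \<noteq> 1" using lam1 arrows a7 by auto
  ultimately show ?thesis by blast
qed

lemma equivalent_to_family: "\<exists>lam. lam \<noteq> 0 \<and> lam \<noteq> 1 \<and> nice_equivalent 7 c (Lsc lam)"
proof -
  obtain A where "lists_below 8 A" "length A = 6"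
    "(\<exists>(s, t, u)\<in>set B_params. contains A (B_arrows s t u)) \<or>
     (\<exists>(q, a, b, s, t)\<in>set C_params. contains A (C_arrows q a b s t) \<and>
        \<sigma> q = q \<and> \<sigma> a = b \<and> \<sigma> s = t \<and> \<sigma> 6 = 6 \<and> \<sigma> 7 = 7)" by (rule classification)
  then show ?thesis using B_equivalent C_impossible by blast
qed

end

section \<open>Reduction to a topologically ordered basis\<close>

context notes atLeastAtMost_iff [simp del] One_nat_def [simp del] begin

lemma sorted_labelling:
  fixes key :: "nat \<Rightarrow> nat"
  obtains p where "bij_betw p (rng n) (rng n)" "\<And>i j. i \<in> rng n \<Longrightarrow> j \<in> rng n \<Longrightarrow> i \<le> j \<Longrightarrow> key (p i) \<le> key (p j)"
proof
  define xs where "xs = sort_key key [1..<Suc n]"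
  have len: "length xs = n" by (simp add: xs_def)
  have set: "set xs = rng n" by (auto simp: xs_def atLeastAtMost_iff)
  have dist: "distinct xs" by (simp add: xs_def distinct_sort)
  \<comment> \<open>Nodes are numbered from 1, list positions from 0.\<close>
  have "bij_betw (\<lambda>i. i - 1) (rng n) {..<n}"
    by (rule bij_betw_byWitness[where f' = Suc]) (auto simp: atLeastAtMost_iff)
  moreover have "bij_betw (nth xs) {..<n} (rng n)"
    using bij_betw_nth[OF dist, of "{..<n}" "rng n"] len set by simp
  ultimately have "bij_betw (nth xs \<circ> (\<lambda>i. i - 1)) (rng n) (rng n)" by (rule bij_betw_trans)
  then show "bij_betw (\<lambda>i. xs ! (i - 1)) (rng n) (rng n)" by (simp add: comp_def)
  have "sorted (map key xs)" by (simp add: xs_def)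
  then have mono: "key (xs ! i) \<le> key (xs ! j)" if "i \<le> j" "j < n" for i j
    using that len sorted_nth_mono[of "map key xs" i j] by simp
  show "key (xs ! (i - 1)) \<le> key (xs ! (j - 1))" if "i \<in> rng n" "j \<in> rng n" "i \<le> j" for i j
    using that by (intro mono) (auto simp: atLeastAtMost_iff)
qed

lemma nice_equivalent_relabel:
  assumes q: "bij_betw q (rng n) (rng n)"
    and c': "\<And>i j k. i \<in> rng n \<Longrightarrow> j \<in> rng n \<Longrightarrow> k \<in> rng n \<Longrightarrow> c' (q i) (q j) (q k) = c i j k"
    and "nice_equivalent n c' d"
  shows "nice_equivalent n c d"
proof -
  from assms(3) obtain \<pi> a where \<pi>: "bij_betw \<pi> (rng n) (rng n)" "\<forall>i\<in>rng n. a i \<noteq> 0"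
    "\<forall>i\<in>rng n. \<forall>j\<in>rng n. \<forall>k\<in>rng n. c' i j k * a k = a i * a j * d (\<pi> i) (\<pi> j) (\<pi> k)"
    unfolding nice_equivalent_def by blast
  have q_in: "q i \<in> rng n" if "i \<in> rng n" for i using q that by (rule bij_betwE[THEN bspec])
  show ?thesis
    unfolding nice_equivalent_def
  proof (intro exI conjI ballI)
    show "bij_betw (\<pi> \<circ> q) (rng n) (rng n)" using q \<pi>(1) by (rule bij_betw_trans)
    show "(a \<circ> q) i \<noteq> 0" if "i \<in> rng n" for i using \<pi>(2) q_in[OF that] by simp
    fix i j k assume ijk: "i \<in> rng n" "j \<in> rng n" "k \<in> rng n"
    have "c' (q i) (q j) (q k) * a (q k) = a (q i) * a (q j) * d (\<pi> (q i)) (\<pi> (q j)) (\<pi> (q k))"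
      using \<pi>(3) q_in ijk by blast
    then show "c i j k * (a \<circ> q) k = (a \<circ> q) i * (a \<circ> q) j * d ((\<pi> \<circ> q) i) ((\<pi> \<circ> q) j) ((\<pi> \<circ> q) k)"
      unfolding c'[OF ijk] by simp
  qed
qed

lemma ricci_flat_imp_family:
  assumes nn: "nice_nilpotent_lie 7 c" and nonab: "nonabelian_sc 7 c" and inv: "diagram_involution 7 c \<sigma>"
    and diag: "sigma_diagonal 7 \<sigma> g" and flat: "ricci_flat 7 c (sdmetric \<sigma> g)"
  shows "\<exists>lam. lam \<noteq> 0 \<and> lam \<noteq> 1 \<and> nice_equivalent 7 c (Lsc lam)"
proof -
  let ?R = "rng 7"
  have lie: "lie_sc 7 c" and nice: "nice_sc 7 c" and nil: "nilpotent_sc 7 c"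
    using nn unfolding nice_nilpotent_lie_def by blast+
  obtain h :: "nat \<Rightarrow> nat" where h: "\<And>i j k. \<lbrakk>i \<in> ?R; j \<in> ?R; k \<in> ?R; c i j k \<noteq> 0\<rbrakk> \<Longrightarrow> h j < h k"
  proof (rule nilpotent_height[OF nice nil])
    fix h' :: "nat \<Rightarrow> nat"
    assume "\<And>i j k. \<lbrakk>i \<in> ?R; j \<in> ?R; k \<in> ?R; c i j k \<noteq> 0\<rbrakk> \<Longrightarrow> h' j < h' k"
    then show thesis by (rule that)
  qed
  interpret diagonal_nice 7 c \<sigma> g h by (rule diagonal_niceI[OF nice lie h inv diag])
  \<comment> \<open>Sorting by this key puts the sources first, all with key 0, and keeps the key
    strictly increasing along arrows.\<close>
  define key where "key k = (if \<exists>i\<in>?R. \<exists>j\<in>?R. c i j k \<noteq> 0 then Suc (h k) else 0)" for k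
  obtain p where p: "bij_betw p ?R ?R" and mono: "\<And>i j. i \<in> ?R \<Longrightarrow> j \<in> ?R \<Longrightarrow> i \<le> j \<Longrightarrow> key (p i) \<le> key (p j)"
  proof (rule sorted_labelling[where key = key and n = 7])
    fix p' assume "bij_betw p' ?R ?R"
      "\<And>i j. i \<in> ?R \<Longrightarrow> j \<in> ?R \<Longrightarrow> i \<le> j \<Longrightarrow> key (p' i) \<le> key (p' j)"
    then show thesis by (rule that)
  qed
  define q where "q = inv_into ?R p"
  have q: "bij_betw q ?R ?R" unfolding q_def using p by (rule bij_betw_inv_into)
  have p_in: "p i \<in> ?R" if "i \<in> ?R" for i using p that by (rule bij_betwE[THEN bspec])
  have q_in: "q i \<in> ?R" if "i \<in> ?R" for i using q that by (rule bij_betwE[THEN bspec])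
  have pq: "p (q i) = i" if "i \<in> ?R" for i unfolding q_def using p that by (rule bij_betw_inv_into_right)
  have qp: "q (p i) = i" if "i \<in> ?R" for i unfolding q_def using p that by (rule bij_betw_inv_into_left)
  define c' where "c' i j k = c (p i) (p j) (p k)" for i j k
  define \<sigma>' where "\<sigma>' i = q (\<sigma> (p i))" for i
  define g' where "g' i = g (p i)" for i
  have \<sigma>'p: "p (\<sigma>' i) = \<sigma> (p i)" if "i \<in> ?R" for i
    unfolding \<sigma>'_def using pq \<sigma>_rng p_in that by blast
  have reidx: "(\<Sum>m\<in>?R. f (p m)) = (\<Sum>m\<in>?R. f m)" for f :: "nat \<Rightarrow> real"
    by (rule sum.reindex_bij_betw[OF p])
  have key_less: "key j < key k" if "i \<in> ?R" "j \<in> ?R" "k \<in> ?R" "c i j k \<noteq> 0" for i j k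
    using h[OF that] that unfolding key_def by auto
  have av: "arrow_val c' \<sigma>' g' i j k = X (p i) (p j) (p k)" if "i \<in> ?R" "j \<in> ?R" "k \<in> ?R" for i j k
    using that by (simp add: arrow_val_def c'_def g'_def \<sigma>'p)
  have "ordered_flat c' \<sigma>' g'"
  proof (unfold_locales, goal_cases)
    case (1 i j k)
    then show ?case unfolding c'_def using anti p_in by blast
  next
    case (2 i j k k')
    then have "p k = p k'" unfolding c'_def using target_unique[of "p i" "p j" "p k" "p k'"] p_in by blast
    then show ?case using qp 2 by metis
  next
    case (3 i j j' k)
    then have "p j = p j'" unfolding c'_def using source_unique[of "p i" "p j" "p j'" "p k"] p_in by blast
    then show ?case using qp 3 by metis
  next
    case (4 i j k)
    have "key (p j) < key (p k)" using key_less[of "p i" "p j" "p k"] 4 p_in unfolding c'_def by blast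
    then have "\<not> k \<le> j" using mono[of k j] 4 by (meson leD)
    then show ?case by simp
  next
    case (5 i)
    then show ?case unfolding \<sigma>'_def using q_in \<sigma>_rng p_in by blast
  next
    case (6 i)
    then show ?case using \<sigma>'p[of i] \<sigma>_\<sigma>[of "p i"] p_in qp unfolding \<sigma>'_def[of "\<sigma>' i"] by simp
  next
    case (7 i j k)
    then show ?case unfolding c'_def using \<sigma>'p \<sigma>_edge p_in by simp
  next
    case (8 i)
    then show ?case unfolding g'_def using g_nonzero p_in by blast
  next
    case (9 i)
    then show ?case unfolding g'_def using \<sigma>'p g_\<sigma> p_in by simp
  next
    case (10 i j k l)
    have "(\<Sum>m\<in>?R. c' i j m * c' m k l + c' j k m * c' m i l + c' k i m * c' m j l)
      = (\<Sum>m\<in>?R. c (p i) (p j) m * c m (p k) (p l) + c (p j) (p k) m * c m (p i) (p l) + c (p k) (p i) m * c m (p j) (p l))"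
      unfolding c'_def by (rule reidx)
    also have "\<dots> = 0" using lie p_in 10 unfolding lie_sc_def by blast
    finally show ?case .
  next
    case (11 b)
    have bal: "(\<Sum>i\<in>?R. \<Sum>j\<in>?R. X i j (p b)) = 2 * (\<Sum>j\<in>?R. \<Sum>k\<in>?R. X (p b) j k)"
      using flat p_in[OF 11] unfolding ricci_flat_iff by blast
    have "(\<Sum>i\<in>?R. \<Sum>j\<in>?R. arrow_val c' \<sigma>' g' i j b) = (\<Sum>i\<in>?R. \<Sum>j\<in>?R. X (p i) (p j) (p b))"
      using 11 av by simp
    also have "\<dots> = (\<Sum>i\<in>?R. \<Sum>j\<in>?R. X (p i) j (p b))" by (intro sum.cong refl reidx)
    also have "\<dots> = (\<Sum>i\<in>?R. \<Sum>j\<in>?R. X i j (p b))" by (rule reidx)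
    finally have 1: "(\<Sum>i\<in>?R. \<Sum>j\<in>?R. arrow_val c' \<sigma>' g' i j b) = (\<Sum>i\<in>?R. \<Sum>j\<in>?R. X i j (p b))" .
    have "(\<Sum>i\<in>?R. \<Sum>j\<in>?R. arrow_val c' \<sigma>' g' b i j) = (\<Sum>i\<in>?R. \<Sum>j\<in>?R. X (p b) (p i) (p j))"
      using 11 av by simp
    also have "\<dots> = (\<Sum>i\<in>?R. \<Sum>j\<in>?R. X (p b) (p i) j)" by (intro sum.cong refl reidx)
    also have "\<dots> = (\<Sum>i\<in>?R. \<Sum>j\<in>?R. X (p b) i j)" by (rule reidx)
    finally show ?case using 1 bal by simp
  next
    case (12 i j k l)
    have "key (p k) \<le> key (p l)" using mono 12 by simp
    moreover have "key (p k) > 0" using key_less[of "p i" "p j" "p k"] 12 p_in unfolding c'_def by fastforce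
    ultimately have "key (p l) \<noteq> 0" by simp
    then obtain i' j' where "i' \<in> ?R" "j' \<in> ?R" "c i' j' (p l) \<noteq> 0"
      unfolding key_def by (auto split: if_splits)
    then have "c' (q i') (q j') l \<noteq> 0" "q i' \<in> ?R" "q j' \<in> ?R" unfolding c'_def using pq q_in by auto
    then show ?case by blast
  next
    case 13
    obtain i where i: "i \<in> ?R" "\<sigma> i \<noteq> i" using inv unfolding diagram_involution_def by blast
    then have "\<sigma>' (q i) \<noteq> q i" using \<sigma>'p[of "q i"] pq q_in by metis
    then show ?case using q_in i by blast
  next
    case 14
    obtain i j k where "i \<in> ?R" "j \<in> ?R" "k \<in> ?R" "c i j k \<noteq> 0"
      using nonab unfolding nonabelian_sc_def by blast
    then have "c' (q i) (q j) (q k) \<noteq> 0" "q i \<in> ?R" "q j \<in> ?R" "q k \<in> ?R"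
      unfolding c'_def using pq q_in by auto
    then show ?case by blast
  qed
  then obtain lam where lam: "lam \<noteq> 0" "lam \<noteq> 1" "nice_equivalent 7 c' (Lsc lam)"
    using ordered_flat.equivalent_to_family by blast
  have "nice_equivalent 7 c (Lsc lam)"
    by (rule nice_equivalent_relabel[OF q _ lam(3)]) (simp add: c'_def pq)
  with lam show ?thesis by blast
qed

end

section \<open>The one-parameter family\<close>

context notes atLeastAtMost_iff [simp del] One_nat_def [simp del] begin

text \<open>The degree of a positive grading of the algebra; it serves for the Jacobi identity, for
  nilpotency and as height.\<close>

definition level :: "nat \<Rightarrow> nat" where
  "level x = (if x \<le> 3 then 1 else if x \<le> 6 then 2 else 3)"

definition edges :: "(nat \<times> nat \<times> nat) list" where
  "edges = [(1,2,4),(1,3,5),(2,3,6),(1,6,7),(2,5,7),(3,4,7)]"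

text \<open>Both orders of the sources are listed. The list does not depend on \<open>lam\<close>,
  so facts about the diagram become finite checks.\<close>

definition support :: "(nat \<times> nat \<times> nat) list" where
  "support = edges @ map (\<lambda>(i, j, k). (j, i, k)) edges"

lemma mem_support: "(x, y, z) \<in> set support \<longleftrightarrow> (x, y, z) \<in> set edges \<or> (y, x, z) \<in> set edges"
  by (force simp: support_def)

lemma support_of: "Lsc lam x y z \<noteq> 0 \<Longrightarrow> (x, y, z) \<in> set support"
  using Lsc_nonzero[of lam x y z] unfolding mem_support edges_def list.set .

lemma support_iff:
  assumes "lam \<noteq> 0" "lam \<noteq> 1"
  shows "Lsc lam x y z \<noteq> 0 \<longleftrightarrow> (x, y, z) \<in> set support"
proof
  have "list_all (\<lambda>(i, j, k). Lsc lam i j k \<noteq> 0) edges" using assms by (simp add: edges_def)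
  then have nz: "Lsc lam i j k \<noteq> 0" if "(i, j, k) \<in> set edges" for i j k
    using that by (auto simp: list_all_iff)
  assume "(x, y, z) \<in> set support"
  then show "Lsc lam x y z \<noteq> 0"
    unfolding mem_support
  proof
    assume "(y, x, z) \<in> set edges"
    then show ?thesis using nz[of y x z] Lsc_anti[of lam x y z] by simp
  qed (rule nz)
qed (rule support_of)

lemma support_level: "list_all (\<lambda>(x, y, z). level z = level x + level y) support"
  by (simp add: support_def edges_def level_def)

lemma Lsc_level: "Lsc lam x y z \<noteq> 0 \<Longrightarrow> level z = level x + level y"
  using support_of[of lam x y z] support_level by (auto simp: list_all_iff)

lemma level_pos: "level x \<ge> 1" and level_le: "level x \<le> 3"
  by (simp_all add: level_def)

lemma rng7: "rng 7 = {1, 2, 3, 4, 5, 6, 7}"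
  by (auto simp: atLeastAtMost_iff)

text \<open>A double bracket adds the three levels. The sum is at least 3 and no level exceeds 3, so
  the identity has content only for three nodes of level one and \<open>l = 7\<close>.\<close>

lemma lie_Lsc: "lie_sc 7 (Lsc lam)"
  unfolding lie_sc_def
proof (intro conjI ballI)
  fix i j k :: nat
  show "Lsc lam i j k = - Lsc lam j i k" by (rule Lsc_anti)
next
  fix i j k l assume ijkl: "i \<in> rng 7" "j \<in> rng 7" "k \<in> rng 7" "l \<in> rng 7"
  show "(\<Sum>m\<in>rng 7. Lsc lam i j m * Lsc lam m k l + Lsc lam j k m * Lsc lam m i l
     + Lsc lam k i m * Lsc lam m j l) = 0"
  proof (cases "level i + level j + level k = 3 \<and> level l = 3")
    case False
    have zero: "Lsc lam x y m * Lsc lam m z l = 0" if "level x + level y + level z = level i + level j + level k"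
      for x y z m
    proof (rule ccontr)
      assume "Lsc lam x y m * Lsc lam m z l \<noteq> 0"
      then have "level l = level x + level y + level z"
        using Lsc_level[of lam x y m] Lsc_level[of lam m z l] by auto
      then show False
        using that False level_pos[of i] level_pos[of j] level_pos[of k] level_le[of l] by linarith
    qed
    show ?thesis
      by (rule sum.neutral) (simp add: zero)
  next
    case True
    then have "level i = 1" "level j = 1" "level k = 1"
      using level_pos[of i] level_pos[of j] level_pos[of k] by linarith+
    then have "i \<in> {1,2,3}" "j \<in> {1,2,3}" "k \<in> {1,2,3}"
      using ijkl by (auto simp: level_def rng7 split: if_splits)
    moreover have "l = 7" using True ijkl by (auto simp: level_def rng7 split: if_splits)
    ultimately show ?thesis
      unfolding rng7 insert_iff empty_iff
      by (elim disjE FalseE) (simp_all add: Lsc_def sc_of_de_def omL_def)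
  qed
qed

lemma support_target: "list_all (\<lambda>(x, y, z). list_all (\<lambda>(x', y', z'). x = x' \<and> y = y' \<longrightarrow> z = z') support) support"
  by (simp add: support_def edges_def)

lemma support_source: "list_all (\<lambda>(x, y, z). list_all (\<lambda>(x', y', z'). x = x' \<and> z = z' \<longrightarrow> y = y') support) support"
  by (simp add: support_def edges_def)

lemma nice_Lsc: "nice_sc 7 (Lsc lam)"
proof -
  have t: "z = z'" if "Lsc lam x y z \<noteq> 0" "Lsc lam x y z' \<noteq> 0" for x y z z'
    using support_of[OF that(1)] support_of[OF that(2)] support_target by (fastforce simp: list_all_iff)
  have s: "y = y'" if "Lsc lam x y z \<noteq> 0" "Lsc lam x y' z \<noteq> 0" for x y y' z
    using support_of[OF that(1)] support_of[OF that(2)] support_source by (fastforce simp: list_all_iff)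
  have one: "1 \<in> rng 7" by (simp add: rng7)
  show ?thesis
    unfolding nice_sc_def
  proof (intro conjI ballI)
    fix i j
    show "\<exists>h\<in>rng 7. \<forall>k\<in>rng 7. k \<noteq> h \<longrightarrow> Lsc lam i j k = 0"
    proof (cases "\<exists>h\<in>rng 7. Lsc lam i j h \<noteq> 0")
      case True
      then show ?thesis using t by blast
    qed (use one in blast)
    show "\<exists>h\<in>rng 7. \<forall>k\<in>rng 7. k \<noteq> h \<longrightarrow> Lsc lam i k j = 0"
    proof (cases "\<exists>h\<in>rng 7. Lsc lam i h j \<noteq> 0")
      case True
      then show ?thesis using s by blast
    qed (use one in blast)
  qed
qed

text \<open>Bracketing raises the level by at least one, so three brackets annihilate
  everything.\<close>

lemma br_level:
  assumes "\<And>k. k \<in> rng 7 \<Longrightarrow> level k \<le> t \<Longrightarrow> w k = 0" "k \<in> rng 7" "level k \<le> Suc t"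
  shows "br 7 (Lsc lam) v w k = 0"
proof -
  have "v i * w j * Lsc lam i j k = 0" if "j \<in> rng 7" for i j
  proof (cases "Lsc lam i j k = 0")
    case False
    then have "level j \<le> t" using Lsc_level[OF False] assms(3) level_pos[of i] by linarith
    then show ?thesis using assms(1)[OF that] by simp
  qed simp
  then have "(\<Sum>i\<in>rng 7. \<Sum>j\<in>rng 7. v i * w j * Lsc lam i j k) = 0"
    by (intro sum.neutral ballI)
  then show ?thesis by (simp add: br_def)
qed

lemma nilpotent_Lsc: "nilpotent_sc 7 (Lsc lam)"
proof -
  have "k \<in> rng 7 \<longrightarrow> level k \<le> length xs \<longrightarrow> foldr (br 7 (Lsc lam)) xs x k = 0" for xs x k
  proof (induction xs arbitrary: k)
    case Nil
    then show ?case using level_pos[of k] by simp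
  next
    case (Cons v xs)
    then show ?case using br_level[of "length xs" "foldr (br 7 (Lsc lam)) xs x" k lam v] by simp
  qed
  then show ?thesis unfolding nilpotent_sc_def using level_le by (intro exI[of _ 3]) metis
qed

lemma nice_nilpotent_Lsc: "nice_nilpotent_lie 7 (Lsc lam)"
  unfolding nice_nilpotent_lie_def using lie_Lsc nice_Lsc nilpotent_Lsc by blast

lemma nonabelian_Lsc: "nonabelian_sc 7 (Lsc lam)"
  unfolding nonabelian_sc_def
  by (intro bexI[of _ 2] bexI[of _ 3] bexI[of _ 6]) (simp_all add: rng7)

section \<open>Diagram involutions of the family\<close>

lemma diagonal_nice_Lsc:
  assumes "diagram_involution 7 (Lsc lam) \<sigma>" "sigma_diagonal 7 \<sigma> g"
  shows "diagonal_nice 7 (Lsc lam) \<sigma> g level"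
proof (rule diagonal_niceI[OF nice_Lsc lie_Lsc _ assms])
  fix i j k assume "Lsc lam i j k \<noteq> 0"
  then show "level j < level k" using Lsc_level level_pos[of i] by fastforce
qed

text \<open>A node \<open>m\<close> of level two only feeds \<open>7\<close>, together with \<open>7 - m\<close>. Hence a diagram involution is
  determined by its action on \<open>{4, 5, 6}\<close>.\<close>

lemma support_chain: "list_all (\<lambda>(a, b, m). list_all (\<lambda>(d, m', l). m' = m \<longrightarrow>
    (m = 4 \<or> m = 5 \<or> m = 6) \<and> l = 7 \<and> d + m = 7) support) support"
  by (simp add: support_def edges_def)

lemma diagram_involution_Lsc:
  assumes "lam \<noteq> 0" "lam \<noteq> 1" and inv: "diagram_involution 7 (Lsc lam) \<sigma>"
  shows "(\<forall>i\<in>{1..7}. \<sigma> i = (swp 2 3 \<circ> swp 4 5) i) \<or> (\<forall>i\<in>{1..7}. \<sigma> i = (swp 1 2 \<circ> swp 5 6) i) \<or>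
    (\<forall>i\<in>{1..7}. \<sigma> i = (swp 1 3 \<circ> swp 4 6) i)"
proof -
  have in7: "\<sigma> i \<in> rng 7" "\<sigma> (\<sigma> i) = i" if "i \<in> rng 7" for i
    using inv that unfolding diagram_involution_def by blast+
  have edge: "(\<sigma> i, \<sigma> j, \<sigma> k) \<in> set support" if "(i, j, k) \<in> set support" "i \<in> rng 7" "j \<in> rng 7" "k \<in> rng 7" for i j k
  proof -
    have "Lsc lam i j k \<noteq> 0" using that(1) support_iff[OF assms(1,2)] by blast
    moreover have "diag_edge 7 (Lsc lam) i j k \<longleftrightarrow> diag_edge 7 (Lsc lam) (\<sigma> i) (\<sigma> j) (\<sigma> k)"
      using inv that(2-4) unfolding diagram_involution_def by blast
    ultimately have "Lsc lam (\<sigma> i) (\<sigma> j) (\<sigma> k) \<noteq> 0"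
      using diag_edge_iff[OF nice_Lsc that(2-4)]
        diag_edge_iff[OF nice_Lsc in7(1)[OF that(2)] in7(1)[OF that(3)] in7(1)[OF that(4)]] by simp
    then show ?thesis by (rule support_of)
  qed
  have chain: "(m = 4 \<or> m = 5 \<or> m = 6) \<and> l = 7 \<and> d + m = 7"
    if "(a, b, m) \<in> set support" "(d, m, l) \<in> set support" for a b m d l
    using support_chain that by (fastforce simp: list_all_iff)
  \<comment> \<open>The image of the path \<open>{1, 2} \<rightarrow> 4\<close>,
    \<open>{3, 4} \<rightarrow> 7\<close> is again a two-step path, so \<open>\<sigma> 4\<close> is
    a middle node and \<open>\<sigma> 3\<close> is its partner.\<close>
  have c4: "(\<sigma> 4 = 4 \<or> \<sigma> 4 = 5 \<or> \<sigma> 4 = 6) \<and> \<sigma> 7 = 7 \<and> \<sigma> 3 + \<sigma> 4 = 7"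
    by (rule chain[OF edge[of 1 2 4] edge[of 3 4 7]]) (simp_all add: support_def edges_def rng7)
  have c5: "(\<sigma> 5 = 4 \<or> \<sigma> 5 = 5 \<or> \<sigma> 5 = 6) \<and> \<sigma> 7 = 7 \<and> \<sigma> 2 + \<sigma> 5 = 7"
    by (rule chain[OF edge[of 1 3 5] edge[of 2 5 7]]) (simp_all add: support_def edges_def rng7)
  have c6: "(\<sigma> 6 = 4 \<or> \<sigma> 6 = 5 \<or> \<sigma> 6 = 6) \<and> \<sigma> 7 = 7 \<and> \<sigma> 1 + \<sigma> 6 = 7"
    by (rule chain[OF edge[of 2 3 6] edge[of 1 6 7]]) (simp_all add: support_def edges_def rng7)
  have ss: "\<sigma> (\<sigma> 4) = 4" "\<sigma> (\<sigma> 5) = 5" "\<sigma> (\<sigma> 6) = 6" using in7(2) by (simp_all add: rng7)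
  \<comment> \<open>Two fixed middle nodes fix the third, and then their partners \<open>1\<close>,
    \<open>2\<close>, \<open>3\<close> as well.\<close>
  have "\<not> (\<sigma> 4 = 4 \<and> \<sigma> 5 = 5)"
  proof
    assume *: "\<sigma> 4 = 4 \<and> \<sigma> 5 = 5"
    then have "\<sigma> 6 = 6" using c6 ss by metis
    then have "\<forall>i\<in>rng 7. \<sigma> i = i" unfolding rng7 using * c4 c5 c6 by auto
    then show False using inv unfolding diagram_involution_def by blast
  qed
  then have "\<sigma> 4 = 5 \<and> \<sigma> 5 = 4 \<and> \<sigma> 6 = 6 \<or> \<sigma> 5 = 6 \<and> \<sigma> 6 = 5 \<and> \<sigma> 4 = 4 \<or> \<sigma> 4 = 6 \<and> \<sigma> 6 = 4 \<and> \<sigma> 5 = 5"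
    using c4[THEN conjunct1] c5[THEN conjunct1] c6[THEN conjunct1] ss by (elim disjE) simp_all
  then consider "\<sigma> 4 = 5" "\<sigma> 5 = 4" "\<sigma> 6 = 6" | "\<sigma> 5 = 6" "\<sigma> 6 = 5" "\<sigma> 4 = 4" | "\<sigma> 4 = 6" "\<sigma> 6 = 4" "\<sigma> 5 = 5"
    by blast
  then show ?thesis
  proof cases
    case 1
    then have "\<sigma> 1 = 1" "\<sigma> 2 = 3" "\<sigma> 3 = 2" using c4 c5 c6 by auto
    then show ?thesis using 1 c4 unfolding rng7 by (simp add: swp_def)
  next
    case 2
    then have "\<sigma> 1 = 2" "\<sigma> 2 = 1" "\<sigma> 3 = 3" using c4 c5 c6 by auto
    then show ?thesis using 2 c4 unfolding rng7 by (simp add: swp_def)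
  next
    case 3
    then have "\<sigma> 1 = 3" "\<sigma> 2 = 2" "\<sigma> 3 = 1" using c4 c5 c6 by auto
    then show ?thesis using 3 c4 unfolding rng7 by (simp add: swp_def)
  qed
qed

text \<open>Since \<open>\<sigma>\<close> is its own inverse, sending arrows to arrows yields the
  equivalence.\<close>

lemma diagram_involution_LscI:
  assumes lam: "lam \<noteq> 0" "lam \<noteq> 1"
    and \<sigma>: "\<And>i. i \<in> rng 7 \<Longrightarrow> \<sigma> i \<in> rng 7" "\<And>i. i \<in> rng 7 \<Longrightarrow> \<sigma> (\<sigma> i) = i" "\<exists>i\<in>rng 7. \<sigma> i \<noteq> i"
    and sup: "list_all (\<lambda>(i, j, k). (\<sigma> i, \<sigma> j, \<sigma> k) \<in> set support) support"
  shows "diagram_involution 7 (Lsc lam) \<sigma>"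
proof -
  have edge: "Lsc lam (\<sigma> i) (\<sigma> j) (\<sigma> k) \<noteq> 0" if "Lsc lam i j k \<noteq> 0" for i j k
    using sup support_of[OF that] unfolding support_iff[OF lam] list_all_iff by fast
  have "Lsc lam i j k \<noteq> 0 \<longleftrightarrow> Lsc lam (\<sigma> i) (\<sigma> j) (\<sigma> k) \<noteq> 0"
    if "i \<in> rng 7" "j \<in> rng 7" "k \<in> rng 7" for i j k
    using edge[of i j k] edge[of "\<sigma> i" "\<sigma> j" "\<sigma> k"] \<sigma>(2) that by auto
  then have "diag_edge 7 (Lsc lam) i j k \<longleftrightarrow> diag_edge 7 (Lsc lam) (\<sigma> i) (\<sigma> j) (\<sigma> k)"
    if "i \<in> rng 7" "j \<in> rng 7" "k \<in> rng 7" for i j k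
    using diag_edge_iff[OF nice_Lsc that] diag_edge_iff[OF nice_Lsc \<sigma>(1)[OF that(1)] \<sigma>(1)[OF that(2)] \<sigma>(1)[OF that(3)]] that
    by blast
  then show ?thesis
    unfolding diagram_involution_def using \<sigma> by (auto simp only: image_subset_iff)
qed

end

section \<open>Signature of a \<open>\<sigma>\<close>-diagonal metric\<close>

lemma order_linear: "order x [:- a, 1:] = (if x = (a :: real) then 1 else 0)"
  using order_power_n_n[of a 1] by (auto intro: order_0I)

lemma prod_linear_nonzero: "(\<Prod>a\<leftarrow>as. [:- a, 1:]) \<noteq> (0 :: real poly)"
  by (induction as) (simp_all del: mult_pCons_left)

lemma order_prod_linear:
  "order x (\<Prod>a\<leftarrow>as. [:- a, 1:]) = count_list as (x :: real)"
proof (induction as)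
  case (Cons a as)
  have "[:- a, 1:] * (\<Prod>b\<leftarrow>as. [:- b, 1:]) \<noteq> 0"
    using prod_linear_nonzero[of as] by (simp del: mult_pCons_left)
  then show ?case using Cons by (simp add: order_mult order_linear del: mult_pCons_left)
qed simp

lemma poly_prod_linear: "poly (\<Prod>a\<leftarrow>as. [:- a, 1:]) x = 0 \<longleftrightarrow> (x :: real) \<in> set as"
  by (induction as) auto

lemma count_list_filter: "count_list (filter P xs) x = (if P x then count_list xs x else 0)"
  by (induction xs) auto

lemma sum_order_prod_linear:
  fixes as :: "real list"
  shows "(\<Sum>x\<in>{x. poly (\<Prod>a\<leftarrow>as. [:- a, 1:]) x = 0 \<and> P x}. order x (\<Prod>a\<leftarrow>as. [:- a, 1:]))
    = length (filter P as)"
proof -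
  have "{x. poly (\<Prod>a\<leftarrow>as. [:- a, 1:]) x = 0 \<and> P x} = set (filter P as)"
    by (auto simp: poly_prod_linear)
  then have "(\<Sum>x\<in>{x. poly (\<Prod>a\<leftarrow>as. [:- a, 1:]) x = 0 \<and> P x}. order x (\<Prod>a\<leftarrow>as. [:- a, 1:]))
      = (\<Sum>x\<in>set (filter P as). count_list (filter P as) x)"
    by (intro sum.cong) (simp_all add: order_prod_linear count_list_filter)
  then show ?thesis using sum_count_set[of "filter P as" "set (filter P as)"] by simp
qed

context diagonal_nice begin

lemma gram_mat_mult: "gram_mat n f * gram_mat n f' = gram_mat n (\<lambda>i j. \<Sum>k\<in>rng n. f i k * f' k j)"
proof (rule eq_matI)
  fix i j assume "i < dim_row (gram_mat n (\<lambda>i j. \<Sum>k\<in>rng n. f i k * f' k j))"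
    "j < dim_col (gram_mat n (\<lambda>i j. \<Sum>k\<in>rng n. f i k * f' k j))"
  then have ij: "i < n" "j < n" by (auto simp: gram_mat_def)
  have "(gram_mat n f * gram_mat n f') $$ (i, j) = (\<Sum>k\<in>{0..<n}. f (i + 1) (k + 1) * f' (k + 1) (j + 1))"
    using ij by (simp add: gram_mat_def scalar_prod_def)
  also have "\<dots> = (\<Sum>k\<in>rng n. f (i + 1) k * f' k (j + 1))"
    by (rule sum.reindex_bij_witness[of _ "\<lambda>k. k - 1" "\<lambda>k. k + 1"]) (auto simp: atLeastAtMost_iff)
  finally show "(gram_mat n f * gram_mat n f') $$ (i, j) =
      gram_mat n (\<lambda>i j. \<Sum>k\<in>rng n. f i k * f' k j) $$ (i, j)" using ij by (simp add: gram_mat_def)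
qed (simp_all add: gram_mat_def)

lemma gram_mat_cong:
  "(\<And>i j. i \<in> rng n \<Longrightarrow> j \<in> rng n \<Longrightarrow> f i j = f' i j) \<Longrightarrow> gram_mat n f = gram_mat n f'"
  by (rule eq_matI) (auto simp: gram_mat_def atLeastAtMost_iff)

text \<open>On the plane of an exchanged pair the Gram matrix is \<open>g i\<close> times a
  transposition matrix, with eigenvalues \<open>g i\<close> and \<open>- g i\<close>; the smaller
  index receives \<open>g i\<close>.\<close>

definition eigval :: "nat \<Rightarrow> real" where
  "eigval i = (if i \<le> \<sigma> i then g i else - g i)"

text \<open>Column \<open>i\<close> of \<open>eigvec\<close> is \<open>e\<^sub>i\<close> if \<open>\<sigma> i = i\<close>; a transposed pair contributes the sum and
  the difference of its two basis vectors.\<close>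

definition eigvec :: "nat \<Rightarrow> nat \<Rightarrow> real" where
  "eigvec i j = (if j = i then (if i \<le> \<sigma> i then 1 else - 1) else if j = \<sigma> i then 1 else 0)"

lemma sum_eigvec:
  assumes i: "i \<in> rng n"
  shows "(\<Sum>k\<in>rng n. eigvec i k * F k) = eigvec i i * F i + (if \<sigma> i = i then 0 else F (\<sigma> i))"
proof -
  have "(\<Sum>k\<in>rng n. eigvec i k * F k) = (\<Sum>k\<in>{i, \<sigma> i}. eigvec i k * F k)"
    by (rule sum.mono_neutral_right) (use i \<sigma>_rng in \<open>auto simp: eigvec_def\<close>)
  then show ?thesis by (auto simp: eigvec_def)
qed

lemma signature_sdmetric:
  "signature n (sdmetric \<sigma> g) = (card {i\<in>rng n. eigval i > 0}, card {i\<in>rng n. eigval i < 0})"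
proof -
  let ?A = "gram_mat n (sdmetric \<sigma> g)" and ?P = "gram_mat n eigvec"
  \<comment> \<open>The inverse of \<open>?P\<close>, whose 2 by 2 blocks are symmetric with square
    twice the identity.\<close>
  let ?Q = "gram_mat n (\<lambda>i j. eigvec i j / (if \<sigma> i = i then 1 else 2))"
  let ?D = "gram_mat n (\<lambda>i j. if i = j then eigval i else 0)"
  have carr: "gram_mat n f \<in> carrier_mat n n" for f by (simp add: gram_mat_def)
  have one: "1\<^sub>m n = gram_mat n (\<lambda>i j. if i = j then 1 else 0)"
    by (rule eq_matI) (auto simp: gram_mat_def)
  have PQ: "?P * ?Q = 1\<^sub>m n"
    unfolding gram_mat_mult one
  proof (rule gram_mat_cong)
    fix i j assume ij: "i \<in> rng n" "j \<in> rng n"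
    show "(\<Sum>k\<in>rng n. eigvec i k * (eigvec k j / (if \<sigma> k = k then 1 else 2))) = (if i = j then 1 else 0)"
      unfolding sum_eigvec[OF ij(1)] using \<sigma>_\<sigma>[OF ij(1)] by (auto simp: eigvec_def)
  qed
  have AP: "?A * ?P = ?P * ?D"
    unfolding gram_mat_mult
  proof (rule gram_mat_cong)
    fix i j assume ij: "i \<in> rng n" "j \<in> rng n"
    have "(\<Sum>k\<in>rng n. sdmetric \<sigma> g i k * eigvec k j) = (\<Sum>k\<in>rng n. if k = \<sigma> i then g i * eigvec k j else 0)"
      by (rule sum.cong) (auto simp: sdmetric_def)
    also have "\<dots> = g i * eigvec (\<sigma> i) j" using \<sigma>_rng[OF ij(1)] by simp
    also have "\<dots> = eigvec i j * eigval j"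
    proof -
      consider "j = i" "\<sigma> i = i" | "j = i" "\<sigma> i < i" | "j = i" "i < \<sigma> i"
        | "j \<noteq> i" "j = \<sigma> i" "\<sigma> i < i" | "j \<noteq> i" "j = \<sigma> i" "i < \<sigma> i" | "j \<noteq> i" "j \<noteq> \<sigma> i"
        by (metis nat_neq_iff)
      then show ?thesis
        by cases (use \<sigma>_\<sigma>[OF ij(1)] g_\<sigma>[OF ij(1)] in \<open>simp_all add: eigvec_def eigval_def\<close>)
    qed
    also have "\<dots> = (\<Sum>k\<in>rng n. if k = j then eigvec i j * eigval j else 0)" using ij by simp
    also have "\<dots> = (\<Sum>k\<in>rng n. eigvec i k * (if k = j then eigval k else 0))"
      by (rule sum.cong) auto
    finally show "(\<Sum>k\<in>rng n. sdmetric \<sigma> g i k * eigvec k j) =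
      (\<Sum>k\<in>rng n. eigvec i k * (if k = j then eigval k else 0))" .
  qed
  have "?A = ?A * (?P * ?Q)" unfolding PQ using carr by (simp add: right_mult_one_mat[OF carr])
  also have "\<dots> = (?A * ?P) * ?Q" by (rule assoc_mult_mat[OF carr carr carr, symmetric])
  also have "\<dots> = ?P * ?D * ?Q" by (simp only: AP)
  finally have A: "?A = ?P * ?D * ?Q" .
  have "similar_mat ?A ?D"
  proof (rule similar_matI)
    show "{?A, ?D, ?P, ?Q} \<subseteq> carrier_mat n n" using carr by blast
  qed (rule PQ mat_mult_left_right_inverse[OF carr carr PQ] A)+
  then have "char_poly ?A = char_poly ?D" by (rule char_poly_similar)
  also have "\<dots> = (\<Prod>a\<leftarrow>diag_mat ?D. [:- a, 1:])"
    by (rule char_poly_upper_triangular[of _ n]) (auto simp: gram_mat_def)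
  also have "diag_mat ?D = map eigval [1..<Suc n]"
    by (rule nth_equalityI) (auto simp: diag_mat_def gram_mat_def add.commute simp del: upt_Suc)
  finally have cp: "char_poly ?A = (\<Prod>a\<leftarrow>map eigval [1..<Suc n]. [:- a, 1:])" .
  have len: "length (filter P (map eigval [1..<Suc n])) = card {i\<in>rng n. P (eigval i)}" for P
  proof -
    have "length (filter P (map eigval [1..<Suc n])) = length (filter (P \<circ> eigval) [1..<Suc n])"
      by (simp add: filter_map del: upt_Suc)
    also have "\<dots> = card ({i. (P \<circ> eigval) i} \<inter> set [1..<Suc n])"
      by (rule distinct_length_filter) simp
    also have "{i. (P \<circ> eigval) i} \<inter> set [1..<Suc n] = {i\<in>rng n. P (eigval i)}"
      by (auto simp: atLeastAtMost_iff)
    finally show ?thesis .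
  qed
  show ?thesis
    unfolding signature_def cp sum_order_prod_linear[of _ "\<lambda>x. x > 0"] sum_order_prod_linear[of _ "\<lambda>x. x < 0"]
    by (simp only: len)
qed

end

section \<open>Ricci-flat metrics on the family\<close>

text \<open>Here \<open>x, y, Y, z, w\<close> are the metric coefficients at the fixed source, the exchanged sources, the
  exchanged nodes of level two, the fixed node of level two, and the node \<open>7\<close>; \<open>\<kappa>\<close> and \<open>- M\<close> are the
  products of structure constants over the two kinds of \<open>\<sigma>\<close>-orbits of arrows into level two.\<close>

definition flat_system :: "real \<Rightarrow> real \<Rightarrow> real \<Rightarrow> real \<Rightarrow> real \<Rightarrow> real \<Rightarrow> real \<Rightarrow> bool" where
  "flat_system \<kappa> M x y Y z w \<longleftrightarrow>
     \<kappa> * Y\<^sup>2 = x * w \<and> - (M * x * z\<^sup>2) = w * y\<^sup>2 \<and> y * Y = - (2 * x * z)"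

text \<open>The three ratio equations are balance at the exchanged nodes of level two, at the fixed
  one, and at node \<open>7\<close>.\<close>

lemma flat_system_ratios:
  assumes "x \<noteq> 0" "y \<noteq> 0" "Y \<noteq> 0" "z \<noteq> 0" "w \<noteq> 0"
  shows "\<kappa> * Y / (x * y) = w / (y * Y) \<and> - (M * z / (y * y)) = w / (x * z) \<and>
      w / (x * z) + w / (y * Y) + w / (y * Y) = 0 \<longleftrightarrow> flat_system \<kappa> M x y Y z w"
proof -
  have "\<kappa> * Y / (x * y) = w / (y * Y) \<longleftrightarrow> \<kappa> * Y\<^sup>2 = x * w"
    using assms by (simp add: field_simps power2_eq_square)
  moreover have "- (M * z / (y * y)) = w / (x * z) \<longleftrightarrow> - (M * x * z\<^sup>2) = w * y\<^sup>2"
    using assms by (simp add: field_simps power2_eq_square)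
  moreover have "w / (x * z) + w / (y * Y) + w / (y * Y) = w * (y * Y + 2 * x * z) / (x * z * y * Y)"
    using assms by (simp add: field_simps)
  then have "w / (x * z) + w / (y * Y) + w / (y * Y) = 0 \<longleftrightarrow> y * Y = - (2 * x * z)"
    using assms by (simp add: eq_neg_iff_add_eq_0)
  ultimately show ?thesis unfolding flat_system_def by simp
qed

text \<open>Squaring the third equation and substituting the other two eliminates all metric
  coefficients, which leaves a condition on the structure constants alone.\<close>

lemma flat_system_coeffs:
  assumes "flat_system \<kappa> M x y Y z w" "x \<noteq> 0" "y \<noteq> 0" "Y \<noteq> 0" "z \<noteq> 0"
  shows "M = - 4 * \<kappa>"
proof -
  have 1: "\<kappa> * Y\<^sup>2 = x * w" and 2: "- (M * x * z\<^sup>2) = w * y\<^sup>2" and 3: "y * Y = - (2 * x * z)"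
    using assms(1) unfolding flat_system_def by blast+
  have sq: "y\<^sup>2 * Y\<^sup>2 = 4 * x\<^sup>2 * z\<^sup>2"
    using arg_cong[OF 3, of "\<lambda>t. t\<^sup>2"] by (simp add: power_mult_distrib)
  have "(- M * Y\<^sup>2) * (x * z\<^sup>2) = - (M * x * z\<^sup>2) * Y\<^sup>2" by (simp add: algebra_simps)
  also have "\<dots> = w * (y\<^sup>2 * Y\<^sup>2)" unfolding 2 by (simp add: algebra_simps)
  also have "\<dots> = 4 * (x * w) * (x * z\<^sup>2)" unfolding sq by (simp add: power2_eq_square algebra_simps)
  also have "\<dots> = (4 * \<kappa> * Y\<^sup>2) * (x * z\<^sup>2)" unfolding 1[symmetric] by (simp add: algebra_simps)
  finally have "(- M * Y\<^sup>2) * (x * z\<^sup>2) = (4 * \<kappa> * Y\<^sup>2) * (x * z\<^sup>2)" .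
  moreover have "x * z\<^sup>2 \<noteq> 0" "Y\<^sup>2 \<noteq> 0" using assms by simp_all
  ultimately have "- M = 4 * \<kappa>" unfolding mult_right_cancel[OF \<open>x * z\<^sup>2 \<noteq> 0\<close>] mult_right_cancel[OF \<open>Y\<^sup>2 \<noteq> 0\<close>] by blast
  then show ?thesis by simp
qed

lemma flat_system_solution:
  assumes "x \<noteq> 0" "y \<noteq> 0" "Y \<noteq> 0"
  shows "flat_system \<kappa> (- 4 * \<kappa>) x y Y z w \<longleftrightarrow> w = \<kappa> * Y\<^sup>2 / x \<and> z = - (y * Y) / (2 * x)"
proof
  assume "flat_system \<kappa> (- 4 * \<kappa>) x y Y z w"
  then show "w = \<kappa> * Y\<^sup>2 / x \<and> z = - (y * Y) / (2 * x)"
    using assms by (auto simp: flat_system_def field_simps)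
next
  assume "w = \<kappa> * Y\<^sup>2 / x \<and> z = - (y * Y) / (2 * x)"
  then have w: "w = \<kappa> * Y\<^sup>2 / x" and z: "z = - (y * Y) / (2 * x)" by blast+
  show "flat_system \<kappa> (- 4 * \<kappa>) x y Y z w"
    unfolding flat_system_def w z using assms by (simp add: field_simps power2_eq_square)
qed

section \<open>Balance on the family for each of the three involutions\<close>

context notes atLeastAtMost_iff [simp del] One_nat_def [simp del] begin

lemma Lsc_values' [simp]: "Lsc lam 2 1 4 = lam - 1" "Lsc lam 3 1 5 = lam" "Lsc lam 3 2 6 = 1"
  using Lsc_anti[of lam 2 1 4] Lsc_anti[of lam 3 1 5] Lsc_anti[of lam 3 2 6] by simp_all

text \<open>The variables are the values on the six arrows. Substituting the balances of the middle
  nodes turns each balance at a source into the balance at node \<open>7\<close>.\<close>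

lemma node_equations:
  fixes a b c d e f :: real
  shows "0 = 2 * (a + b + d) \<and> 0 = 2 * (a + c + e) \<and> 0 = 2 * (b + c + f) \<and> 2 * a = 2 * f \<and>
      2 * b = 2 * e \<and> 2 * c = 2 * d \<and> 2 * (d + e + f) = 2 * 0 \<longleftrightarrow>
    a = f \<and> b = e \<and> c = d \<and> d + e + f = 0"
proof (rule iffI)
  assume "a = f \<and> b = e \<and> c = d \<and> d + e + f = 0"
  then have "a = f" "b = e" "c = d" "d + e + f = 0" by blast+
  then show "0 = 2 * (a + b + d) \<and> 0 = 2 * (a + c + e) \<and> 0 = 2 * (b + c + f) \<and> 2 * a = 2 * f \<and>
      2 * b = 2 * e \<and> 2 * c = 2 * d \<and> 2 * (d + e + f) = 2 * 0"
    by (simp add: ac_simps)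
qed simp

lemma ricci_flat_Lsc:
  assumes inv: "diagram_involution 7 (Lsc lam) \<sigma>" and g: "sigma_diagonal 7 \<sigma> g"
  defines "X \<equiv> arrow_val (Lsc lam) \<sigma> g"
  shows "ricci_flat 7 (Lsc lam) (sdmetric \<sigma> g) \<longleftrightarrow>
    X 1 2 4 = X 3 4 7 \<and> X 1 3 5 = X 2 5 7 \<and> X 2 3 6 = X 1 6 7 \<and> X 1 6 7 + X 2 5 7 + X 3 4 7 = 0"
proof -
  interpret diagonal_nice 7 "Lsc lam" \<sigma> g level by (rule diagonal_nice_Lsc[OF inv g])
  have zero: "X i j k = 0" if "(i, j, k) \<notin> set support" for i j k
    using support_of[of lam i j k] that by (auto simp: X_def arrow_val_def)
  have sym: "X 2 1 4 = X 1 2 4" "X 3 1 5 = X 1 3 5" "X 3 2 6 = X 2 3 6"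
    "X 6 1 7 = X 1 6 7" "X 5 2 7 = X 2 5 7" "X 4 3 7 = X 3 4 7"
    unfolding X_def by (rule X_sym; simp add: rng7)+
  note eval = rng7 zero sym support_def edges_def
  have ins: "(\<Sum>i\<in>rng 7. \<Sum>j\<in>rng 7. X i j 1) = 0" "(\<Sum>i\<in>rng 7. \<Sum>j\<in>rng 7. X i j 2) = 0"
    "(\<Sum>i\<in>rng 7. \<Sum>j\<in>rng 7. X i j 3) = 0" "(\<Sum>i\<in>rng 7. \<Sum>j\<in>rng 7. X i j 4) = 2 * X 1 2 4"
    "(\<Sum>i\<in>rng 7. \<Sum>j\<in>rng 7. X i j 5) = 2 * X 1 3 5" "(\<Sum>i\<in>rng 7. \<Sum>j\<in>rng 7. X i j 6) = 2 * X 2 3 6"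
    "(\<Sum>i\<in>rng 7. \<Sum>j\<in>rng 7. X i j 7) = 2 * (X 1 6 7 + X 2 5 7 + X 3 4 7)"
    by (simp_all add: eval)
  have outs: "(\<Sum>j\<in>rng 7. \<Sum>k\<in>rng 7. X 1 j k) = X 1 2 4 + X 1 3 5 + X 1 6 7"
    "(\<Sum>j\<in>rng 7. \<Sum>k\<in>rng 7. X 2 j k) = X 1 2 4 + X 2 3 6 + X 2 5 7"
    "(\<Sum>j\<in>rng 7. \<Sum>k\<in>rng 7. X 3 j k) = X 1 3 5 + X 2 3 6 + X 3 4 7"
    "(\<Sum>j\<in>rng 7. \<Sum>k\<in>rng 7. X 4 j k) = X 3 4 7" "(\<Sum>j\<in>rng 7. \<Sum>k\<in>rng 7. X 5 j k) = X 2 5 7"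
    "(\<Sum>j\<in>rng 7. \<Sum>k\<in>rng 7. X 6 j k) = X 1 6 7" "(\<Sum>j\<in>rng 7. \<Sum>k\<in>rng 7. X 7 j k) = 0"
    by (simp_all add: eval)
  have all7: "(\<forall>b\<in>rng 7. P b) \<longleftrightarrow> P 1 \<and> P 2 \<and> P 3 \<and> P 4 \<and> P 5 \<and> P 6 \<and> P 7" for P
    by (simp add: rng7)
  show ?thesis
    unfolding ricci_flat_iff X_def[symmetric] all7 ins outs
    by (rule node_equations)
qed

lemma flat_iff_23_45:
  assumes inv: "diagram_involution 7 (Lsc lam) \<sigma>" and g: "sigma_diagonal 7 \<sigma> g"
    and \<sigma>: "\<forall>i\<in>{1..7}. \<sigma> i = (swp 2 3 \<circ> swp 4 5) i"
  shows "ricci_flat 7 (Lsc lam) (sdmetric \<sigma> g) \<longleftrightarrow>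
    flat_system (lam * (lam - 1)) 1 (g 1) (g 2) (g 4) (g 6) (g 7)"
proof -
  have s: "\<sigma> 1 = 1" "\<sigma> 2 = 3" "\<sigma> 3 = 2" "\<sigma> 4 = 5" "\<sigma> 5 = 4" "\<sigma> 6 = 6" "\<sigma> 7 = 7"
    using \<sigma> unfolding rng7 by (simp_all add: swp_def)
  have gi: "g i \<noteq> 0 \<and> g (\<sigma> i) = g i" if "i \<in> rng 7" for i
    using g that unfolding sigma_diagonal_def by blast
  have gs: "g 3 = g 2" "g 5 = g 4"
    using gi[of 2] gi[of 4] s by (simp_all add: rng7)
  have nz: "g 1 \<noteq> 0" "g 2 \<noteq> 0" "g 4 \<noteq> 0" "g 6 \<noteq> 0" "g 7 \<noteq> 0"
    using gi by (simp_all add: rng7)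
  let ?X = "arrow_val (Lsc lam) \<sigma> g"
  \<comment> \<open>The arrow into the fixed middle node has its sources exchanged by
    \<open>\<sigma>\<close>, hence the minus sign; the factor 1 displays \<open>M\<close> for
    \<open>flat_system_ratios\<close>.\<close>
  have X: "?X 1 2 4 = lam * (lam - 1) * g 4 / (g 1 * g 2)"
    "?X 1 3 5 = lam * (lam - 1) * g 4 / (g 1 * g 2)"
    "?X 2 3 6 = - (1 * g 6 / (g 2 * g 2))"
    "?X 1 6 7 = g 7 / (g 1 * g 6)"
    "?X 2 5 7 = g 7 / (g 2 * g 4)"
    "?X 3 4 7 = g 7 / (g 2 * g 4)"
    by (simp_all add: arrow_val_def s gs algebra_simps power2_eq_square)
  show ?thesis
    unfolding ricci_flat_Lsc[OF inv g] flat_system_ratios[OF nz, symmetric] X by blast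
qed

lemma flat_iff_12_56:
  assumes inv: "diagram_involution 7 (Lsc lam) \<sigma>" and g: "sigma_diagonal 7 \<sigma> g"
    and \<sigma>: "\<forall>i\<in>{1..7}. \<sigma> i = (swp 1 2 \<circ> swp 5 6) i"
  shows "ricci_flat 7 (Lsc lam) (sdmetric \<sigma> g) \<longleftrightarrow>
    flat_system lam ((lam - 1)\<^sup>2) (g 3) (g 1) (g 5) (g 4) (g 7)"
proof -
  have s: "\<sigma> 1 = 2" "\<sigma> 2 = 1" "\<sigma> 3 = 3" "\<sigma> 4 = 4" "\<sigma> 5 = 6" "\<sigma> 6 = 5" "\<sigma> 7 = 7"
    using \<sigma> unfolding rng7 by (simp_all add: swp_def)
  have gi: "g i \<noteq> 0 \<and> g (\<sigma> i) = g i" if "i \<in> rng 7" for i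
    using g that unfolding sigma_diagonal_def by blast
  have gs: "g 2 = g 1" "g 6 = g 5"
    using gi[of 1] gi[of 5] s by (simp_all add: rng7)
  have nz: "g 3 \<noteq> 0" "g 1 \<noteq> 0" "g 5 \<noteq> 0" "g 4 \<noteq> 0" "g 7 \<noteq> 0"
    using gi by (simp_all add: rng7)
  let ?X = "arrow_val (Lsc lam) \<sigma> g"
  have sq: "(1 - lam) * (lam - 1) = - ((lam - 1)\<^sup>2)"
    by (simp add: power2_eq_square algebra_simps)
  have X: "?X 1 3 5 = lam * g 5 / (g 3 * g 1)"
    "?X 2 3 6 = lam * g 5 / (g 3 * g 1)"
    "?X 1 2 4 = - ((lam - 1)\<^sup>2 * g 4 / (g 1 * g 1))"
    "?X 3 4 7 = g 7 / (g 3 * g 4)"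
    "?X 1 6 7 = g 7 / (g 1 * g 5)"
    "?X 2 5 7 = g 7 / (g 1 * g 5)"
    by (simp_all add: arrow_val_def s gs sq mult.commute)
  show ?thesis
    unfolding ricci_flat_Lsc[OF inv g] flat_system_ratios[OF nz, symmetric] X
      add.commute[of "g 7 / (g 1 * g 5) + g 7 / (g 1 * g 5)"] add.assoc[symmetric] by blast
qed

lemma flat_iff_13_46:
  assumes inv: "diagram_involution 7 (Lsc lam) \<sigma>" and g: "sigma_diagonal 7 \<sigma> g"
    and \<sigma>: "\<forall>i\<in>{1..7}. \<sigma> i = (swp 1 3 \<circ> swp 4 6) i"
  shows "ricci_flat 7 (Lsc lam) (sdmetric \<sigma> g) \<longleftrightarrow>
    flat_system (1 - lam) (lam\<^sup>2) (g 2) (g 1) (g 4) (g 5) (g 7)"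
proof -
  have s: "\<sigma> 1 = 3" "\<sigma> 2 = 2" "\<sigma> 3 = 1" "\<sigma> 4 = 6" "\<sigma> 5 = 5" "\<sigma> 6 = 4" "\<sigma> 7 = 7"
    using \<sigma> unfolding rng7 by (simp_all add: swp_def)
  have gi: "g i \<noteq> 0 \<and> g (\<sigma> i) = g i" if "i \<in> rng 7" for i
    using g that unfolding sigma_diagonal_def by blast
  have gs: "g 3 = g 1" "g 6 = g 4"
    using gi[of 1] gi[of 4] s by (simp_all add: rng7)
  have nz: "g 2 \<noteq> 0" "g 1 \<noteq> 0" "g 4 \<noteq> 0" "g 5 \<noteq> 0" "g 7 \<noteq> 0"
    using gi by (simp_all add: rng7)
  let ?X = "arrow_val (Lsc lam) \<sigma> g"
  have X: "?X 1 2 4 = (1 - lam) * g 4 / (g 2 * g 1)"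
    "?X 2 3 6 = (1 - lam) * g 4 / (g 2 * g 1)"
    "?X 1 3 5 = - (lam\<^sup>2 * g 5 / (g 1 * g 1))"
    "?X 2 5 7 = g 7 / (g 2 * g 5)"
    "?X 1 6 7 = g 7 / (g 1 * g 4)"
    "?X 3 4 7 = g 7 / (g 1 * g 4)"
    by (simp_all add: arrow_val_def s gs algebra_simps power2_eq_square)
  show ?thesis
    unfolding ricci_flat_Lsc[OF inv g] flat_system_ratios[OF nz, symmetric] X
      add.commute[of "g 7 / (g 1 * g 4)" "g 7 / (g 2 * g 5)"] by blast
qed

end

text \<open>\<open>f\<close> and \<open>F\<close> are the fixed nodes among \<open>1, 2, 3\<close> and \<open>4, 5, 6\<close>; the pairs \<open>r, r'\<close> and
  \<open>R, R'\<close> are exchanged by \<open>\<sigma>\<close>.\<close>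

locale flat_member =
  fixes lam \<kappa> :: real and \<sigma> :: "nat \<Rightarrow> nat" and f r r' R R' F :: nat
  assumes nodes: "rng 7 = {f, r, r', R, R', F, 7}" and dist: "distinct [f, r, r', R, R', F, 7]"
    and ord: "r < r'" "R < R'"
    and \<sigma>: "\<sigma> f = f" "\<sigma> r = r'" "\<sigma> r' = r" "\<sigma> R = R'" "\<sigma> R' = R" "\<sigma> F = F" "\<sigma> 7 = 7"
    and \<kappa>: "\<kappa> < 0"
    and inv: "diagram_involution 7 (Lsc lam) \<sigma>"
    and flat: "\<And>g. sigma_diagonal 7 \<sigma> g \<Longrightarrow> ricci_flat 7 (Lsc lam) (sdmetric \<sigma> g) \<longleftrightarrow>
      flat_system \<kappa> (- 4 * \<kappa>) (g f) (g r) (g R) (g F) (g 7)"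
begin

declare atLeastAtMost_iff [simp del] One_nat_def [simp del]

lemma diagonal_iff: "sigma_diagonal 7 \<sigma> g \<longleftrightarrow> g f \<noteq> 0 \<and> g r \<noteq> 0 \<and> g R \<noteq> 0 \<and> g F \<noteq> 0 \<and> g 7 \<noteq> 0 \<and>
    g r' = g r \<and> g R' = g R"
  unfolding sigma_diagonal_def nodes by (auto simp: \<sigma>)

lemma ricci_flat_solution:
  "sigma_diagonal 7 \<sigma> g \<and> ricci_flat 7 (Lsc lam) (sdmetric \<sigma> g) \<longleftrightarrow>
    g f \<noteq> 0 \<and> g r \<noteq> 0 \<and> g R \<noteq> 0 \<and> g r' = g r \<and> g R' = g R \<and>
    g 7 = \<kappa> * (g R)\<^sup>2 / g f \<and> g F = - (g r * g R) / (2 * g f)"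
proof (cases "sigma_diagonal 7 \<sigma> g")
  case True
  then have nz: "g f \<noteq> 0" "g r \<noteq> 0" "g R \<noteq> 0" and "g r' = g r" "g R' = g R"
    unfolding diagonal_iff by blast+
  then show ?thesis using True flat[OF True] flat_system_solution[OF nz] by simp
next
  case False
  then show ?thesis unfolding diagonal_iff using \<kappa> by auto
qed

text \<open>Evenly many negative signs among \<open>g f\<close>, \<open>g r\<close>,
  \<open>g R\<close> means a positive product, and the explicit solution then makes
  \<open>g F\<close> negative.\<close>

definition even_signs :: "bool \<Rightarrow> bool \<Rightarrow> bool \<Rightarrow> bool" where
  "even_signs a b d \<longleftrightarrow> ((a \<noteq> b) \<longleftrightarrow> d)"

text \<open>As \<open>\<kappa> < 0\<close>, the coefficients at \<open>f\<close> and
  \<open>7\<close> have opposite signs, so exactly one of these two nodes is in the set.\<close>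

definition negs :: "bool \<Rightarrow> bool \<Rightarrow> bool \<Rightarrow> nat set" where
  "negs a b d = (if a then {f} else {7}) \<union> (if b then {r, r'} else {}) \<union> (if d then {R, R'} else {}) \<union>
     (if even_signs a b d then {F} else {})"

lemma flat_signs:
  assumes "sigma_diagonal 7 \<sigma> g \<and> ricci_flat 7 (Lsc lam) (sdmetric \<sigma> g)"
  shows "g f \<noteq> 0" "g r \<noteq> 0" "g R \<noteq> 0" "g F \<noteq> 0" "g 7 \<noteq> 0" "g r' = g r" "g R' = g R"
    "g 7 < 0 \<longleftrightarrow> \<not> g f < 0" "g F < 0 \<longleftrightarrow> even_signs (g f < 0) (g r < 0) (g R < 0)"
proof -
  note sol = assms[unfolded ricci_flat_solution]
  show nz: "g f \<noteq> 0" "g r \<noteq> 0" "g R \<noteq> 0" "g r' = g r" "g R' = g R" using sol by blast+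
  show "g F \<noteq> 0" "g 7 \<noteq> 0" using assms unfolding diagonal_iff by blast+
  have "g 7 = \<kappa> * (g R)\<^sup>2 / g f" using sol by blast
  then show "g 7 < 0 \<longleftrightarrow> \<not> g f < 0"
    using \<kappa> nz by (auto simp: divide_less_0_iff zero_less_divide_iff mult_less_0_iff zero_less_mult_iff)
  have "g F = - (g r * g R) / (2 * g f)" using sol by blast
  then show "g F < 0 \<longleftrightarrow> even_signs (g f < 0) (g r < 0) (g R < 0)"
    using nz by (cases "g f < 0"; cases "g r < 0"; cases "g R < 0")
      (auto simp: even_signs_def divide_less_0_iff zero_less_divide_iff mult_less_0_iff zero_less_mult_iff)
qed

lemma negative_set:
  assumes "sigma_diagonal 7 \<sigma> g \<and> ricci_flat 7 (Lsc lam) (sdmetric \<sigma> g)"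
  shows "{i\<in>rng 7. g i < 0} = negs (g f < 0) (g r < 0) (g R < 0)"
proof -
  note s = flat_signs[OF assms]
  show ?thesis unfolding negs_def nodes using s(6-9) by auto
qed

text \<open>Each exchanged pair contributes one positive and one negative eigenvalue, and so do
  \<open>f\<close> and \<open>7\<close> together. The sign at \<open>F\<close> alone decides between
  the two signatures.\<close>

lemma signature_flat:
  assumes flat_g: "sigma_diagonal 7 \<sigma> g \<and> ricci_flat 7 (Lsc lam) (sdmetric \<sigma> g)"
  shows "signature 7 (sdmetric \<sigma> g) = (if even_signs (g f < 0) (g r < 0) (g R < 0) then (3, 4) else (4, 3))"
proof -
  interpret diagonal_nice 7 "Lsc lam" \<sigma> g level
    using diagonal_nice_Lsc[OF inv] flat_g by blast
  note s = flat_signs[OF flat_g]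
  have ev: "eigval f = g f" "eigval r = g r" "eigval r' = - g r" "eigval R = g R" "eigval R' = - g R"
    "eigval F = g F" "eigval 7 = g 7"
    using ord s by (simp_all add: eigval_def \<sigma>)
  have card: "card {i\<in>rng 7. P (eigval i)} = (\<Sum>i\<in>{f, r, r', R, R', F, 7}. if P (eigval i) then 1 else 0)" for P
    unfolding nodes card_eq_sum by (rule sum.inter_filter) simp
  have sum: "(\<Sum>i\<in>{f, r, r', R, R', F, 7}. u i) = u f + u r + u r' + u R + u R' + u F + u 7" for u :: "nat \<Rightarrow> nat"
    using dist by simp
  have pos: "0 < x \<longleftrightarrow> \<not> x < 0" if "x \<noteq> 0" for x :: real using that by auto
  show ?thesis
    unfolding signature_sdmetric card[of "\<lambda>x. x > 0"] card[of "\<lambda>x. x < 0"] sum ev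
    using s(8,9) pos[OF s(1)] pos[OF s(2)] pos[OF s(3)] pos[OF s(4)] pos[OF s(5)]
    by (cases "g f < 0"; cases "g r < 0"; cases "g R < 0") (simp_all add: even_signs_def)
qed

lemma flat_metric_exists:
  "\<exists>g. (sigma_diagonal 7 \<sigma> g \<and> ricci_flat 7 (Lsc lam) (sdmetric \<sigma> g)) \<and>
    (g f < 0) = a \<and> (g r < 0) = b \<and> (g R < 0) = d"
proof -
  define x :: real where "x = (if a then - 1 else 1)"
  define y :: real where "y = (if b then - 1 else 1)"
  define z :: real where "z = (if d then - 1 else 1)"
  define g where "g i = (if i = f then x else if i \<in> {r, r'} then y else if i \<in> {R, R'} then z
    else if i = F then - (y * z) / (2 * x) else \<kappa> * z\<^sup>2 / x)" for i
  have g: "g f = x" "g r = y" "g r' = y" "g R = z" "g R' = z" "g F = - (y * z) / (2 * x)" "g 7 = \<kappa> * z\<^sup>2 / x"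
    using dist by (auto simp: g_def)
  show ?thesis
    unfolding ricci_flat_solution by (rule exI[of _ g]) (simp add: g, simp add: x_def y_def z_def)
qed

lemma Sset_eq: "Sset 7 (Lsc lam) \<sigma> p q =
    {negs a b d | a b d. (p, q) = (if even_signs a b d then (3, 4) else (4, 3))}"
proof (rule subset_antisym; rule subsetI)
  fix S assume "S \<in> Sset 7 (Lsc lam) \<sigma> p q"
  then obtain g where g: "sigma_diagonal 7 \<sigma> g \<and> ricci_flat 7 (Lsc lam) (sdmetric \<sigma> g)"
    "S = {i\<in>rng 7. g i < 0}" "signature 7 (sdmetric \<sigma> g) = (p, q)"
    unfolding Sset_def by blast
  have "S = negs (g f < 0) (g r < 0) (g R < 0)" using g(2) negative_set[OF g(1)] by simp
  moreover have "(p, q) = (if even_signs (g f < 0) (g r < 0) (g R < 0) then (3, 4) else (4, 3))"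
    using g(3) signature_flat[OF g(1)] by simp
  ultimately show "S \<in> {negs a b d | a b d. (p, q) = (if even_signs a b d then (3, 4) else (4, 3))}"
    by blast
next
  fix S assume "S \<in> {negs a b d | a b d. (p, q) = (if even_signs a b d then (3, 4) else (4, 3))}"
  then obtain a b d where S: "S = negs a b d" "(p, q) = (if even_signs a b d then (3, 4) else (4, 3))" by blast
  obtain g where g: "sigma_diagonal 7 \<sigma> g \<and> ricci_flat 7 (Lsc lam) (sdmetric \<sigma> g)"
    "(g f < 0) = a" "(g r < 0) = b" "(g R < 0) = d" using flat_metric_exists by blast
  then have "S = {i\<in>rng 7. g i < 0}" "signature 7 (sdmetric \<sigma> g) = (p, q)"
    using negative_set[OF g(1)] signature_flat[OF g(1)] S by simp_all
  then show "S \<in> Sset 7 (Lsc lam) \<sigma> p q" unfolding Sset_def using g(1) by blast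
qed

lemma negs_values:
  "negs True False False = {f}" "negs False True False = {r, r', 7}" "negs False False True = {R, R', 7}"
  "negs True True True = {f, r, r', R, R'}" "negs False False False = {F, 7}"
  "negs True True False = {f, r, r', F}" "negs True False True = {f, R, R', F}"
  "negs False True True = {r, r', R, R', F, 7}"
  by (auto simp: negs_def even_signs_def)

lemma Sset_4_3: "Sset 7 (Lsc lam) \<sigma> 4 3 = {{f}, {r, r', 7}, {R, R', 7}, {f, r, r', R, R'}}"
proof -
  have "Sset 7 (Lsc lam) \<sigma> 4 3 = {negs True False False, negs False True False, negs False False True, negs True True True}"
    unfolding Sset_eq by (auto simp: ex_bool_eq even_signs_def)
  then show ?thesis unfolding negs_values .
qed

lemma Sset_3_4: "Sset 7 (Lsc lam) \<sigma> 3 4 = {{F, 7}, {f, r, r', F}, {f, R, R', F}, {r, r', R, R', F, 7}}"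
proof -
  have "Sset 7 (Lsc lam) \<sigma> 3 4 = {negs False False False, negs True True False, negs True False True, negs False True True}"
    unfolding Sset_eq by (auto simp: ex_bool_eq even_signs_def)
  then show ?thesis unfolding negs_values .
qed

lemma Sset_empty: "(p, q) \<notin> {(4, 3), (3, 4)} \<Longrightarrow> Sset 7 (Lsc lam) \<sigma> p q = {}"
  unfolding Sset_eq by (auto split: if_splits)

end

section \<open>The three members of the family with flat metrics\<close>

context notes atLeastAtMost_iff [simp del] One_nat_def [simp del] begin

lemma diagram_involution_Lsc_swap:
  assumes "lam \<noteq> 0" "lam \<noteq> 1"
    and "(\<forall>i\<in>{1..7}. \<sigma> i = (swp 2 3 \<circ> swp 4 5) i) \<or> (\<forall>i\<in>{1..7}. \<sigma> i = (swp 1 2 \<circ> swp 5 6) i) \<or>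
      (\<forall>i\<in>{1..7}. \<sigma> i = (swp 1 3 \<circ> swp 4 6) i)"
  shows "diagram_involution 7 (Lsc lam) \<sigma>"
proof (rule diagram_involution_LscI[OF assms(1,2)])
  have v: "(\<sigma> 1, \<sigma> 2, \<sigma> 3, \<sigma> 4, \<sigma> 5, \<sigma> 6, \<sigma> 7) \<in>
    {(1, 3, 2, 5, 4, 6, 7), (2, 1, 3, 4, 6, 5, 7), (3, 2, 1, 6, 5, 4, 7)}"
    using assms(3) unfolding rng7 by (elim disjE) (simp_all add: swp_def)
  then consider "\<sigma> 1 = 1" "\<sigma> 2 = 3" "\<sigma> 3 = 2" "\<sigma> 4 = 5" "\<sigma> 5 = 4" "\<sigma> 6 = 6" "\<sigma> 7 = 7"
    | "\<sigma> 1 = 2" "\<sigma> 2 = 1" "\<sigma> 3 = 3" "\<sigma> 4 = 4" "\<sigma> 5 = 6" "\<sigma> 6 = 5" "\<sigma> 7 = 7"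
    | "\<sigma> 1 = 3" "\<sigma> 2 = 2" "\<sigma> 3 = 1" "\<sigma> 4 = 6" "\<sigma> 5 = 5" "\<sigma> 6 = 4" "\<sigma> 7 = 7" by auto
  note cases = this
  have perm: "(\<forall>i\<in>rng 7. \<sigma> i \<in> rng 7 \<and> \<sigma> (\<sigma> i) = i) \<and> (\<exists>i\<in>rng 7. \<sigma> i \<noteq> i)"
    unfolding rng7 by (cases rule: cases) simp_all
  show "\<sigma> i \<in> rng 7" "\<sigma> (\<sigma> i) = i" if "i \<in> rng 7" for i
    using perm that by blast+
  show "\<exists>i\<in>rng 7. \<sigma> i \<noteq> i" using perm by blast
  show "list_all (\<lambda>(i, j, k). (\<sigma> i, \<sigma> j, \<sigma> k) \<in> set support) support"
    by (cases rule: cases) (simp_all add: support_def edges_def)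
qed

lemma flat_member_23_45:
  assumes \<sigma>: "\<forall>i\<in>{1..7}. \<sigma> i = (swp 2 3 \<circ> swp 4 5) i"
  shows "flat_member (1/2) (- 1/4) \<sigma> 1 2 3 4 5 6"
proof
  show inv: "diagram_involution 7 (Lsc (1/2)) \<sigma>" using \<sigma> by (intro diagram_involution_Lsc_swap) auto
  show "ricci_flat 7 (Lsc (1/2)) (sdmetric \<sigma> g) \<longleftrightarrow> flat_system (- 1/4) (- 4 * (- 1/4)) (g 1) (g 2) (g 4) (g 6) (g 7)"
    if "sigma_diagonal 7 \<sigma> g" for g using flat_iff_23_45[OF inv that \<sigma>] by simp
qed (use \<sigma> in \<open>simp_all add: rng7 swp_def\<close>)

lemma flat_member_12_56:
  assumes \<sigma>: "\<forall>i\<in>{1..7}. \<sigma> i = (swp 1 2 \<circ> swp 5 6) i"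
  shows "flat_member (- 1) (- 1) \<sigma> 3 1 2 5 6 4"
proof
  show inv: "diagram_involution 7 (Lsc (- 1)) \<sigma>" using \<sigma> by (intro diagram_involution_Lsc_swap) auto
  show "ricci_flat 7 (Lsc (- 1)) (sdmetric \<sigma> g) \<longleftrightarrow> flat_system (- 1) (- 4 * (- 1)) (g 3) (g 1) (g 5) (g 4) (g 7)"
    if "sigma_diagonal 7 \<sigma> g" for g using flat_iff_12_56[OF inv that \<sigma>] by simp
qed (use \<sigma> in \<open>auto simp: rng7 swp_def\<close>)

lemma flat_member_13_46:
  assumes \<sigma>: "\<forall>i\<in>{1..7}. \<sigma> i = (swp 1 3 \<circ> swp 4 6) i"
  shows "flat_member 2 (- 1) \<sigma> 2 1 3 4 6 5"
proof
  show inv: "diagram_involution 7 (Lsc 2) \<sigma>" using \<sigma> by (intro diagram_involution_Lsc_swap) auto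
  show "ricci_flat 7 (Lsc 2) (sdmetric \<sigma> g) \<longleftrightarrow> flat_system (- 1) (- 4 * (- 1)) (g 2) (g 1) (g 4) (g 5) (g 7)"
    if "sigma_diagonal 7 \<sigma> g" for g using flat_iff_13_46[OF inv that \<sigma>] by simp
qed (use \<sigma> in \<open>auto simp: rng7 swp_def\<close>)

text \<open>Let \<open>p\<close> and \<open>q\<close> be the cyclically oriented products of
  constants along the two exchanged routes to node \<open>7\<close>. Then
  \<open>\<kappa> = - p * q\<close>, and the Jacobi identity gives
  \<open>M = (p + q)\<^sup>2\<close>, so \<open>M = - 4 * \<kappa>\<close> says
  \<open>(p - q)\<^sup>2 = 0\<close>. This is why each quadratic in \<open>lam\<close> has a double
  root.\<close>

lemma flat_members:
  assumes lam: "lam \<noteq> 0" "lam \<noteq> 1"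
  shows "diagram_involution 7 (Lsc lam) \<sigma> \<and>
      (\<exists>g. sigma_diagonal 7 \<sigma> g \<and> ricci_flat 7 (Lsc lam) (sdmetric \<sigma> g)) \<longleftrightarrow>
    (\<forall>i\<in>{1..7}. \<sigma> i = (swp 2 3 \<circ> swp 4 5) i) \<and> lam = 1/2 \<or>
    (\<forall>i\<in>{1..7}. \<sigma> i = (swp 1 2 \<circ> swp 5 6) i) \<and> lam = -1 \<or>
    (\<forall>i\<in>{1..7}. \<sigma> i = (swp 1 3 \<circ> swp 4 6) i) \<and> lam = 2"
    (is "?lhs \<longleftrightarrow> ?rhs")
proof
  assume ?lhs
  then obtain g where inv: "diagram_involution 7 (Lsc lam) \<sigma>" and g: "sigma_diagonal 7 \<sigma> g"
    and flat: "ricci_flat 7 (Lsc lam) (sdmetric \<sigma> g)" by blast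
  have nz: "g i \<noteq> 0" if "i \<in> rng 7" for i using g that unfolding sigma_diagonal_def by blast
  note coeffs = flat_system_coeffs[OF _ nz nz nz nz]
  from diagram_involution_Lsc[OF lam inv] show ?rhs
  proof (elim disjE)
    assume \<sigma>: "\<forall>i\<in>{1..7}. \<sigma> i = (swp 2 3 \<circ> swp 4 5) i"
    have "1 = - 4 * (lam * (lam - 1))"
      by (rule coeffs[OF flat[unfolded flat_iff_23_45[OF inv g \<sigma>]]]) (simp_all add: rng7)
    then have "(2 * lam - 1)\<^sup>2 = 0" by (simp add: power2_eq_square algebra_simps)
    then have "lam = 1/2" by simp
    then show ?rhs using \<sigma> by blast
  next
    assume \<sigma>: "\<forall>i\<in>{1..7}. \<sigma> i = (swp 1 2 \<circ> swp 5 6) i"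
    have "(lam - 1)\<^sup>2 = - 4 * lam"
      by (rule coeffs[OF flat[unfolded flat_iff_12_56[OF inv g \<sigma>]]]) (simp_all add: rng7)
    then have "(lam + 1)\<^sup>2 = 0" by (simp add: power2_eq_square algebra_simps)
    then have "lam = - 1" by simp
    then show ?rhs using \<sigma> by blast
  next
    assume \<sigma>: "\<forall>i\<in>{1..7}. \<sigma> i = (swp 1 3 \<circ> swp 4 6) i"
    have "lam\<^sup>2 = - 4 * (1 - lam)"
      by (rule coeffs[OF flat[unfolded flat_iff_13_46[OF inv g \<sigma>]]]) (simp_all add: rng7)
    then have "(lam - 2)\<^sup>2 = 0" by (simp add: power2_eq_square algebra_simps)
    then have "lam = 2" by simp
    then show ?rhs using \<sigma> by blast
  qed
next
  assume ?rhs
  then obtain \<kappa> f r r' R R' F where "flat_member lam \<kappa> \<sigma> f r r' R R' F"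
    using flat_member_23_45 flat_member_12_56 flat_member_13_46 by blast
  then interpret flat_member lam \<kappa> \<sigma> f r r' R R' F .
  show ?lhs using inv flat_metric_exists[of True True True] by blast
qed

end

theorem theorem4p3:
  shows
  "(\<forall>c \<sigma> g. nice_nilpotent_lie 7 c \<and> nonabelian_sc 7 c \<and> diagram_involution 7 c \<sigma> \<and>
       sigma_diagonal 7 \<sigma> g \<and> ricci_flat 7 c (sdmetric \<sigma> g) \<longrightarrow>
       (\<exists>lam. lam \<noteq> 0 \<and> lam \<noteq> 1 \<and> nice_equivalent 7 c (Lsc lam)))
   \<and> (\<forall>lam. lam \<noteq> 0 \<and> lam \<noteq> 1 \<longrightarrow> nice_nilpotent_lie 7 (Lsc lam) \<and> nonabelian_sc 7 (Lsc lam))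
   \<and> (\<forall>lam \<sigma>. lam \<noteq> 0 \<and> lam \<noteq> 1 \<longrightarrow>
       ((diagram_involution 7 (Lsc lam) \<sigma> \<and>
         (\<exists>g. sigma_diagonal 7 \<sigma> g \<and> ricci_flat 7 (Lsc lam) (sdmetric \<sigma> g)))
        \<longleftrightarrow>
        (((\<forall>i\<in>{1..7}. \<sigma> i = (swp 2 3 \<circ> swp 4 5) i) \<and> lam = 1/2) \<or>
         ((\<forall>i\<in>{1..7}. \<sigma> i = (swp 1 2 \<circ> swp 5 6) i) \<and> lam = -1) \<or>
         ((\<forall>i\<in>{1..7}. \<sigma> i = (swp 1 3 \<circ> swp 4 6) i) \<and> lam = 2))))
   \<and> Sset 7 (Lsc (1/2)) (swp 2 3 \<circ> swp 4 5) 4 3 = {{1}, {2,3,7}, {4,5,7}, {1,2,3,4,5}}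
   \<and> Sset 7 (Lsc (1/2)) (swp 2 3 \<circ> swp 4 5) 3 4 = {{6,7}, {1,2,3,6}, {1,4,5,6}, {2,3,4,5,6,7}}
   \<and> (\<forall>p q. (p,q) \<notin> {(4,3),(3,4)} \<longrightarrow> Sset 7 (Lsc (1/2)) (swp 2 3 \<circ> swp 4 5) p q = {})
   \<and> Sset 7 (Lsc (-1)) (swp 1 2 \<circ> swp 5 6) 4 3 = {{3}, {1,2,7}, {5,6,7}, {1,2,3,5,6}}
   \<and> Sset 7 (Lsc (-1)) (swp 1 2 \<circ> swp 5 6) 3 4 = {{4,7}, {1,2,3,4}, {3,4,5,6}, {1,2,4,5,6,7}}
   \<and> (\<forall>p q. (p,q) \<notin> {(4,3),(3,4)} \<longrightarrow> Sset 7 (Lsc (-1)) (swp 1 2 \<circ> swp 5 6) p q = {})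
   \<and> Sset 7 (Lsc 2) (swp 1 3 \<circ> swp 4 6) 4 3 = {{2}, {1,3,7}, {4,6,7}, {1,2,3,4,6}}
   \<and> Sset 7 (Lsc 2) (swp 1 3 \<circ> swp 4 6) 3 4 = {{5,7}, {1,2,3,5}, {2,4,5,6}, {1,3,4,5,6,7}}
   \<and> (\<forall>p q. (p,q) \<notin> {(4,3),(3,4)} \<longrightarrow> Sset 7 (Lsc 2) (swp 1 3 \<circ> swp 4 6) p q = {})"
proof -
  have Sset_1: "Sset 7 (Lsc (1/2)) (swp 2 3 \<circ> swp 4 5) 4 3 = {{1}, {2,3,7}, {4,5,7}, {1,2,3,4,5}}"
    "Sset 7 (Lsc (1/2)) (swp 2 3 \<circ> swp 4 5) 3 4 = {{6,7}, {1,2,3,6}, {1,4,5,6}, {2,3,4,5,6,7}}"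
    "\<forall>p q. (p,q) \<notin> {(4,3),(3,4)} \<longrightarrow> Sset 7 (Lsc (1/2)) (swp 2 3 \<circ> swp 4 5) p q = {}"
  proof -
    interpret flat_member "1/2" "- 1/4" "swp 2 3 \<circ> swp 4 5" 1 2 3 4 5 6
      by (rule flat_member_23_45) simp
    show "Sset 7 (Lsc (1/2)) (swp 2 3 \<circ> swp 4 5) 4 3 = {{1}, {2,3,7}, {4,5,7}, {1,2,3,4,5}}"
      by (rule Sset_4_3)
    show "Sset 7 (Lsc (1/2)) (swp 2 3 \<circ> swp 4 5) 3 4 = {{6,7}, {1,2,3,6}, {1,4,5,6}, {2,3,4,5,6,7}}"
      by (rule Sset_3_4)
    show "\<forall>p q. (p,q) \<notin> {(4,3),(3,4)} \<longrightarrow> Sset 7 (Lsc (1/2)) (swp 2 3 \<circ> swp 4 5) p q = {}"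
      using Sset_empty by blast
  qed
  have Sset_2: "Sset 7 (Lsc (-1)) (swp 1 2 \<circ> swp 5 6) 4 3 = {{3}, {1,2,7}, {5,6,7}, {1,2,3,5,6}}"
    "Sset 7 (Lsc (-1)) (swp 1 2 \<circ> swp 5 6) 3 4 = {{4,7}, {1,2,3,4}, {3,4,5,6}, {1,2,4,5,6,7}}"
    "\<forall>p q. (p,q) \<notin> {(4,3),(3,4)} \<longrightarrow> Sset 7 (Lsc (-1)) (swp 1 2 \<circ> swp 5 6) p q = {}"
  proof -
    interpret flat_member "-1" "-1" "swp 1 2 \<circ> swp 5 6" 3 1 2 5 6 4
      by (rule flat_member_12_56) simp
    show "Sset 7 (Lsc (-1)) (swp 1 2 \<circ> swp 5 6) 4 3 = {{3}, {1,2,7}, {5,6,7}, {1,2,3,5,6}}"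
      unfolding Sset_4_3 by (simp only: insert_commute)
    show "Sset 7 (Lsc (-1)) (swp 1 2 \<circ> swp 5 6) 3 4 = {{4,7}, {1,2,3,4}, {3,4,5,6}, {1,2,4,5,6,7}}"
      unfolding Sset_3_4 by (simp only: insert_commute)
    show "\<forall>p q. (p,q) \<notin> {(4,3),(3,4)} \<longrightarrow> Sset 7 (Lsc (-1)) (swp 1 2 \<circ> swp 5 6) p q = {}"
      using Sset_empty by blast
  qed
  have Sset_3: "Sset 7 (Lsc 2) (swp 1 3 \<circ> swp 4 6) 4 3 = {{2}, {1,3,7}, {4,6,7}, {1,2,3,4,6}}"
    "Sset 7 (Lsc 2) (swp 1 3 \<circ> swp 4 6) 3 4 = {{5,7}, {1,2,3,5}, {2,4,5,6}, {1,3,4,5,6,7}}"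
    "\<forall>p q. (p,q) \<notin> {(4,3),(3,4)} \<longrightarrow> Sset 7 (Lsc 2) (swp 1 3 \<circ> swp 4 6) p q = {}"
  proof -
    interpret flat_member 2 "-1" "swp 1 3 \<circ> swp 4 6" 2 1 3 4 6 5
      by (rule flat_member_13_46) simp
    show "Sset 7 (Lsc 2) (swp 1 3 \<circ> swp 4 6) 4 3 = {{2}, {1,3,7}, {4,6,7}, {1,2,3,4,6}}"
      unfolding Sset_4_3 by (simp only: insert_commute)
    show "Sset 7 (Lsc 2) (swp 1 3 \<circ> swp 4 6) 3 4 = {{5,7}, {1,2,3,5}, {2,4,5,6}, {1,3,4,5,6,7}}"
      unfolding Sset_3_4 by (simp only: insert_commute)
    show "\<forall>p q. (p,q) \<notin> {(4,3),(3,4)} \<longrightarrow> Sset 7 (Lsc 2) (swp 1 3 \<circ> swp 4 6) p q = {}"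
      using Sset_empty by blast
  qed
  show ?thesis
  proof (intro conjI)
    show "\<forall>c \<sigma> g. nice_nilpotent_lie 7 c \<and> nonabelian_sc 7 c \<and> diagram_involution 7 c \<sigma> \<and>
       sigma_diagonal 7 \<sigma> g \<and> ricci_flat 7 c (sdmetric \<sigma> g) \<longrightarrow>
       (\<exists>lam. lam \<noteq> 0 \<and> lam \<noteq> 1 \<and> nice_equivalent 7 c (Lsc lam))"
      using ricci_flat_imp_family by blast
    show "\<forall>lam. lam \<noteq> 0 \<and> lam \<noteq> 1 \<longrightarrow> nice_nilpotent_lie 7 (Lsc lam) \<and> nonabelian_sc 7 (Lsc lam)"
      using nice_nilpotent_Lsc nonabelian_Lsc by blast
  qed (use flat_members Sset_1 Sset_2 Sset_3 in blast)+
qed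

end
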